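(* Let $N=2$. For every integer $k\ge3$ there exist $n\in\mathbb{N}$ and $p_k>2$ such that $\mu_k(p_k)=\tau_n(p_k)$.
   Context: For $p>1$ and a bounded domain $\Omega\subset\mathbb{R}^2$, $\lambda_1(\Omega;p)$ denotes the first eigenvalue of $-\Delta_p u=-\mathrm{div}(|\nabla u|^{p-2}\nabla u)$ on $\Omega$ with zero Dirichlet boundary conditions. For $n\ge1$, $B_1^{\pi/n}=\{(\rho\cos\theta,\rho\sin\theta):0<\rho<1,\ 0<\theta<\pi/n\}$ and $\tau_n(p)=\lambda_1(B_1^{\pi/n};p)$. The radial eigenvalues $\mu_1(p)<\mu_2(p)<\dots$ on the unit disk are the numbers $\mu$ for which $-(r|u'|^{p-2}u')'=\mu r|u|^{p-2}u$ on $(0,1)$, $u'(0)=0$, $u(1)=0$, has a nontrivial solution, listed in increasing order. *)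

theory Defs
  imports "HOL-Analysis.Analysis"
begin

text \<open>Admissible test functions for the Rayleigh quotient on a domain Omega in R^2:
  continuously differentiable functions with compact support contained in Omega,
  not identically zero. D x is the (Frechet) derivative of u at x; its operator norm
  is the Euclidean norm of the gradient.\<close>
definition admissible ::
  "(real^2) set \<Rightarrow> (real^2 \<Rightarrow> real) \<Rightarrow> (real^2 \<Rightarrow> ((real^2) \<Rightarrow>\<^sub>L real)) \<Rightarrow> bool" where
  "admissible \<Omega> u D \<longleftrightarrow>
     (\<forall>x. (u has_derivative blinfun_apply (D x)) (at x)) \<and>
     continuous_on UNIV D \<and>
     compact (closure {x. u x \<noteq> 0}) \<and> closure {x. u x \<noteq> 0} \<subseteq> \<Omega> \<and>
     (\<exists>x. u x \<noteq> 0)"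

text \<open>First Dirichlet eigenvalue of the p-Laplacian, via its variational characterization
  (infimum of the Rayleigh quotient; C_c^1(Omega) is dense in W_0^{1,p}(Omega)).\<close>
definition lambda1 :: "(real^2) set \<Rightarrow> real \<Rightarrow> real" where
  "lambda1 \<Omega> p = Inf {integral UNIV (\<lambda>x. norm (D x) powr p) / integral UNIV (\<lambda>x. \<bar>u x\<bar> powr p)
                        | u D. admissible \<Omega> u D}"

definition sector :: "nat \<Rightarrow> (real^2) set" where
  "sector n = {x. \<exists>\<rho> \<theta>. 0 < \<rho> \<and> \<rho> < 1 \<and> 0 < \<theta> \<and> \<theta> < pi / real n \<and>
                      x $ 1 = \<rho> * cos \<theta> \<and> x $ 2 = \<rho> * sin \<theta>}"

definition tau :: "nat \<Rightarrow> real \<Rightarrow> real" where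
  "tau n p = lambda1 (sector n) p"

text \<open>|v|^{p-2} v written as sgn v * |v|^{p-1} (well defined also at v = 0).\<close>
definition phi_p :: "real \<Rightarrow> real \<Rightarrow> real" where
  "phi_p p v = sgn v * \<bar>v\<bar> powr (p - 1)"

definition radial_eigenvalue :: "real \<Rightarrow> real \<Rightarrow> bool" where
  "radial_eigenvalue p \<mu> \<longleftrightarrow>
     (\<exists>u u'. continuous_on {0..1} u' \<and>
        (\<forall>r\<in>{0..1}. (u has_real_derivative u' r) (at r within {0..1})) \<and>
        (\<forall>r\<in>{0<..<1}. ((\<lambda>s. s * phi_p p (u' s)) has_real_derivative
                          (- \<mu> * r * phi_p p (u r))) (at r)) \<and>
        u' 0 = 0 \<and> u 1 = 0 \<and> (\<exists>r\<in>{0..1}. u r \<noteq> 0))"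

definition kth_radial_eigenvalue :: "real \<Rightarrow> nat \<Rightarrow> real \<Rightarrow> bool" where
  "kth_radial_eigenvalue p k \<mu> \<longleftrightarrow>
     radial_eigenvalue p \<mu> \<and> finite {\<nu>. radial_eigenvalue p \<nu> \<and> \<nu> < \<mu>} \<and>
     card {\<nu>. radial_eigenvalue p \<nu> \<and> \<nu> < \<mu>} = k - 1"

end

theory Submission
  imports Defs "HOL-Complex_Analysis.Great_Picard"
begin

text \<open>Write \<open>T(p) = \<tau>\<^sub>n(p)\<^sup>1\<^sup>/\<^sup>p\<close>. By scaling, \<open>\<mu>\<^sub>k(p)\<^sup>1\<^sup>/\<^sup>p\<close> is the \<open>k\<close>-th zero \<open>\<nu>\<^sub>k(p)\<close> of the
  radial solution with eigenvalue parameter 1 that starts from 1, and it depends continuously on \<open>p\<close>.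
  As \<open>p \<rightarrow> \<infinity>\<close>, \<open>T(p)\<close> is asymptotically at most the reciprocal inradius \<open>1 + 1 / sin(\<pi>/2n)\<close> of the sector,
  while \<open>\<nu>\<^sub>k(p)\<close> is asymptotically at least \<open>2k - 1\<close>. At \<open>p = 2\<close> the two numbers are zeros of the Bessel
  functions \<open>J\<^sub>n\<close> and \<open>J\<^sub>0\<close>. For \<open>k \<ge> 3\<close> some \<open>n\<close> slightly below \<open>\<pi>(k - 1)\<close> gives \<open>T(2) > \<nu>\<^sub>k(2)\<close> but
  \<open>T(p) < \<nu>\<^sub>k(p)\<close> for large \<open>p\<close>. Continuity of \<open>T\<close> is not needed for the crossing: Lindqvist's
  monotonicity of \<open>p T(p)\<close> suffices, because it excludes downward jumps.\<close>

section \<open>Signed powers\<close>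

text \<open>The limits at infinity compare favourably when 1 + 1 / sin(pi/2n) < 2k - 1, that is
  sin(pi/2n) > 1/(2(k - 1)); this caps n near pi (k - 1). For k = 2 it leaves only n \<le> 2, and
  the first zero of J_2 (5.14) lies below the second zero of J_0 (5.52), so the comparison at p = 2
  fails. For k = 3 the choice n = 6 works. The number 2k - 1 arises because, up to factors tending
  to 1 as p grows, the slope of a radial solution is bounded by its amplitude: it covers length at
  least 1 before the first zero and at least 2 between consecutive zeros. The obstacle in the ODE
  part is that the signed power with exponent 1/(p - 1) is not Lipschitz at 0 for p > 2, while the
  equation is singular at r = 0. Hence existence comes from compactness instead of contraction,
  uniqueness is glued from two local arguments, and dependence on p is obtained along subsequences,
  by compactness together with uniqueness.\<close>

definition spow :: "real \<Rightarrow> real \<Rightarrow> real" where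
  "spow e v = sgn v * \<bar>v\<bar> powr e"

lemma phi_p_eq_spow: "phi_p p = spow (p - 1)"
  by (simp add: fun_eq_iff phi_p_def spow_def)

lemma spow_0 [simp]: "spow e 0 = 0"
  by (simp add: spow_def)

lemma spow_minus [simp]: "spow e (- v) = - spow e v"
  by (simp add: spow_def sgn_minus)

lemma spow_pos: "v > 0 \<Longrightarrow> spow e v = v powr e"
  by (simp add: spow_def)

lemma spow_nonneg: "v \<ge> 0 \<Longrightarrow> spow e v = v powr e"
  by (simp add: spow_def sgn_if)

lemma spow_neg: "v < 0 \<Longrightarrow> spow e v = - ((- v) powr e)"
  by (simp add: spow_def)

lemma spow_1 [simp]: "spow 1 v = v"
  by (simp add: spow_def sgn_if)

lemma abs_spow: "\<bar>spow e v\<bar> = \<bar>v\<bar> powr e"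
  by (simp add: spow_def abs_mult sgn_if)

lemma sgn_spow: "sgn (spow e v) = sgn v"
  by (auto simp: spow_def sgn_mult sgn_if)

lemma spow_eq_0_iff [simp]: "spow e v = 0 \<longleftrightarrow> v = 0"
  by (auto simp: spow_def sgn_if)

lemma spow_pos_iff [simp]: "spow e v > 0 \<longleftrightarrow> v > 0"
  using sgn_spow[of e v] by (auto simp: sgn_if split: if_splits)

lemma spow_neg_iff [simp]: "spow e v < 0 \<longleftrightarrow> v < 0"
  using spow_pos_iff[of e "- v"] by simp

lemma spow_spow: "spow a (spow b v) = spow (b * a) v"
  using sgn_spow[of b v] by (simp add: spow_def abs_mult powr_powr sgn_mult)

lemma spow_inverse: "e \<noteq> 0 \<Longrightarrow> spow (1 / e) (spow e v) = v" "e \<noteq> 0 \<Longrightarrow> spow e (spow (1 / e) v) = v"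
  by (simp_all add: spow_spow)

lemma spow_mult: "spow e (a * b) = spow e a * spow e b"
  by (simp add: spow_def abs_mult powr_mult sgn_mult)

lemma spow_mult_self: "v * spow e v = \<bar>v\<bar> powr (e + 1)"
  by (cases "v = 0") (auto simp: spow_def sgn_if powr_add)

lemma spow_strict_mono: "e > 0 \<Longrightarrow> v < w \<Longrightarrow> spow e v < spow e w"
proof -
  assume "e > 0" "v < w"
  consider "v \<ge> 0" | "v < 0" "w \<ge> 0" | "w < 0" by linarith
  then show ?thesis
  proof cases
    case 1
    then show ?thesis using \<open>e > 0\<close> \<open>v < w\<close> by (simp add: spow_nonneg powr_less_mono2)
  next
    case 2
    then have "spow e v < 0" by simp
    also have "0 \<le> spow e w" using 2 by (simp add: spow_nonneg)
    finally show ?thesis .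
  next
    case 3
    then show ?thesis using \<open>e > 0\<close> \<open>v < w\<close> by (simp add: spow_neg powr_less_mono2)
  qed
qed

lemma spow_mono: "e > 0 \<Longrightarrow> v \<le> w \<Longrightarrow> spow e v \<le> spow e w"
  using spow_strict_mono[of e v w] by (cases "v = w") auto

lemma spow_eq_iff: "e > 0 \<Longrightarrow> spow e v = spow e w \<longleftrightarrow> v = w"
  using spow_strict_mono[of e v w] spow_strict_mono[of e w v] by (cases v w rule: linorder_cases) auto

lemma spow_altdef: "spow e v = (max v 0) powr e - (max (- v) 0) powr e"
  by (auto simp: spow_def max_def sgn_if)

text \<open>Base and exponent vary together, because the exponent p will run through sequences. The
  split into positive and negative parts makes both bases nonnegative, so the base may tend to
  0.\<close>

lemma tendsto_spow:
  assumes "(f \<longlongrightarrow> a) F" "(g \<longlongrightarrow> b) F" "b > 0"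
  shows "((\<lambda>x. spow (g x) (f x)) \<longlongrightarrow> spow b a) F"
  unfolding spow_altdef using assms
  by (intro tendsto_intros tendsto_powr2) auto

lemma continuous_on_spow [continuous_intros]:
  "continuous_on S f \<Longrightarrow> e > 0 \<Longrightarrow> continuous_on S (\<lambda>x. spow e (f x))"
  unfolding continuous_on_def by (auto intro!: tendsto_spow)

lemma has_derivative_abs_powr:
  assumes "a > 1"
  shows "((\<lambda>v. \<bar>v\<bar> powr a) has_real_derivative a * spow (a - 1) v) (at v)"
proof -
  consider "v > 0" | "v < 0" | "v = 0" by linarith
  then show ?thesis
  proof cases
    case 1
    have "((\<lambda>v. v powr a) has_real_derivative a * spow (a - 1) v) (at v)"
      using has_real_derivative_powr[OF 1, of a] 1 by (simp add: spow_pos)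
    then show ?thesis
      by (rule has_field_derivative_transform_within_open[where S = "{0<..}"]) (use 1 in auto)
  next
    case 2
    have "((\<lambda>v. (- v) powr a) has_real_derivative a * spow (a - 1) v) (at v)"
      using 2 by (auto intro!: derivative_eq_intros simp: spow_neg powr_diff)
    then show ?thesis
      by (rule has_field_derivative_transform_within_open[where S = "{..<0}"]) (use 2 in auto)
  next
    case 3
    have "((\<lambda>h. spow (a - 1) h) \<longlongrightarrow> spow (a - 1) 0) (at 0)"
      using assms by (intro tendsto_spow) auto
    moreover have "spow (a - 1) h = (\<bar>0 + h\<bar> powr a - \<bar>0\<bar> powr a) / h" if "h \<noteq> 0" for h
      using that by (auto simp: spow_def powr_diff sgn_if)
    ultimately have "((\<lambda>h. (\<bar>0 + h\<bar> powr a - \<bar>0\<bar> powr a) / h) \<longlongrightarrow> 0) (at 0)"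
      by (subst (asm) Lim_cong_within[OF refl refl refl, where g = "\<lambda>h. (\<bar>0 + h\<bar> powr a - \<bar>0\<bar> powr a) / h"]) auto
    then show ?thesis using 3 by (simp add: DERIV_def)
  qed
qed

lemma has_derivative_spow:
  assumes "v \<noteq> 0"
  shows "((\<lambda>v. spow e v) has_real_derivative e * \<bar>v\<bar> powr (e - 1)) (at v)"
proof (cases "v > 0")
  case True
  have "((\<lambda>v. v powr e) has_real_derivative e * \<bar>v\<bar> powr (e - 1)) (at v)"
    using has_real_derivative_powr[OF True, of e] True by simp
  then show ?thesis
    by (rule has_field_derivative_transform_within_open[where S = "{0<..}"]) (use True in \<open>auto simp: spow_pos\<close>)
next
  case False
  have "((\<lambda>v. - ((- v) powr e)) has_real_derivative e * \<bar>v\<bar> powr (e - 1)) (at v)"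
    using assms False by (auto intro!: derivative_eq_intros simp: powr_diff)
  then show ?thesis
    by (rule has_field_derivative_transform_within_open[where S = "{..<0}"]) (use assms False in \<open>auto simp: spow_neg\<close>)
qed

lemma has_derivative_spow_gt_1:
  assumes "e > 1"
  shows "((\<lambda>v. spow e v) has_real_derivative e * \<bar>v\<bar> powr (e - 1)) (at v)"
proof (cases "v = 0")
  case True
  have "((\<lambda>h. \<bar>h\<bar> powr (e - 1)) \<longlongrightarrow> \<bar>0\<bar> powr (e - 1)) (at (0::real))"
    using assms by (intro tendsto_powr2 tendsto_intros) auto
  moreover have "\<bar>h\<bar> powr (e - 1) = (spow e (0 + h) - spow e 0) / h" if "h \<noteq> 0" for h
    using that by (auto simp: spow_def powr_diff sgn_if)
  ultimately have "((\<lambda>h. (spow e (0 + h) - spow e 0) / h) \<longlongrightarrow> 0) (at 0)"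
    by (subst (asm) Lim_cong_within[OF refl refl refl, where g = "\<lambda>h. (spow e (0 + h) - spow e 0) / h"]) auto
  then show ?thesis using True by (simp add: DERIV_def)
qed (rule has_derivative_spow)

lemma abs_powr_lipschitz:
  fixes x y :: real
  assumes "a > 1" "\<bar>x\<bar> \<le> M" "\<bar>y\<bar> \<le> M"
  shows "\<bar>\<bar>x\<bar> powr a - \<bar>y\<bar> powr a\<bar> \<le> a * M powr (a - 1) * \<bar>x - y\<bar>"
proof -
  have "norm ((\<lambda>v. \<bar>v\<bar> powr a) x - (\<lambda>v. \<bar>v\<bar> powr a) y) \<le> (a * M powr (a - 1)) * norm (x - y)"
  proof (rule field_differentiable_bound[where S = "{-M..M}" and f' = "\<lambda>v. a * spow (a - 1) v"])
    fix z assume "z \<in> {-M..M}"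
    then show "norm (a * spow (a - 1) z) \<le> a * M powr (a - 1)"
      using assms by (auto simp: abs_mult abs_spow intro!: mult_left_mono powr_mono2)
  qed (use assms in \<open>auto intro: has_field_derivative_at_within[OF has_derivative_abs_powr]\<close>)
  then show ?thesis by simp
qed

lemma spow_lipschitz:
  assumes "e \<ge> 1" "\<bar>x\<bar> \<le> M" "\<bar>y\<bar> \<le> M"
  shows "\<bar>spow e x - spow e y\<bar> \<le> e * M powr (e - 1) * \<bar>x - y\<bar>"
proof (cases "e = 1")
  case True
  then show ?thesis using assms by (cases "M = 0") auto
next
  case False
  then have "e > 1" using assms by simp
  have "norm ((\<lambda>v. spow e v) x - (\<lambda>v. spow e v) y) \<le> (e * M powr (e - 1)) * norm (x - y)"
  proof (rule field_differentiable_bound[where S = "{-M..M}" and f' = "\<lambda>v. e * \<bar>v\<bar> powr (e - 1)"])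
    fix z assume "z \<in> {-M..M}"
    then show "norm (e * \<bar>z\<bar> powr (e - 1)) \<le> e * M powr (e - 1)"
      using assms \<open>e > 1\<close> by (auto simp: abs_mult intro!: mult_left_mono powr_mono2)
  qed (use assms \<open>e > 1\<close> in \<open>auto intro: has_field_derivative_at_within[OF has_derivative_spow_gt_1]\<close>)
  then show ?thesis by simp
qed

text \<open>For e < 1 the derivative blows up at 0 and decreases in the modulus, so on a half-line
  at distance m from 0 it is largest at modulus m. Both points lie on one side of 0 so that the
  segment between them avoids 0.\<close>

lemma spow_lipschitz_away:
  assumes "0 < e" "e \<le> 1" "m > 0" "x \<ge> m \<and> y \<ge> m \<or> x \<le> -m \<and> y \<le> -m"
  shows "\<bar>spow e x - spow e y\<bar> \<le> e * m powr (e - 1) * \<bar>x - y\<bar>"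
proof -
  define S where "S = (if x \<ge> m then {m..} else {..-m})"
  have "norm ((\<lambda>v. spow e v) x - (\<lambda>v. spow e v) y) \<le> (e * m powr (e - 1)) * norm (x - y)"
  proof (rule field_differentiable_bound[where S = S and f' = "\<lambda>v. e * \<bar>v\<bar> powr (e - 1)"])
    show "convex S" by (simp add: S_def)
    fix z assume "z \<in> S"
    then have z: "\<bar>z\<bar> \<ge> m" using assms by (auto simp: S_def split: if_splits)
    then show "norm (e * \<bar>z\<bar> powr (e - 1)) \<le> e * m powr (e - 1)"
      using assms by (auto simp: abs_mult intro!: mult_left_mono powr_mono2')
    show "(spow e has_real_derivative e * \<bar>z\<bar> powr (e - 1)) (at z within S)"
      using z assms by (intro has_field_derivative_at_within[OF has_derivative_spow]) auto
  qed (use assms in \<open>auto simp: S_def\<close>)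
  then show ?thesis by simp
qed

text \<open>exp(-C x) N(x) is nonincreasing and starts from 0.\<close>

lemma gronwall_zero:
  fixes N :: "real \<Rightarrow> real"
  assumes "a \<le> b" "continuous_on {a..b} N" "N a = 0" "\<And>x. x \<in> {a..b} \<Longrightarrow> N x \<ge> 0"
    and d: "\<And>x. x \<in> {a<..<b} \<Longrightarrow> (N has_real_derivative N' x) (at x)"
    and le: "\<And>x. x \<in> {a<..<b} \<Longrightarrow> N' x \<le> C * N x"
    and x: "x \<in> {a..b}"
  shows "N x = 0"
proof -
  have "exp (- C * x) * N x \<le> exp (- C * a) * N a"
  proof (rule DERIV_nonpos_imp_decreasing_open[where f = "\<lambda>x. exp (- C * x) * N x"])
    show "a \<le> x" using x by simp
    show "continuous_on {a..x} (\<lambda>x. exp (- C * x) * N x)"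
      using x by (intro continuous_intros continuous_on_subset[OF assms(2)]) auto
    fix t assume t: "a < t" "t < x"
    then have "((\<lambda>x. exp (- C * x) * N x) has_real_derivative exp (- C * t) * (N' t - C * N t)) (at t)"
      using x by (auto intro!: derivative_eq_intros d simp: algebra_simps)
    moreover have "exp (- C * t) * (N' t - C * N t) \<le> 0"
      using le[of t] t x by (intro mult_nonneg_nonpos) auto
    ultimately show "\<exists>y. ((\<lambda>x. exp (- C * x) * N x) has_real_derivative y) (at t) \<and> y \<le> 0" by blast
  qed
  then have "N x \<le> 0" using assms(3) by (simp add: mult_le_0_iff)
  then show ?thesis using assms(4)[OF x] by simp
qed

section \<open>Radial solutions and their energy\<close>

text \<open>The length R is a parameter because scaling trades the eigenvalue on the unit interval
  for the length of the interval at \<mu> = 1. No condition is imposed at R.\<close>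

definition rsol :: "real \<Rightarrow> real \<Rightarrow> real \<Rightarrow> (real \<Rightarrow> real) \<Rightarrow> (real \<Rightarrow> real) \<Rightarrow> bool" where
  "rsol p \<mu> R u u' \<longleftrightarrow>
     continuous_on {0..R} u' \<and>
     (\<forall>r\<in>{0..R}. (u has_real_derivative u' r) (at r within {0..R})) \<and>
     (\<forall>r\<in>{0<..<R}. ((\<lambda>s. s * phi_p p (u' s)) has_real_derivative (- \<mu> * r * phi_p p (u r))) (at r)) \<and>
     u' 0 = 0"

lemma radial_eigenvalue_rsol:
  "radial_eigenvalue p \<mu> \<longleftrightarrow> (\<exists>u u'. rsol p \<mu> 1 u u' \<and> u 1 = 0 \<and> (\<exists>r\<in>{0..1}. u r \<noteq> 0))"
  by (auto simp: radial_eigenvalue_def rsol_def)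

lemma rsol_continuous:
  assumes "rsol p \<mu> R u u'"
  shows "continuous_on {0..R} u" "continuous_on {0..R} u'"
  using assms unfolding rsol_def by (auto intro!: DERIV_continuous_on)

lemma rsol_deriv:
  assumes "rsol p \<mu> R u u'" "0 < r" "r < R"
  shows "(u has_real_derivative u' r) (at r)"
    "((\<lambda>s. s * spow (p - 1) (u' s)) has_real_derivative (- \<mu> * r * spow (p - 1) (u r))) (at r)"
proof -
  have "(u has_real_derivative u' r) (at r within {0..R})"
    using assms by (auto simp: rsol_def)
  moreover have "at r within {0..R} = at r"
    by (rule at_within_interior) (use assms in auto)
  ultimately show "(u has_real_derivative u' r) (at r)" by simp
  show "((\<lambda>s. s * spow (p - 1) (u' s)) has_real_derivative (- \<mu> * r * spow (p - 1) (u r))) (at r)"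
    using assms by (auto simp: rsol_def phi_p_eq_spow)
qed

lemma rsol_scale:
  assumes u: "rsol p \<mu> R u u'" and "c > 0" "p > 1"
  shows "rsol p (\<mu> / c powr p) (R * c) (\<lambda>s. a * u (s / c)) (\<lambda>s. a / c * u' (s / c))"
  unfolding rsol_def
proof (intro conjI ballI)
  have m: "s / c \<in> {0..R}" if "s \<in> {0..R * c}" for s
    using that \<open>c > 0\<close> by (auto simp: field_simps)
  have "continuous_on {0..R * c} (u' \<circ> (\<lambda>s. s / c))"
  proof (rule continuous_on_compose)
    show "continuous_on {0..R * c} (\<lambda>s. s / c)"
      using \<open>c > 0\<close> by (intro continuous_intros) auto
    show "continuous_on ((\<lambda>s. s / c) ` {0..R * c}) u'"
      by (rule continuous_on_subset[OF rsol_continuous(2)[OF u]]) (use m in blast)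
  qed
  then show "continuous_on {0..R * c} (\<lambda>s. a / c * u' (s / c))"
    unfolding o_def by (rule continuous_on_mult_left)
  show "a / c * u' (0 / c) = 0" using u by (simp add: rsol_def)
  fix r
  {
    assume r: "r \<in> {0..R * c}"
    have "((\<lambda>s. u (s / c)) has_real_derivative u' (r / c) * (1 / c)) (at r within {0..R * c})"
    proof (rule DERIV_image_chain[unfolded o_def, where f = u and g = "\<lambda>s. s / c"])
      show "((\<lambda>s. s / c) has_real_derivative 1 / c) (at r within {0..R * c})"
        using \<open>c > 0\<close> by (auto intro!: derivative_eq_intros)
      have "(u has_real_derivative u' (r / c)) (at (r / c) within {0..R})"
        using u m[OF r] by (simp add: rsol_def)
      then show "(u has_real_derivative u' (r / c)) (at (r / c) within (\<lambda>s. s / c) ` {0..R * c})"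
        by (rule has_field_derivative_subset) (use m in blast)
    qed
    from DERIV_cmult[OF this, of a]
    show "((\<lambda>s. a * u (s / c)) has_real_derivative a / c * u' (r / c)) (at r within {0..R * c})"
      by simp
  }
  assume "r \<in> {0<..<R * c}"
  then have r: "0 < r / c" "r / c < R" using \<open>c > 0\<close> by (auto simp: field_simps)
  have "((\<lambda>s. (s / c) * spow (p - 1) (u' (s / c))) has_real_derivative
          (- \<mu> * (r / c) * spow (p - 1) (u (r / c))) * (1 / c)) (at r)"
    by (rule DERIV_chain'[where f = "\<lambda>s. s / c" and g = "\<lambda>s. s * spow (p - 1) (u' s)"])
       (use rsol_deriv(2)[OF u r] \<open>c > 0\<close> in \<open>auto intro!: derivative_eq_intros\<close>)
  note d = DERIV_cmult[OF this, of "c * spow (p - 1) (a / c)"]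
  have 1: "(\<lambda>s. s * phi_p p (a / c * u' (s / c))) =
      (\<lambda>s. c * spow (p - 1) (a / c) * (s / c * spow (p - 1) (u' (s / c))))"
    unfolding phi_p_eq_spow spow_mult[of "p - 1" "a / c"] using \<open>c > 0\<close> by auto
  have "spow (p - 1) a = spow (p - 1) (a / c) * c powr (p - 1)"
    using \<open>c > 0\<close> spow_mult[of "p - 1" "a / c" c] by (simp add: spow_pos)
  moreover have "c powr p = c * c powr (p - 1)"
    using \<open>c > 0\<close> by (simp add: powr_diff)
  moreover have "c powr (p - 1) \<noteq> 0" using \<open>c > 0\<close> by simp
  ultimately have 2: "- (\<mu> / c powr p) * r * phi_p p (a * u (r / c)) =
      c * spow (p - 1) (a / c) * ((- \<mu> * (r / c) * spow (p - 1) (u (r / c))) * (1 / c))"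
    unfolding phi_p_eq_spow spow_mult[of "p - 1" a] using \<open>c > 0\<close> by simp
  show "((\<lambda>s. s * phi_p p (a / c * u' (s / c))) has_real_derivative
          - (\<mu> / c powr p) * r * phi_p p (a * u (r / c))) (at r)"
    unfolding 1 2 by (rule d)
qed

text \<open>With a = u and b = u', this is the first integral of the equation
  \<open>(phi_p p u')' + phi_p p u = 0\<close>, which lacks the damping term of the radial
  equation.\<close>

definition energy :: "real \<Rightarrow> real \<Rightarrow> real \<Rightarrow> real" where
  "energy p a b = (p - 1) / p * \<bar>b\<bar> powr p + \<bar>a\<bar> powr p / p"

lemma energy_nonneg: "p > 1 \<Longrightarrow> energy p a b \<ge> 0"
  by (simp add: energy_def)

lemma energy_eq_0_iff: "p > 1 \<Longrightarrow> energy p a b = 0 \<longleftrightarrow> a = 0 \<and> b = 0"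
  by (auto simp: energy_def add_nonneg_eq_0_iff)

lemma continuous_on_energy:
  assumes "rsol p \<mu> R u u'" "p > 1"
  shows "continuous_on {0..R} (\<lambda>r. energy p (u r) (u' r))"
  unfolding energy_def using assms(2)
  by (intro continuous_intros rsol_continuous[OF assms(1)] continuous_on_powr') auto

text \<open>The damping term dissipates the energy. As u' itself may fail to be differentiable where
  it vanishes, its p-th power is written as the q-th power of the differentiable function
  \<open>Y s / s\<close>, with q the conjugate exponent.\<close>

lemma energy_deriv:
  assumes u: "rsol p 1 R u u'" and "p > 1" and r: "0 < r" "r < R"
  shows "((\<lambda>r. energy p (u r) (u' r)) has_real_derivative - (\<bar>u' r\<bar> powr p / r)) (at r)"
proof -
  define q where "q = p / (p - 1)"
  have q: "q > 1" "q - 1 = 1 / (p - 1)" "(p - 1) * q = p" "(p - 1) / p * q = 1"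
    using \<open>p > 1\<close> by (auto simp: q_def field_simps)
  define Y where "Y = (\<lambda>s. s * spow (p - 1) (u' s))"
  have dY: "(Y has_real_derivative - r * spow (p - 1) (u r)) (at r)"
    using rsol_deriv(2)[OF u r] by (simp add: Y_def)
  have "((\<lambda>s. Y s / s) has_real_derivative - spow (p - 1) (u r) - spow (p - 1) (u' r) / r) (at r)"
  proof -
    have "((\<lambda>s. Y s / s) has_real_derivative (- r * spow (p - 1) (u r) * r - Y r * 1) / (r * r)) (at r)"
      by (rule DERIV_divide[OF dY DERIV_ident]) (use r in simp)
    moreover have "(- r * spow (p - 1) (u r) * r - Y r * 1) / (r * r) = - spow (p - 1) (u r) - spow (p - 1) (u' r) / r"
      using r by (simp add: Y_def field_simps)
    ultimately show ?thesis by metis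
  qed
  from DERIV_chain2[OF has_derivative_abs_powr[OF q(1)] this]
  have "((\<lambda>s. \<bar>Y s / s\<bar> powr q) has_real_derivative
      q * u' r * (- spow (p - 1) (u r) - spow (p - 1) (u' r) / r)) (at r)"
    using r \<open>p > 1\<close> by (simp add: q Y_def spow_inverse)
  then have 1: "((\<lambda>s. \<bar>u' s\<bar> powr p) has_real_derivative
      q * u' r * (- spow (p - 1) (u r) - spow (p - 1) (u' r) / r)) (at r)"
    by (rule has_field_derivative_transform_within_open[where S = "{0<..}"])
       (use r in \<open>auto simp: Y_def abs_spow powr_powr q\<close>)
  have 2: "((\<lambda>s. \<bar>u s\<bar> powr p) has_real_derivative p * spow (p - 1) (u r) * u' r) (at r)"
    by (rule DERIV_chain2[OF has_derivative_abs_powr[OF \<open>p > 1\<close>] rsol_deriv(1)[OF u r]])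
  have "(p - 1) / p * (q * u' r * (- spow (p - 1) (u r) - spow (p - 1) (u' r) / r))
      + p * spow (p - 1) (u r) * u' r / p = ((p - 1) / p * q) * (u' r * (- spow (p - 1) (u r) - spow (p - 1) (u' r) / r)) + spow (p - 1) (u r) * u' r"
    using \<open>p > 1\<close> by simp
  also have "\<dots> = - (u' r * spow (p - 1) (u' r)) / r"
    by (subst q(4)) (use r in \<open>simp add: field_simps\<close>)
  finally have "(p - 1) / p * (q * u' r * (- spow (p - 1) (u r) - spow (p - 1) (u' r) / r))
      + p * spow (p - 1) (u r) * u' r / p = - (\<bar>u' r\<bar> powr p / r)"
    by (simp add: spow_mult_self)
  with DERIV_add[OF DERIV_cmult[OF 1, of "(p - 1) / p"] DERIV_cdivide[OF 2, of p]]
  show ?thesis by (simp add: energy_def)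
qed

lemma energy_antimono:
  assumes u: "rsol p 1 R u u'" and "p > 1" and r: "0 \<le> r" "r \<le> s" "s \<le> R"
  shows "energy p (u s) (u' s) \<le> energy p (u r) (u' r)"
proof (rule DERIV_nonpos_imp_decreasing_open[where f = "\<lambda>r. energy p (u r) (u' r)"])
  show "continuous_on {r..s} (\<lambda>r. energy p (u r) (u' r))"
    by (rule continuous_on_subset[OF continuous_on_energy[OF u \<open>p > 1\<close>]]) (use r in auto)
  fix t assume "r < t" "t < s"
  then have t: "0 < t" "t < R" using r by auto
  have "- (\<bar>u' t\<bar> powr p / t) \<le> 0" using t by simp
  then show "\<exists>y. ((\<lambda>r. energy p (u r) (u' r)) has_real_derivative y) (at t) \<and> y \<le> 0"
    using energy_deriv[OF u \<open>p > 1\<close> t] by blast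
qed (use r in auto)

text \<open>The dissipation is at most q/r times the energy, q = p/(p - 1), so the energy decays no
  faster than the power -q of r: in the derivative of the product the terms in u' cancel and a
  nonnegative term in u remains. Thus vanishing energy propagates towards 0.\<close>

lemma energy_lower:
  assumes u: "rsol p 1 R u u'" and "p > 1" and r: "0 < r" "r \<le> s" "s \<le> R"
  shows "r powr (p / (p - 1)) * energy p (u r) (u' r) \<le> s powr (p / (p - 1)) * energy p (u s) (u' s)"
proof (rule DERIV_nonneg_imp_increasing_open[where f = "\<lambda>r. r powr (p / (p - 1)) * energy p (u r) (u' r)"])
  show "continuous_on {r..s} (\<lambda>r. r powr (p / (p - 1)) * energy p (u r) (u' r))"
    by (intro continuous_intros continuous_on_subset[OF continuous_on_energy[OF u \<open>p > 1\<close>]]) (use r in auto)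
  fix t assume "r < t" "t < s"
  then have t: "0 < t" "t < R" using r by auto
  define q where "q = p / (p - 1)"
  have q: "q * ((p - 1) / p) = 1" "q > 0" using \<open>p > 1\<close> by (auto simp: q_def)
  have d: "((\<lambda>r. r powr q * energy p (u r) (u' r)) has_real_derivative
      t powr q * (- (\<bar>u' t\<bar> powr p / t)) + (q * t powr (q - 1)) * energy p (u t) (u' t)) (at t)"
    using t by (auto intro!: derivative_eq_intros energy_deriv[OF u \<open>p > 1\<close> t] simp: powr_diff)
  have eq: "t powr q * (- (\<bar>u' t\<bar> powr p / t)) + (q * t powr (q - 1)) * energy p (u t) (u' t)
     = t powr (q - 1) * ((q * ((p - 1) / p) - 1) * \<bar>u' t\<bar> powr p + (q / p) * \<bar>u t\<bar> powr p)"
    using t by (simp add: energy_def powr_diff field_simps)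
  have ge: "t powr (q - 1) * ((q * ((p - 1) / p) - 1) * \<bar>u' t\<bar> powr p + (q / p) * \<bar>u t\<bar> powr p) \<ge> 0"
    unfolding q(1) using q(2) \<open>p > 1\<close> by simp
  show "\<exists>y. ((\<lambda>r. r powr (p / (p - 1)) * energy p (u r) (u' r)) has_real_derivative y) (at t) \<and> y \<ge> 0"
    unfolding q_def[symmetric] using d[unfolded eq] ge by blast
qed (use r in auto)

lemma rsol_abs_le:
  assumes u: "rsol p 1 R u u'" and "p > 1" and r: "0 \<le> r" "r \<le> R"
  shows "\<bar>u r\<bar> \<le> \<bar>u 0\<bar>"
proof -
  have "\<bar>u r\<bar> powr p / p \<le> energy p (u r) (u' r)"
    using \<open>p > 1\<close> by (simp add: energy_def)
  also have "\<dots> \<le> energy p (u 0) (u' 0)"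
    using r by (intro energy_antimono[OF u \<open>p > 1\<close>]) auto
  also have "\<dots> = \<bar>u 0\<bar> powr p / p"
    using u \<open>p > 1\<close> by (simp add: energy_def rsol_def)
  finally have "\<bar>u r\<bar> powr p \<le> \<bar>u 0\<bar> powr p" using \<open>p > 1\<close> by (simp add: field_simps)
  then show ?thesis
    using powr_less_mono2[of p "\<bar>u 0\<bar>" "\<bar>u r\<bar>"] \<open>p > 1\<close> by (meson abs_ge_zero not_le order_less_trans zero_less_one)
qed

text \<open>At a double zero the energy vanishes, hence also at every smaller positive radius, and
  continuity at 0 contradicts \<open>u 0 \<noteq> 0\<close>.\<close>

lemma rsol_simple_zero:
  assumes u: "rsol p 1 R u u'" and "p > 1" and "u 0 \<noteq> 0" and s: "0 \<le> s" "s \<le> R" "u s = 0"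
  shows "u' s \<noteq> 0"
proof
  assume "u' s = 0"
  have "s > 0" using s \<open>u 0 \<noteq> 0\<close> by (cases "s = 0") auto
  have z: "u r = 0" if r: "0 < r" "r \<le> s" for r
  proof -
    have "r powr (p / (p - 1)) * energy p (u r) (u' r) \<le> 0"
      using energy_lower[OF u \<open>p > 1\<close> r(1,2) s(2)] s \<open>u' s = 0\<close> \<open>p > 1\<close> by (simp add: energy_def)
    then have "energy p (u r) (u' r) \<le> 0" using r by (simp add: mult_le_0_iff)
    then show ?thesis
      using energy_nonneg[OF \<open>p > 1\<close>] energy_eq_0_iff[OF \<open>p > 1\<close>] by (metis order_antisym)
  qed
  have "continuous_on {0..s} u"
    by (rule continuous_on_subset[OF rsol_continuous(1)[OF u]]) (use s in auto)
  then have "(u \<longlongrightarrow> u 0) (at 0 within {0..s})"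
    using \<open>s > 0\<close> by (simp add: continuous_on)
  moreover have "\<forall>\<^sub>F r in at 0 within {0..s}. u r = 0"
    using z by (auto simp: eventually_at intro!: exI[of _ 1])
  ultimately have "((\<lambda>_. 0) \<longlongrightarrow> u 0) (at 0 within {0..s})"
    by (rule Lim_transform_eventually)
  moreover have "at 0 within {0..s} \<noteq> bot"
    using \<open>s > 0\<close> by (simp add: at_within_Icc_at_right trivial_limit_at_right_real)
  ultimately have "u 0 = 0"
    using tendsto_unique tendsto_const by metis
  then show False using \<open>u 0 \<noteq> 0\<close> by simp
qed

section \<open>Uniqueness of the initial value problem\<close>

lemma DERIV_square:
  "(f has_real_derivative f') (at x) \<Longrightarrow> ((\<lambda>x. (f x)\<^sup>2) has_real_derivative 2 * f x * f') (at x)"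
  using DERIV_power[of f f' x UNIV 2] by (simp add: mult_ac)

text \<open>First of two local uniqueness arguments, for places where u' is not 0. There the
  first-order system for u and \<open>r * spow (p - 1) (u' r)\<close> is Lipschitz: the inverse
  power is used away from 0, and the power p - 1 is at least 1. Gronwall is applied to the squared
  distance in these two variables.\<close>

lemma rsol_eq_local_lipschitz:
  assumes u: "rsol p 1 R u u'" and v: "rsol p 1 R v v'" and "p \<ge> 2"
    and ab: "0 < a" "a \<le> b" "b \<le> R" and init: "u a = v a" "u' a = v' a"
    and m: "m > 0" "(\<forall>r\<in>{a..b}. spow (p - 1) (u' r) \<ge> m \<and> spow (p - 1) (v' r) \<ge> m) \<or>
      (\<forall>r\<in>{a..b}. spow (p - 1) (u' r) \<le> - m \<and> spow (p - 1) (v' r) \<le> - m)"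
    and x: "x \<in> {a..b}"
  shows "u x = v x"
proof -
  define e where "e = 1 / (p - 1)"
  have e: "0 < e" "e \<le> 1" "(p - 1) * e = 1" using \<open>p \<ge> 2\<close> by (auto simp: e_def field_simps)
  define M where "M = max \<bar>u 0\<bar> \<bar>v 0\<bar>"
  define U V where "U = (\<lambda>r. spow (p - 1) (u' r))" and "V = (\<lambda>r. spow (p - 1) (v' r))"
  have u': "u' r = spow e (U r)" "v' r = spow e (V r)" for r
    using e by (simp_all add: U_def V_def spow_spow)
  define L1 where "L1 = e * m powr (e - 1)"
  define L2 where "L2 = (p - 1) * M powr (p - 1 - 1)"
  have L: "L1 \<ge> 0" "L2 \<ge> 0" using e \<open>p \<ge> 2\<close> by (auto simp: L1_def L2_def)
  define N where "N = (\<lambda>r. (u r - v r)\<^sup>2 + (r * U r - r * V r)\<^sup>2)"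
  define N' where "N' = (\<lambda>r. 2 * (u r - v r) * (u' r - v' r) +
     2 * (r * U r - r * V r) * (- 1 * r * spow (p - 1) (u r) - - 1 * r * spow (p - 1) (v r)))"
  have "N x = 0"
  proof (rule gronwall_zero[where N = N and a = a and b = b and N' = N' and C = "L1 / a + R * L2"])
    have c: "continuous_on {a..b} u" "continuous_on {a..b} u'" "continuous_on {a..b} v" "continuous_on {a..b} v'"
      using ab by (auto intro: continuous_on_subset[OF rsol_continuous(1)[OF u]] continuous_on_subset[OF rsol_continuous(2)[OF u]]
      continuous_on_subset[OF rsol_continuous(1)[OF v]] continuous_on_subset[OF rsol_continuous(2)[OF v]])
    then show "continuous_on {a..b} N"
      unfolding N_def U_def V_def using \<open>p \<ge> 2\<close> by (intro continuous_intros) auto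
    show "N a = 0" using init by (simp add: N_def U_def V_def)
    fix r assume "r \<in> {a<..<b}"
    then have r: "0 < r" "r < R" "a \<le> r" "r \<in> {a..b}" using ab by auto
    show "(N has_real_derivative N' r) (at r)"
      unfolding N_def N'_def U_def V_def
      using DERIV_add[OF DERIV_square[OF DERIV_diff[OF rsol_deriv(1)[OF u r(1,2)] rsol_deriv(1)[OF v r(1,2)]]]
          DERIV_square[OF DERIV_diff[OF rsol_deriv(2)[OF u r(1,2)] rsol_deriv(2)[OF v r(1,2)]]]] .
    have "\<bar>u' r - v' r\<bar> \<le> L1 * \<bar>U r - V r\<bar>"
      unfolding u' L1_def by (rule spow_lipschitz_away) (use e m r in \<open>auto simp: U_def V_def\<close>)
    also have "\<dots> \<le> L1 * (\<bar>r * U r - r * V r\<bar> / a)"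
    proof (intro mult_left_mono L)
      have "a * \<bar>U r - V r\<bar> \<le> r * \<bar>U r - V r\<bar>" using r by (intro mult_right_mono) auto
      also have "\<dots> = \<bar>r * U r - r * V r\<bar>"
        using r by (simp add: abs_mult flip: right_diff_distrib)
      finally show "\<bar>U r - V r\<bar> \<le> \<bar>r * U r - r * V r\<bar> / a" using ab by (simp add: field_simps)
    qed
    finally have 1: "\<bar>u' r - v' r\<bar> \<le> L1 / a * \<bar>r * U r - r * V r\<bar>" by simp
    have "\<bar>spow (p - 1) (v r) - spow (p - 1) (u r)\<bar> \<le> L2 * \<bar>v r - u r\<bar>"
      unfolding L2_def
    proof (rule spow_lipschitz)
      show "\<bar>v r\<bar> \<le> M" "\<bar>u r\<bar> \<le> M"
        using rsol_abs_le[OF u _ less_imp_le[OF r(1)] less_imp_le[OF r(2)]]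
          rsol_abs_le[OF v _ less_imp_le[OF r(1)] less_imp_le[OF r(2)]] \<open>p \<ge> 2\<close>
        by (auto simp: M_def)
    qed (use \<open>p \<ge> 2\<close> in auto)
    then have "r * \<bar>spow (p - 1) (v r) - spow (p - 1) (u r)\<bar> \<le> R * (L2 * \<bar>v r - u r\<bar>)"
      using r by (intro mult_mono) auto
    then have 2: "\<bar>- 1 * r * spow (p - 1) (u r) - - 1 * r * spow (p - 1) (v r)\<bar> \<le> R * L2 * \<bar>u r - v r\<bar>"
      using r by (simp add: abs_mult abs_minus_commute flip: right_diff_distrib)
    let ?d = "\<bar>u r - v r\<bar>" and ?y = "\<bar>r * U r - r * V r\<bar>"
    have "N' r \<le> \<bar>2 * (u r - v r) * (u' r - v' r)\<bar> +
      \<bar>2 * (r * U r - r * V r) * (- 1 * r * spow (p - 1) (u r) - - 1 * r * spow (p - 1) (v r))\<bar>"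
      unfolding N'_def by linarith
    also have "\<dots> \<le> 2 * ?d * (L1 / a * ?y) + 2 * ?y * (R * L2 * ?d)"
      unfolding abs_mult[of "2 * _"] abs_mult[of 2 "_ - _"] by (intro add_mono mult_mono 1 2) auto
    also have "\<dots> = (L1 / a + R * L2) * (2 * ?d * ?y)" by (simp add: algebra_simps)
    also have "\<dots> \<le> (L1 / a + R * L2) * (?d\<^sup>2 + ?y\<^sup>2)"
      by (intro mult_left_mono sum_squares_bound) (use L ab in auto)
    also have "\<dots> = (L1 / a + R * L2) * N r" by (simp add: N_def)
    finally show "N' r \<le> (L1 / a + R * L2) * N r" .
  qed (use ab x in \<open>auto simp: N_def\<close>)
  then show ?thesis by (simp add: N_def sum_power2_eq_zero_iff)
qed

text \<open>The signed power of u'/u satisfies a scalar equation of Riccati type in which u no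
  longer appears. Its nonlinearity has exponent p/(p - 1) > 1, so it is locally Lipschitz even where
  u' = 0.\<close>

lemma riccati_deriv:
  assumes u: "rsol p 1 R u u'" and "p > 1" and r: "0 < r" "r < R" "u r \<noteq> 0"
  shows "((\<lambda>s. spow (p - 1) (u' s / u s)) has_real_derivative
    - 1 - (p - 1) * \<bar>spow (p - 1) (u' r / u r)\<bar> powr (p / (p - 1)) - spow (p - 1) (u' r / u r) / r) (at r)"
proof -
  define Y X where "Y = (\<lambda>s. s * spow (p - 1) (u' s))" and "X = (\<lambda>s. spow (p - 1) (u s))"
  have dY: "(Y has_real_derivative - r * X r) (at r)"
    using rsol_deriv(2)[OF u r(1,2)] by (simp add: Y_def X_def)
  have dX: "(X has_real_derivative (p - 1) * \<bar>u r\<bar> powr (p - 1 - 1) * u' r) (at r)"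
    unfolding X_def by (rule DERIV_chain2[OF has_derivative_spow[OF r(3)] rsol_deriv(1)[OF u r(1,2)]])
  have X0: "X r \<noteq> 0" "r \<noteq> 0" using r by (auto simp: X_def)
  let ?D = "((- r * X r) * (r * X r) - Y r * (1 * X r + ((p - 1) * \<bar>u r\<bar> powr (p - 1 - 1) * u' r) * r)) / ((r * X r) * (r * X r))"
  have "((\<lambda>s. Y s / (s * X s)) has_real_derivative ?D) (at r)"
    by (rule DERIV_divide[OF dY DERIV_mult[OF DERIV_ident dX]]) (use X0 in simp)
  then have *: "((\<lambda>s. spow (p - 1) (u' s / u s)) has_real_derivative ?D) (at r)"
  proof (rule has_field_derivative_transform_within_open[where S = "{0<..}"])
    fix s :: real assume "s \<in> {0<..}"
    then have "Y s / (s * X s) = spow (p - 1) (u' s) / spow (p - 1) (u s)"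
      by (simp add: Y_def X_def)
    also have "\<dots> = spow (p - 1) (u' s / u s)"
    proof (cases "u s = 0")
      case False
      then show ?thesis using spow_mult[of "p - 1" "u' s / u s" "u s"] by (simp add: field_simps)
    qed auto
    finally show "Y s / (s * X s) = spow (p - 1) (u' s / u s)" .
  qed (use r in auto)
  let ?t = "u' r / u r"
  have t: "\<bar>spow (p - 1) ?t\<bar> powr (p / (p - 1)) = \<bar>?t\<bar> powr p"
    using \<open>p > 1\<close> by (simp add: abs_spow powr_powr)
  have Yr: "Y r = r * (spow (p - 1) ?t * X r)"
    using r spow_mult[of "p - 1" ?t "u r"] by (simp add: Y_def X_def)
  have X2: "u r * X r = \<bar>u r\<bar> powr p"
    using spow_mult_self[of "u r" "p - 1"] by (simp add: X_def)
  have "\<bar>u r\<bar> powr (p - 1 - 1) * u r * u r = \<bar>u r\<bar> powr p"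
  proof -
    have "\<bar>u r\<bar> powr (p - 1 - 1) * u r * u r = \<bar>u r\<bar> powr (p - 2) * \<bar>u r\<bar> powr 2"
      using r by (simp add: powr_numeral power2_eq_square)
    also have "\<dots> = \<bar>u r\<bar> powr p" by (subst powr_add[symmetric]) simp
    finally show ?thesis .
  qed
  then have "\<bar>u r\<bar> powr (p - 1 - 1) * u r = X r"
    using X2 r by (metis mult.commute mult_cancel_left)
  then have X3: "\<bar>u r\<bar> powr (p - 1 - 1) * u' r = ?t * X r"
    using r by (simp add: field_simps)
  have "?D = - 1 - spow (p - 1) ?t / r - (p - 1) * (spow (p - 1) ?t * ?t)"
  proof -
    have "(p - 1) * \<bar>u r\<bar> powr (p - 1 - 1) * u' r = (p - 1) * ?t * X r"
      using X3 by (simp only: mult.assoc)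
    then show ?thesis unfolding Yr using X0 by (simp add: field_simps)
  qed
  also have "spow (p - 1) ?t * ?t = \<bar>?t\<bar> powr p"
    using spow_mult_self[of ?t "p - 1"] by (simp add: mult.commute)
  finally have "?D = - 1 - (p - 1) * \<bar>spow (p - 1) ?t\<bar> powr (p / (p - 1)) - spow (p - 1) ?t / r"
    unfolding t by simp
  with * show ?thesis by metis
qed

text \<open>Second local argument, for places where u is not 0, including r = 0. Gronwall for the
  Riccati variables gives equal logarithmic derivatives, so u/v is constant.\<close>

lemma rsol_eq_local_riccati:
  assumes u: "rsol p 1 R u u'" and v: "rsol p 1 R v v'" and "p \<ge> 2"
    and ab: "0 \<le> a" "a \<le> b" "b \<le> R" and init: "u a = v a" "u' a = v' a"
    and nz: "\<And>r. r \<in> {a..b} \<Longrightarrow> u r \<noteq> 0" "\<And>r. r \<in> {a..b} \<Longrightarrow> v r \<noteq> 0"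
    and x: "x \<in> {a..b}"
  shows "u x = v x"
proof -
  define q where "q = p / (p - 1)"
  have q: "q > 1" using \<open>p \<ge> 2\<close> by (simp add: q_def)
  define z w where "z = (\<lambda>s. spow (p - 1) (u' s / u s))" and "w = (\<lambda>s. spow (p - 1) (v' s / v s))"
  have cuv: "continuous_on {a..b} u" "continuous_on {a..b} u'" "continuous_on {a..b} v" "continuous_on {a..b} v'"
    using ab by (auto intro: continuous_on_subset[OF rsol_continuous(1)[OF u]] continuous_on_subset[OF rsol_continuous(2)[OF u]]
      continuous_on_subset[OF rsol_continuous(1)[OF v]] continuous_on_subset[OF rsol_continuous(2)[OF v]])
  have c: "continuous_on {a..b} z" "continuous_on {a..b} w"
    unfolding z_def w_def using \<open>p \<ge> 2\<close> nz by (auto intro!: continuous_intros cuv)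
  obtain M1 where M1: "\<And>r. r \<in> {a..b} \<Longrightarrow> \<bar>z r\<bar> \<le> M1"
    using compact_imp_bounded[OF compact_continuous_image[OF c(1)]] by (force simp: bounded_iff)
  obtain M2 where M2: "\<And>r. r \<in> {a..b} \<Longrightarrow> \<bar>w r\<bar> \<le> M2"
    using compact_imp_bounded[OF compact_continuous_image[OF c(2)]] by (force simp: bounded_iff)
  define M where "M = max M1 M2"
  define L where "L = (p - 1) * (q * M powr (q - 1))"
  define N where "N = (\<lambda>r. (z r - w r)\<^sup>2)"
  define N' where "N' = (\<lambda>r. 2 * (z r - w r) * ((- 1 - (p - 1) * \<bar>z r\<bar> powr q - z r / r) - (- 1 - (p - 1) * \<bar>w r\<bar> powr q - w r / r)))"
  have "z r = w r" if r: "r \<in> {a..b}" for r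
  proof -
    have "N r = 0"
    proof (rule gronwall_zero[where N = N and a = a and b = b and N' = N' and C = "2 * L"])
      show "continuous_on {a..b} N" unfolding N_def by (intro continuous_intros c)
      show "N a = 0" using init by (simp add: N_def z_def w_def)
      fix r assume "r \<in> {a<..<b}"
      then have r: "0 < r" "r < R" "r \<in> {a..b}" using ab by auto
      have dz: "(z has_real_derivative (- 1 - (p - 1) * \<bar>z r\<bar> powr q - z r / r)) (at r)"
        unfolding z_def q_def using riccati_deriv[OF u _ r(1,2) nz(1)[OF r(3)]] \<open>p \<ge> 2\<close> by simp
      have dw: "(w has_real_derivative (- 1 - (p - 1) * \<bar>w r\<bar> powr q - w r / r)) (at r)"
        unfolding w_def q_def using riccati_deriv[OF v _ r(1,2) nz(2)[OF r(3)]] \<open>p \<ge> 2\<close> by simp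
      show "(N has_real_derivative N' r) (at r)"
        unfolding N_def N'_def
        by (rule DERIV_square[OF DERIV_diff[OF dz dw]])
      have *: "\<bar>\<bar>z r\<bar> powr q - \<bar>w r\<bar> powr q\<bar> \<le> q * M powr (q - 1) * \<bar>z r - w r\<bar>"
        by (rule abs_powr_lipschitz) (use q M1[OF r(3)] M2[OF r(3)] in \<open>auto simp: M_def\<close>)
      let ?A = "\<bar>z r\<bar> powr q - \<bar>w r\<bar> powr q"
      have "N' r = - 2 * (p - 1) * ((z r - w r) * ?A) - 2 * (z r - w r)\<^sup>2 / r"
        using r by (simp add: N'_def field_simps power2_eq_square)
      also have "\<dots> \<le> 2 * (p - 1) * (\<bar>z r - w r\<bar> * \<bar>?A\<bar>)"
      proof -
        have "- ((z r - w r) * ?A) \<le> \<bar>z r - w r\<bar> * \<bar>?A\<bar>" by (simp flip: abs_mult)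
        then have "2 * (p - 1) * - ((z r - w r) * ?A) \<le> 2 * (p - 1) * (\<bar>z r - w r\<bar> * \<bar>?A\<bar>)"
          using \<open>p \<ge> 2\<close> by (intro mult_left_mono) auto
        \<comment> \<open>The singular coefficient 1/r enters with a favourable sign and is dropped;
          this is why a = 0 is allowed.\<close>
        moreover have "2 * (z r - w r)\<^sup>2 / r \<ge> 0" using r by simp
        ultimately show ?thesis by linarith
      qed
      also have "\<dots> \<le> 2 * (p - 1) * (\<bar>z r - w r\<bar> * (q * M powr (q - 1) * \<bar>z r - w r\<bar>))"
        using \<open>p \<ge> 2\<close> by (intro mult_left_mono *) auto
      also have "\<dots> = 2 * L * N r"
      proof -
        have "\<bar>z r - w r\<bar> * \<bar>z r - w r\<bar> = N r" by (simp add: N_def power2_eq_square)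
        then show ?thesis by (simp add: L_def mult_ac)
      qed
      finally show "N' r \<le> 2 * L * N r" .
    qed (use ab r in \<open>auto simp: N_def\<close>)
    then show ?thesis by (simp add: N_def)
  qed
  then have eq: "u' r / u r = v' r / v r" if "r \<in> {a..b}" for r
    using that \<open>p \<ge> 2\<close> by (simp add: z_def w_def spow_eq_iff)
  have "u x / v x = u a / v a"
  proof (cases "a = x")
    case False
    show ?thesis
    proof (rule DERIV_isconst_end[where f = "\<lambda>r. u r / v r"])
      show "a < x" using False x by auto
      show "continuous_on {a..x} (\<lambda>r. u r / v r)"
        using nz x by (intro continuous_intros continuous_on_subset[OF cuv(1)] continuous_on_subset[OF cuv(3)]) auto
      fix r assume "a < r" "r < x"
      then have r: "0 < r" "r < R" "r \<in> {a..b}" using ab x by auto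
      have "((\<lambda>r. u r / v r) has_real_derivative (u' r * v r - u r * v' r) / (v r * v r)) (at r)"
        by (rule DERIV_divide[OF rsol_deriv(1)[OF u r(1,2)] rsol_deriv(1)[OF v r(1,2)] nz(2)[OF r(3)]])
      moreover have "u' r * v r - u r * v' r = 0"
        using eq[OF r(3)] nz[OF r(3)] by (simp add: field_simps)
      ultimately show "((\<lambda>r. u r / v r) has_real_derivative 0) (at r)" by simp
    qed
  qed simp
  then show ?thesis using nz[of a] nz[of x] init x ab by (simp add: field_simps)
qed

lemma continuous_on_abs_ge_near:
  fixes f :: "real \<Rightarrow> real"
  assumes "continuous_on {0..R} f" "a \<in> {0..<R}" "f a \<noteq> 0"
  obtains b where "a < b" "b \<le> R" "\<And>x. x \<in> {a..b} \<Longrightarrow> \<bar>f x - f a\<bar> < \<bar>f a\<bar> / 2"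
proof -
  obtain d where d: "d > 0" "\<And>x. x \<in> {0..R} \<Longrightarrow> dist x a < d \<Longrightarrow> dist (f x) (f a) < \<bar>f a\<bar> / 2"
    using assms unfolding continuous_on_iff
    by (metis atLeastLessThan_iff atLeastAtMost_iff half_gt_zero_iff less_eq_real_def zero_less_abs_iff)
  show ?thesis
  proof (rule that[of "min R (a + d / 2)"])
    fix x assume "x \<in> {a..min R (a + d / 2)}"
    then show "\<bar>f x - f a\<bar> < \<bar>f a\<bar> / 2"
      using d(2)[of x] assms(2) d(1) by (auto simp: dist_real_def)
  qed (use assms d in auto)
qed

text \<open>Continuation past the supremum a of the interval of agreement: if u(a) is not 0 the
  Riccati argument applies, and if u(a) = 0 the zero is simple, so the Lipschitz argument
  applies.\<close>

lemma rsol_unique: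
  assumes u: "rsol p 1 R u u'" and v: "rsol p 1 R v v'" and "p \<ge> 2"
    and init: "u 0 = v 0" "u 0 \<noteq> 0" and x: "x \<in> {0..R}"
  shows "u x = v x"
proof -
  define S where "S = {r \<in> {0..R}. \<forall>s\<in>{0..r}. u s = v s}"
  define a where "a = Sup S"
  have "0 \<in> S" using x init by (auto simp: S_def)
  moreover have bdd: "bdd_above S" by (auto simp: S_def bdd_above_def)
  ultimately have "0 \<le> a"
    by (simp add: a_def cSup_upper)
  moreover have "a \<le> R"
    unfolding a_def by (rule cSup_least) (use \<open>0 \<in> S\<close> in \<open>auto simp: S_def\<close>)
  ultimately have a: "0 \<le> a" "a \<le> R" by auto
  have lt: "u s = v s" if "0 \<le> s" "s < a" for s
  proof -
    have "\<exists>r\<in>S. s < r"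
      using that(2) \<open>0 \<in> S\<close> less_cSup_iff[OF _ bdd, of s] unfolding a_def by blast
    then obtain r where "r \<in> S" "s < r" by blast
    then show ?thesis using that by (auto simp: S_def)
  qed
  have cu: "continuous_on {0..R} u" "continuous_on {0..R} u'" "continuous_on {0..R} v" "continuous_on {0..R} v'"
    using rsol_continuous u v by auto
  have lt': "u' s = v' s" if "0 < s" "s < a" for s
  proof -
    have s: "0 < s" "s < R" using that a by auto
    have "(v has_real_derivative u' s) (at s)"
      by (rule has_field_derivative_transform_within_open[OF rsol_deriv(1)[OF u s], where S = "{0<..<a}"])
         (use that lt in auto)
    then show ?thesis using rsol_deriv(1)[OF v s] by (rule DERIV_unique)
  qed
  have eqa: "u a = v a" "u' a = v' a"
  proof -
    have "u a = v a \<and> u' a = v' a"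
    proof (cases "a = 0")
      case True
      then show ?thesis using init u v by (simp add: rsol_def)
    next
      case False
      then have "a > 0" using a by simp
      have *: "f a = g a" if "continuous_on {0..R} f" "continuous_on {0..R} g"
        "\<And>s. 0 < s \<Longrightarrow> s < a \<Longrightarrow> f s = g s" for f g :: "real \<Rightarrow> real"
      proof -
        have "(\<lambda>x. f x - g x) a = 0"
        proof (rule continuous_constant_on_closure[where S = "{0<..<a}" and f = "\<lambda>x. f x - g x"])
          show "continuous_on (closure {0<..<a}) (\<lambda>x. f x - g x)"
            using \<open>a > 0\<close> a by (auto intro!: continuous_intros continuous_on_subset[OF that(1)] continuous_on_subset[OF that(2)])
        qed (use that \<open>a > 0\<close> in auto)
        then show ?thesis by simp
      qed
      show ?thesis using *[OF cu(1,3)] *[OF cu(2,4)] lt lt' by simp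
    qed
    then show "u a = v a" "u' a = v' a" by auto
  qed
  have "a = R"
  proof (rule ccontr)
    assume "a \<noteq> R"
    then have aR: "a < R" using a by simp
    obtain b where b: "a < b" "b \<le> R" "\<And>x. x \<in> {a..b} \<Longrightarrow> u x = v x"
    proof (cases "u a = 0")
      case False
      obtain b1 where b1: "a < b1" "b1 \<le> R" "\<And>x. x \<in> {a..b1} \<Longrightarrow> \<bar>u x - u a\<bar> < \<bar>u a\<bar> / 2"
        using continuous_on_abs_ge_near[OF cu(1), of a] a aR False by auto
      obtain b2 where b2: "a < b2" "b2 \<le> R" "\<And>x. x \<in> {a..b2} \<Longrightarrow> \<bar>v x - v a\<bar> < \<bar>v a\<bar> / 2"
        using continuous_on_abs_ge_near[OF cu(3), of a] a aR False eqa by auto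
      show ?thesis
      proof (rule that[of "min b1 b2"])
        fix x assume x: "x \<in> {a..min b1 b2}"
        show "u x = v x"
        proof (rule rsol_eq_local_riccati[OF u v \<open>p \<ge> 2\<close> a(1) _ _ eqa _ _ x])
          fix r assume "r \<in> {a..min b1 b2}"
          then show "u r \<noteq> 0" "v r \<noteq> 0" using b1(3)[of r] b2(3)[of r] by auto
        qed (use b1 b2 in auto)
      qed (use b1 b2 in auto)
    next
      case True
      have "a > 0" using True init a by (cases "a = 0") auto
      define f g where "f = (\<lambda>r. spow (p - 1) (u' r))" and "g = (\<lambda>r. spow (p - 1) (v' r))"
      have c: "continuous_on {0..R} f" "continuous_on {0..R} g"
        unfolding f_def g_def using \<open>p \<ge> 2\<close> by (intro continuous_intros cu; simp)+
      have "u' a \<noteq> 0" using rsol_simple_zero[OF u _ init(2) a True] \<open>p \<ge> 2\<close> by simp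
      then have fa: "f a \<noteq> 0" "g a = f a" by (auto simp: f_def g_def eqa)
      obtain b1 where b1: "a < b1" "b1 \<le> R" "\<And>x. x \<in> {a..b1} \<Longrightarrow> \<bar>f x - f a\<bar> < \<bar>f a\<bar> / 2"
        using continuous_on_abs_ge_near[OF c(1), of a] a aR fa by auto
      obtain b2 where b2: "a < b2" "b2 \<le> R" "\<And>x. x \<in> {a..b2} \<Longrightarrow> \<bar>g x - g a\<bar> < \<bar>g a\<bar> / 2"
        using continuous_on_abs_ge_near[OF c(2), of a] a aR fa by auto
      show ?thesis
      proof (rule that[of "min b1 b2"])
        fix x assume x: "x \<in> {a..min b1 b2}"
        show "u x = v x"
        proof (rule rsol_eq_local_lipschitz[OF u v \<open>p \<ge> 2\<close> \<open>a > 0\<close> _ _ eqa _ _ x, where m = "\<bar>f a\<bar> / 2"])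
          have *: "\<bar>f r - f a\<bar> < \<bar>f a\<bar> / 2 \<and> \<bar>g r - f a\<bar> < \<bar>f a\<bar> / 2" if "r \<in> {a..min b1 b2}" for r
            using b1(3)[of r] b2(3)[of r] that fa by auto
          show "(\<forall>r\<in>{a..min b1 b2}. \<bar>f a\<bar> / 2 \<le> spow (p - 1) (u' r) \<and> \<bar>f a\<bar> / 2 \<le> spow (p - 1) (v' r)) \<or>
             (\<forall>r\<in>{a..min b1 b2}. spow (p - 1) (u' r) \<le> - (\<bar>f a\<bar> / 2) \<and> spow (p - 1) (v' r) \<le> - (\<bar>f a\<bar> / 2))"
          proof (cases "f a > 0")
            case True
            have "\<bar>f a\<bar> / 2 \<le> f r \<and> \<bar>f a\<bar> / 2 \<le> g r" if "r \<in> {a..min b1 b2}" for r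
              using *[OF that] True by linarith
            then show ?thesis by (simp add: f_def g_def)
          next
            case False
            have "f r \<le> - (\<bar>f a\<bar> / 2) \<and> g r \<le> - (\<bar>f a\<bar> / 2)" if "r \<in> {a..min b1 b2}" for r
              using *[OF that] False by linarith
            then show ?thesis by (simp add: f_def g_def)
          qed
        qed (use b1 b2 fa in auto)
      qed (use b1 b2 in auto)
    qed
    have "b \<in> S"
      using b lt a by (auto simp: S_def not_less) (metis atLeastAtMost_iff linorder_not_less)
    then have "b \<le> a" using cSup_upper[OF _ bdd] by (simp add: a_def)
    then show False using b by simp
  qed
  then show ?thesis using lt[of x] eqa x by (cases "x = a") auto
qed

lemma rsol_zero_start:
  assumes u: "rsol p 1 R u u'" and "p > 1" and "u 0 = 0" and x: "x \<in> {0..R}"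
  shows "u x = 0"
  using rsol_abs_le[OF u \<open>p > 1\<close>, of x] assms by simp

text \<open>Multiplying the equation by u shows that \<open>N\<close> is nondecreasing for \<mu>
  \<le> 0. It vanishes at 0 because of the factor r and at 1 because of the boundary condition, so
  it is constant, u' = 0, and u is identically 0.\<close>

lemma radial_eigenvalue_pos:
  assumes u: "rsol p \<mu> 1 u u'" and "p > 1" and "u 1 = 0" and x: "x \<in> {0..1}" "u x \<noteq> 0"
  shows "\<mu> > 0"
proof (rule ccontr)
  assume "\<not> \<mu> > 0"
  define N where "N = (\<lambda>r. r * spow (p - 1) (u' r) * u r)"
  have cu: "continuous_on {0..1} u" "continuous_on {0..1} u'"
    using rsol_continuous[OF u] by auto
  have cN: "continuous_on {0..1} N"
    unfolding N_def using \<open>p > 1\<close> by (intro continuous_intros cu) auto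
  have dN: "(N has_real_derivative r * (\<bar>u' r\<bar> powr p) - \<mu> * r * \<bar>u r\<bar> powr p) (at r)" if r: "0 < r" "r < 1" for r
  proof -
    have "(N has_real_derivative (- \<mu> * r * spow (p - 1) (u r)) * u r + u' r * (r * spow (p - 1) (u' r))) (at r)"
      unfolding N_def by (rule DERIV_mult[OF rsol_deriv(2)[OF u r] rsol_deriv(1)[OF u r]])
    moreover have "(- \<mu> * r * spow (p - 1) (u r)) * u r + u' r * (r * spow (p - 1) (u' r))
       = r * (u' r * spow (p - 1) (u' r)) - \<mu> * r * (u r * spow (p - 1) (u r))"
      by (simp add: algebra_simps)
    ultimately show ?thesis by (simp add: spow_mult_self)
  qed
  have nn: "- (\<mu> * r * \<bar>u r\<bar> powr p) \<ge> 0" if "0 < r" for r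
    using that \<open>\<not> \<mu> > 0\<close> by (simp add: mult_nonpos_nonneg mult_le_0_iff)
  have mono: "N r \<le> N s" if "0 \<le> r" "r \<le> s" "s \<le> 1" for r s
  proof (rule DERIV_nonneg_imp_increasing_open[where f = N])
    fix t assume "r < t" "t < s"
    then have t: "0 < t" "t < 1" using that by auto
    have "t * \<bar>u' t\<bar> powr p \<ge> 0" using t by simp
    then have "t * \<bar>u' t\<bar> powr p - \<mu> * t * \<bar>u t\<bar> powr p \<ge> 0" using nn[of t] t by linarith
    then show "\<exists>y. (N has_real_derivative y) (at t) \<and> y \<ge> 0" using dN[OF t] by blast
  qed (use that in \<open>auto intro: continuous_on_subset[OF cN]\<close>)
  have N0: "N r = 0" if "0 \<le> r" "r \<le> 1" for r
    using mono[of 0 r] mono[of r 1] that \<open>u 1 = 0\<close> by (simp add: N_def)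
  have u'0: "u' r = 0" if r: "0 < r" "r < 1" for r
  proof -
    have "(N has_real_derivative 0) (at r)"
      by (rule has_field_derivative_transform_within_open[where f = "\<lambda>_. 0" and S = "{0<..<1}"])
         (use r N0 in auto)
    then have "r * \<bar>u' r\<bar> powr p - \<mu> * r * \<bar>u r\<bar> powr p = 0"
      using DERIV_unique dN[OF r] by blast
    moreover have "r * \<bar>u' r\<bar> powr p \<ge> 0" using r by simp
    ultimately have "r * \<bar>u' r\<bar> powr p = 0" using nn[of r] r by linarith
    then show ?thesis using r by simp
  qed
  have "u x = u 1"
  proof (cases "x = 1")
    case False
    show ?thesis
    proof (rule sym, rule DERIV_isconst_end[where f = u])
      show "continuous_on {x..1} u" by (rule continuous_on_subset[OF cu(1)]) (use x in auto)
      fix r assume "x < r" "r < 1"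
      then have r: "0 < r" "r < 1" using x by auto
      then show "(u has_real_derivative 0) (at r)" using rsol_deriv(1)[OF u r] u'0[OF r] by simp
    qed (use False x in auto)
  qed simp
  then show False using \<open>u 1 = 0\<close> x by simp
qed

section \<open>Existence and compactness of solutions\<close>

text \<open>The clamp gives a priori bounds for all approximations; by the energy estimate the limit has modulus
  at most 1, so that the clamp is inactive there.\<close>

definition clamp2 :: "real \<Rightarrow> real" where
  "clamp2 v = max (- 2) (min 2 v)"

lemma abs_clamp2: "\<bar>clamp2 v\<bar> \<le> 2"
  by (auto simp: clamp2_def)

lemma clamp2_id: "\<bar>v\<bar> \<le> 2 \<Longrightarrow> clamp2 v = v"
  by (auto simp: clamp2_def)

lemma continuous_on_clamp2 [continuous_intros]:
  "continuous_on S f \<Longrightarrow> continuous_on S (\<lambda>x. clamp2 (f x))"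
  unfolding clamp2_def by (intro continuous_intros)

lemma tendsto_clamp2: "(f \<longlongrightarrow> a) F \<Longrightarrow> ((\<lambda>x. clamp2 (f x)) \<longlongrightarrow> clamp2 a) F"
  unfolding clamp2_def by (intro tendsto_intros)

text \<open>For a solution f of modulus at most 2 this is \<open>phi_p p (- f' r)\<close>: the
  equation integrated once from 0. Division by zero gives the correct value 0 at r = 0.\<close>

definition flux :: "real \<Rightarrow> (real \<Rightarrow> real) \<Rightarrow> real \<Rightarrow> real" where
  "flux p f r = integral {0..r} (\<lambda>t. t * spow (p - 1) (clamp2 (f t))) / r"

text \<open>Second integration: fixed points solve the clamped initial value problem with value 1
  and slope 0 at the origin.\<close>

definition picard :: "real \<Rightarrow> (real \<Rightarrow> real) \<Rightarrow> real \<Rightarrow> real" where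
  "picard p f r = 1 - integral {0..r} (\<lambda>s. spow (1 / (p - 1)) (flux p f s))"

lemma flux_cong: "(\<And>t. t \<in> {0..r} \<Longrightarrow> f t = g t) \<Longrightarrow> flux p f r = flux p g r"
  unfolding flux_def by (metis (mono_tags, lifting) integral_cong)

lemma picard_cong: 
  assumes "\<And>t. t \<in> {0..r} \<Longrightarrow> f t = g t"
  shows "picard p f r = picard p g r"
proof -
  have "integral {0..r} (\<lambda>s. spow (1 / (p - 1)) (flux p f s)) = integral {0..r} (\<lambda>s. spow (1 / (p - 1)) (flux p g s))"
  proof (rule integral_cong)
    fix s assume "s \<in> {0..r}"
    then have "flux p f s = flux p g s" by (intro flux_cong assms) auto
    then show "spow (1 / (p - 1)) (flux p f s) = spow (1 / (p - 1)) (flux p g s)" by simp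
  qed
  then show ?thesis by (simp add: picard_def)
qed

text \<open>The integral over an empty interval is 0; this supplies the constant past that the
  delayed equation uses below.\<close>

lemma picard_nonpos: "r \<le> 0 \<Longrightarrow> picard p f r = 1"
  by (cases "r = 0") (auto simp: picard_def)

lemma abs_spow_clamp2_le: "p \<ge> 2 \<Longrightarrow> \<bar>spow (p - 1) (clamp2 v)\<bar> \<le> 2 powr (p - 1)"
  unfolding abs_spow using abs_clamp2[of v] by (intro powr_mono2) auto

context
  fixes p R :: real and f :: "real \<Rightarrow> real"
  assumes p: "p \<ge> 2" and f: "continuous_on {0..R} f"
begin

lemma flux_integrand_continuous: "continuous_on {0..R} (\<lambda>t. t * spow (p - 1) (clamp2 (f t)))"
  using p by (intro continuous_intros f) auto

lemma flux_integrand_integrable: "s \<le> R \<Longrightarrow> (\<lambda>t. t * spow (p - 1) (clamp2 (f t))) integrable_on {0..s}"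
  by (rule integrable_continuous_interval, rule continuous_on_subset[OF flux_integrand_continuous]) auto

lemma abs_flux_le:
  assumes "0 \<le> s" "s \<le> R"
  shows "\<bar>flux p f s\<bar> \<le> 2 powr (p - 1) * s"
proof (cases "s = 0")
  case False
  then have "s > 0" using assms by simp
  have "norm (integral {0..s} (\<lambda>t. t * spow (p - 1) (clamp2 (f t)))) \<le> (s * 2 powr (p - 1)) * (s - 0)"
  proof (rule integral_bound)
    show "continuous_on {0..s} (\<lambda>t. t * spow (p - 1) (clamp2 (f t)))"
      by (rule continuous_on_subset[OF flux_integrand_continuous]) (use assms in auto)
    fix t assume "t \<in> {0..s}"
    then show "norm (t * spow (p - 1) (clamp2 (f t))) \<le> s * 2 powr (p - 1)"
      using abs_spow_clamp2_le[OF p, of "f t"] by (simp add: abs_mult mult_mono)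
  qed (use assms in auto)
  then show ?thesis using \<open>s > 0\<close> by (simp add: flux_def field_simps)
qed (simp add: flux_def)

lemma continuous_on_flux: "continuous_on {0..R} (flux p f)"
proof (cases "R > 0")
  case True
  have c: "continuous_on {0..R} (\<lambda>r. integral {0..r} (\<lambda>t. t * spow (p - 1) (clamp2 (f t))))"
    by (intro indefinite_integral_continuous_1 flux_integrand_integrable) auto
  show ?thesis
    unfolding continuous_on_def
  proof
    fix x assume x: "x \<in> {0..R}"
    show "(flux p f \<longlongrightarrow> flux p f x) (at x within {0..R})"
    proof (cases "x = 0")
      case False
      then show ?thesis
        unfolding flux_def using c x by (intro tendsto_intros) (auto simp: continuous_on_def)
    next
      case True
      have "(flux p f \<longlongrightarrow> 0) (at 0 within {0..R})"
      proof (rule Lim_null_comparison)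
        show "\<forall>\<^sub>F s in at 0 within {0..R}. norm (flux p f s) \<le> 2 powr (p - 1) * s"
          using abs_flux_le by (auto simp: eventually_at intro!: exI[of _ 1])
        show "((\<lambda>s. 2 powr (p - 1) * s) \<longlongrightarrow> 0) (at 0 within {0..R})"
          by (auto intro!: tendsto_eq_intros)
      qed
      then show ?thesis using True by (simp add: flux_def)
    qed
  qed
next
  case False
  then have "{0..R} = {} \<or> {0..R} = {0}" by (cases "R = 0") auto
  then show ?thesis by (metis continuous_on_empty continuous_on_sing)
qed

lemma spow_flux_continuous: "continuous_on {0..R} (\<lambda>s. spow (1 / (p - 1)) (flux p f s))"
  using p by (intro continuous_intros continuous_on_flux) auto

text \<open>The bound does not depend on p, since the powers p - 1 and 1/(p - 1) of the clamp
  constant cancel. It gives equicontinuity even when the exponents vary.\<close>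

lemma abs_spow_flux_le:
  assumes "0 \<le> s" "s \<le> R"
  shows "\<bar>spow (1 / (p - 1)) (flux p f s)\<bar> \<le> 2 * max 1 R"
proof -
  have "\<bar>spow (1 / (p - 1)) (flux p f s)\<bar> \<le> (2 powr (p - 1) * s) powr (1 / (p - 1))"
    unfolding abs_spow using abs_flux_le[OF assms] p by (intro powr_mono2) auto
  also have "\<dots> = 2 * s powr (1 / (p - 1))"
    using assms p by (simp add: powr_mult powr_powr)
  also have "s powr (1 / (p - 1)) \<le> max 1 R powr (1 / (p - 1))"
    using assms p by (intro powr_mono2) auto
  also have "max 1 R powr (1 / (p - 1)) \<le> max 1 R powr 1"
    using p by (intro powr_mono) auto
  finally show ?thesis by simp
qed

lemma picard_deriv:
  assumes "r \<in> {0..R}"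
  shows "(picard p f has_real_derivative - spow (1 / (p - 1)) (flux p f r)) (at r within {0..R})"
proof -
  have "((\<lambda>r. integral {0..r} (\<lambda>s. spow (1 / (p - 1)) (flux p f s))) has_real_derivative
     spow (1 / (p - 1)) (flux p f r)) (at r within {0..R})"
    by (rule integral_has_real_derivative[OF spow_flux_continuous assms])
  then show ?thesis
    unfolding picard_def by (auto intro!: derivative_eq_intros)
qed

lemma picard_lipschitz:
  assumes "r \<le> R" "s \<le> R"
  shows "\<bar>picard p f r - picard p f s\<bar> \<le> 2 * max 1 R * \<bar>r - s\<bar>"
proof -
  have eq: "picard p f x = picard p f (max 0 x)" for x
    by (cases "x \<le> 0") (auto simp: picard_nonpos)
  consider "R \<ge> 0" | "R < 0" by linarith
  then show ?thesis
  proof cases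
    case 1
    have "norm (picard p f (max 0 r) - picard p f (max 0 s)) \<le> 2 * max 1 R * norm (max 0 r - max 0 s)"
      by (rule field_differentiable_bound[where S = "{0..R}" and f' = "\<lambda>r. - spow (1 / (p - 1)) (flux p f r)"])
         (use assms picard_deriv abs_spow_flux_le 1 in auto)
    also have "\<dots> \<le> 2 * max 1 R * \<bar>r - s\<bar>"
      by (intro mult_left_mono) auto
    finally show ?thesis using eq[of r] eq[of s] by simp
  qed (use assms in \<open>simp add: picard_nonpos\<close>)
qed

lemma abs_picard_le:
  assumes "r \<in> {0..R}"
  shows "\<bar>picard p f r\<bar> \<le> 1 + 2 * max 1 R * R"
proof -
  have "\<bar>picard p f r - picard p f 0\<bar> \<le> 2 * max 1 R * \<bar>r - 0\<bar>"
    using assms by (intro picard_lipschitz) auto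
  also have "\<dots> \<le> 2 * max 1 R * R" using assms by (intro mult_left_mono) auto
  finally show ?thesis by (simp add: picard_nonpos)
qed

end

section \<open>Limits of the integral operator along varying exponents\<close>

lemma tendsto_flux:
  fixes q :: "nat \<Rightarrow> real"
  assumes q: "q \<longlonglongrightarrow> p" "\<And>j. 2 \<le> q j" "\<And>j. q j \<le> P"
    and f: "\<And>j. continuous_on {0..R} (f j)"
    and lim: "\<And>t. t \<in> {0..R} \<Longrightarrow> (\<lambda>j. f j t) \<longlonglongrightarrow> g t"
    and s: "0 \<le> s" "s \<le> R"
  shows "(\<lambda>j. flux (q j) (f j) s) \<longlonglongrightarrow> flux p g s"
proof -
  have "p \<ge> 2" using q by (intro LIMSEQ_le_const) auto
  have "(\<lambda>j. integral {0..s} (\<lambda>t. t * spow (q j - 1) (clamp2 (f j t)))) \<longlonglongrightarrow>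
      integral {0..s} (\<lambda>t. t * spow (p - 1) (clamp2 (g t)))"
  proof (rule dominated_convergence(2)[where h = "\<lambda>_. s * 2 powr (P - 1)"])
    fix j show "(\<lambda>t. t * spow (q j - 1) (clamp2 (f j t))) integrable_on {0..s}"
      by (rule flux_integrand_integrable[OF q(2) f s(2)])
    fix t assume t: "t \<in> {0..s}"
    have "\<bar>spow (q j - 1) (clamp2 (f j t))\<bar> \<le> 2 powr (P - 1)"
      by (rule order_trans[OF abs_spow_clamp2_le[OF q(2)]]) (use q(3) in \<open>auto intro!: powr_mono\<close>)
    then show "norm (t * spow (q j - 1) (clamp2 (f j t))) \<le> s * 2 powr (P - 1)"
      using t by (simp add: abs_mult mult_mono)
  next
    fix t assume "t \<in> {0..s}"
    then show "(\<lambda>j. t * spow (q j - 1) (clamp2 (f j t))) \<longlonglongrightarrow> t * spow (p - 1) (clamp2 (g t))"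
      using s lim \<open>p \<ge> 2\<close> by (auto intro!: tendsto_mult tendsto_spow tendsto_diff tendsto_clamp2 q(1))
  qed auto
  then show ?thesis
    unfolding flux_def by (cases "s = 0") (auto intro!: tendsto_intros)
qed

lemma tendsto_picard:
  fixes q :: "nat \<Rightarrow> real"
  assumes q: "q \<longlonglongrightarrow> p" "\<And>j. 2 \<le> q j" "\<And>j. q j \<le> P"
    and f: "\<And>j. continuous_on {0..R} (f j)"
    and lim: "\<And>t. t \<in> {0..R} \<Longrightarrow> (\<lambda>j. f j t) \<longlonglongrightarrow> g t"
    and r: "0 \<le> r" "r \<le> R"
  shows "(\<lambda>j. picard (q j) (f j) r) \<longlonglongrightarrow> picard p g r"
proof -
  have "p \<ge> 2" using q by (intro LIMSEQ_le_const) auto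
  have "(\<lambda>j. integral {0..r} (\<lambda>s. spow (1 / (q j - 1)) (flux (q j) (f j) s))) \<longlonglongrightarrow>
      integral {0..r} (\<lambda>s. spow (1 / (p - 1)) (flux p g s))"
  proof (rule dominated_convergence(2)[where h = "\<lambda>_. 2 * max 1 R"])
    fix j show "(\<lambda>s. spow (1 / (q j - 1)) (flux (q j) (f j) s)) integrable_on {0..r}"
      by (rule integrable_continuous_interval, rule continuous_on_subset[OF spow_flux_continuous[OF q(2) f]])
         (use r in auto)
    fix s assume s: "s \<in> {0..r}"
    then show "norm (spow (1 / (q j - 1)) (flux (q j) (f j) s)) \<le> 2 * max 1 R"
      using abs_spow_flux_le[OF q(2) f, of s j] r by auto
  next
    fix s assume s: "s \<in> {0..r}"
    show "(\<lambda>j. spow (1 / (q j - 1)) (flux (q j) (f j) s)) \<longlonglongrightarrow> spow (1 / (p - 1)) (flux p g s)"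
    proof -
      from s have "(\<lambda>j. flux (q j) (f j) s) \<longlonglongrightarrow> flux p g s"
        using r by (intro tendsto_flux[OF q f lim]) auto
      moreover have "(\<lambda>j. 1 / (q j - 1)) \<longlonglongrightarrow> 1 / (p - 1)"
        using \<open>p \<ge> 2\<close> by (intro tendsto_intros q(1)) auto
      ultimately show "(\<lambda>j. spow (1 / (q j - 1)) (flux (q j) (f j) s)) \<longlonglongrightarrow> spow (1 / (p - 1)) (flux p g s)"
        using \<open>p \<ge> 2\<close> by (intro tendsto_spow) auto
    qed
  qed auto
  then show ?thesis unfolding picard_def by (intro tendsto_intros)
qed

text \<open>The arguments \<open>f\<close> and the images \<open>u\<close> are kept apart so that
  one lemma serves twice: with \<open>f j\<close> a delayed copy of \<open>u j\<close> it yields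
  existence, and with \<open>f = u\<close> it yields dependence on the exponent. Arzela-Ascoli gives
  a uniform limit, and the operator passes to the limit by dominated convergence.\<close>

lemma picard_compactness:
  fixes q :: "nat \<Rightarrow> real"
  assumes q: "q \<longlonglongrightarrow> p" "\<And>j. 2 \<le> q j"
    and f: "\<And>j. continuous_on {0..R} (f j)"
    and u: "\<And>j r. r \<in> {0..R} \<Longrightarrow> u j r = picard (q j) (f j) r"
    and lim: "\<And>t. t \<in> {0..R} \<Longrightarrow> (\<lambda>j. f j t - u j t) \<longlonglongrightarrow> 0"
  obtains g k where "continuous_on {0..R} g" "strict_mono (k :: nat \<Rightarrow> nat)"
    "\<And>r. r \<in> {0..R} \<Longrightarrow> g r = picard p g r"
    "\<And>e. 0 < e \<Longrightarrow> \<forall>\<^sub>F j in sequentially. \<forall>x\<in>{0..R}. \<bar>u (k j) x - g x\<bar> < e"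
proof -
  have "Bseq q" using q(1) convergent_imp_Bseq convergent_def by blast
  then obtain P where "\<And>j. norm (q j) \<le> P" by (auto simp: Bseq_def)
  then have P: "q j \<le> P" for j using abs_le_D1 by (metis real_norm_def)
  obtain g k where g: "continuous_on {0..R} g" "strict_mono (k :: nat \<Rightarrow> nat)"
    "\<And>e. 0 < e \<Longrightarrow> \<exists>N. \<forall>n x. n \<ge> N \<and> x \<in> {0..R} \<longrightarrow> norm (u (k n) x - g x) < e"
  proof (rule Arzela_Ascoli[of "{0..R}" u "1 + 2 * max 1 R * R"])
    fix n x assume "x \<in> {0..R}"
    then show "norm (u n x) \<le> 1 + 2 * max 1 R * R"
      using abs_picard_le[OF q(2) f] u by auto
  next
    fix x e :: real assume x: "x \<in> {0..R}" "e > 0"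
    have L: "2 * max 1 R > 0" by simp
    show "\<exists>d>0. \<forall>n y. y \<in> {0..R} \<and> norm (x - y) < d \<longrightarrow> norm (u n x - u n y) < e"
    proof (intro exI[of _ "e / (2 * max 1 R)"] conjI allI impI)
      fix n y assume y: "y \<in> {0..R} \<and> norm (x - y) < e / (2 * max 1 R)"
      have "norm (u n x - u n y) \<le> 2 * max 1 R * \<bar>x - y\<bar>"
        using picard_lipschitz[OF q(2) f, of x y n] u x y by auto
      also have "\<dots> < e" using y L by (simp add: field_simps)
      finally show "norm (u n x - u n y) < e" .
    qed (use x L in auto)
  qed auto
  have unif: "\<forall>\<^sub>F j in sequentially. \<forall>x\<in>{0..R}. \<bar>u (k j) x - g x\<bar> < e" if "e > 0" for e
    using g(3)[OF that] unfolding eventually_sequentially real_norm_def by blast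
  have ptw: "(\<lambda>j. u (k j) x) \<longlonglongrightarrow> g x" if "x \<in> {0..R}" for x
  proof (rule tendstoI)
    fix e :: real assume "e > 0"
    from unif[OF this] show "\<forall>\<^sub>F j in sequentially. dist (u (k j) x) (g x) < e"
      by eventually_elim (use that in \<open>auto simp: dist_real_def\<close>)
  qed
  show ?thesis
  proof (rule that[OF g(1,2) _ unif])
    fix r assume r: "r \<in> {0..R}"
    have "(\<lambda>j. picard (q (k j)) (f (k j)) r) \<longlonglongrightarrow> picard p g r"
    proof (rule tendsto_picard[where R = R and P = P])
      show "(\<lambda>j. q (k j)) \<longlonglongrightarrow> p"
        using LIMSEQ_subseq_LIMSEQ[OF q(1) g(2)] by (simp add: o_def)
      fix t assume t: "t \<in> {0..R}"
      have "(\<lambda>j. f (k j) t - u (k j) t) \<longlonglongrightarrow> 0"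
        using LIMSEQ_subseq_LIMSEQ[OF lim[OF t] g(2)] by (simp add: o_def)
      from tendsto_add[OF this ptw[OF t]] show "(\<lambda>j. f (k j) t) \<longlonglongrightarrow> g t" by simp
    qed (use q(2) P f r in auto)
    then have "(\<lambda>j. u (k j) r) \<longlonglongrightarrow> picard p g r" using u[OF r] by simp
    then show "g r = picard p g r" using ptw[OF r] LIMSEQ_unique by blast
  qed
qed

text \<open>Tonelli's approximation: with the delay \<open>\<epsilon>\<close> the iterates are stationary on \<open>{..j\<epsilon>}\<close>, which solves the
  delayed equation although \<open>spow (1 / (p - 1))\<close> is not Lipschitz at 0.\<close>

primrec tonelli :: "real \<Rightarrow> real \<Rightarrow> nat \<Rightarrow> real \<Rightarrow> real" where
  "tonelli p \<epsilon> 0 = (\<lambda>_. 1)"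
| "tonelli p \<epsilon> (Suc j) = picard p (\<lambda>t. tonelli p \<epsilon> j (t - \<epsilon>))"

lemma continuous_picard:
  assumes "p \<ge> 2" "continuous_on UNIV f"
  shows "continuous_on UNIV (picard p f)"
  unfolding continuous_on_iff
proof (intro ballI allI impI)
  fix x e :: real assume "e > 0"
  define L where "L = 2 * max 1 (x + 1)"
  have "L > 0" by (simp add: L_def)
  show "\<exists>d>0. \<forall>y\<in>UNIV. dist y x < d \<longrightarrow> dist (picard p f y) (picard p f x) < e"
  proof (intro exI[of _ "min 1 (e / L)"] conjI ballI impI)
    fix y assume y: "dist y x < min 1 (e / L)"
    have "\<bar>picard p f y - picard p f x\<bar> \<le> L * \<bar>y - x\<bar>"
      unfolding L_def
      by (rule picard_lipschitz) (use y assms in \<open>auto simp: dist_real_def intro: continuous_on_subset\<close>)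
    also have "\<dots> < e" using y \<open>L > 0\<close> by (simp add: dist_real_def field_simps)
    finally show "dist (picard p f y) (picard p f x) < e" by (simp add: dist_real_def)
  qed (use \<open>e > 0\<close> \<open>L > 0\<close> in auto)
qed

lemma continuous_tonelli: "p \<ge> 2 \<Longrightarrow> continuous_on UNIV (tonelli p \<epsilon> j)"
proof (induction j)
  case (Suc j)
  have "continuous_on UNIV (\<lambda>t. tonelli p \<epsilon> j (t - \<epsilon>))"
    by (rule continuous_on_compose2[OF Suc.IH[OF Suc.prems]]) (auto intro!: continuous_intros)
  then show ?case by (simp add: continuous_picard Suc.prems)
qed simp

lemma tonelli_stable:
  assumes "\<epsilon> > 0"
  shows "r \<le> real j * \<epsilon> \<Longrightarrow> tonelli p \<epsilon> (Suc j) r = tonelli p \<epsilon> j r"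
proof (induction j arbitrary: r)
  case 0
  then show ?case by (simp add: picard_nonpos)
next
  case (Suc j)
  have "picard p (\<lambda>t. tonelli p \<epsilon> (Suc j) (t - \<epsilon>)) r = picard p (\<lambda>t. tonelli p \<epsilon> j (t - \<epsilon>)) r"
    by (rule picard_cong, rule Suc.IH) (use Suc.prems in \<open>auto simp: algebra_simps\<close>)
  then show ?case by simp
qed

lemma picard_fixpoint_exists:
  assumes "p \<ge> 2"
  shows "\<exists>g. continuous_on {0..R} g \<and> (\<forall>r\<in>{0..R}. g r = picard p g r)"
proof -
  define \<epsilon> where "\<epsilon> = (\<lambda>j. 1 / real (Suc j))"
  \<comment> \<open>Enough iterations to make J steps of length \<epsilon> reach R, so that the
    iterate solves the delayed equation on the whole interval.\<close>
  define J where "J = (\<lambda>j. nat \<lceil>R * real (Suc j)\<rceil>)"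
  define u where "u = (\<lambda>j. tonelli p (\<epsilon> j) (J j))"
  define f where "f = (\<lambda>j t. u j (t - \<epsilon> j))"
  have \<epsilon>: "\<epsilon> j > 0" for j by (simp add: \<epsilon>_def)
  have JR: "R \<le> real (J j) * \<epsilon> j" for j
  proof -
    have "R * real (Suc j) \<le> real (J j)" unfolding J_def by linarith
    then show ?thesis by (simp add: \<epsilon>_def field_simps)
  qed
  have u: "u j r = picard p (f j) r" if "r \<le> R" for j r
  proof -
    have "u j r = tonelli p (\<epsilon> j) (Suc (J j)) r"
      unfolding u_def by (rule tonelli_stable[symmetric, OF \<epsilon>]) (use that JR[of j] in linarith)
    then show ?thesis by (simp add: f_def u_def)
  qed
  have f: "continuous_on UNIV (f j)" for j
    unfolding f_def u_def
    by (rule continuous_on_compose2[OF continuous_tonelli[OF assms]]) (auto intro!: continuous_intros)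
  have f': "continuous_on {0..R} (f j)" for j
    using f continuous_on_subset by blast
  have lim: "(\<lambda>j. f j t - u j t) \<longlonglongrightarrow> 0" if t: "t \<in> {0..R}" for t
  proof (rule Lim_null_comparison)
    show "\<forall>\<^sub>F j in sequentially. norm (f j t - u j t) \<le> 2 * max 1 R * \<epsilon> j"
    proof (rule always_eventually, rule allI)
      fix j
      have "t - \<epsilon> j \<le> R" using t \<epsilon>[of j] by simp
      then have "\<bar>picard p (f j) (t - \<epsilon> j) - picard p (f j) t\<bar> \<le> 2 * max 1 R * \<bar>(t - \<epsilon> j) - t\<bar>"
        using t by (intro picard_lipschitz assms f') auto
      moreover have "f j t = picard p (f j) (t - \<epsilon> j)"
        using u[OF \<open>t - \<epsilon> j \<le> R\<close>] by (simp add: f_def)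
      ultimately show "norm (f j t - u j t) \<le> 2 * max 1 R * \<epsilon> j"
        using u[of t j] t \<epsilon>[of j] by simp
    qed
    have "\<epsilon> \<longlonglongrightarrow> 0" unfolding \<epsilon>_def by (rule LIMSEQ_Suc[OF lim_1_over_n])
    then show "(\<lambda>j. 2 * max 1 R * \<epsilon> j) \<longlonglongrightarrow> 0" by (rule tendsto_mult_right_zero)
  qed
  obtain g where "continuous_on {0..R} g" "\<And>r. r \<in> {0..R} \<Longrightarrow> g r = picard p g r"
    by (rule picard_compactness[of "\<lambda>_. p" p R f u]) (use assms f' u lim in auto)
  then show ?thesis by blast
qed

section \<open>From fixed points to radial solutions\<close>

lemma picard_fixpoint_rsol:
  assumes "p \<ge> 2" and g: "continuous_on {0..R} g" "\<And>r. r \<in> {0..R} \<Longrightarrow> g r = picard p g r"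
    and bd: "\<And>r. r \<in> {0..R} \<Longrightarrow> \<bar>g r\<bar> \<le> 2"
  shows "rsol p 1 R g (\<lambda>r. - spow (1 / (p - 1)) (flux p g r))"
  unfolding rsol_def
proof (intro conjI ballI)
  show "continuous_on {0..R} (\<lambda>r. - spow (1 / (p - 1)) (flux p g r))"
    by (intro continuous_intros spow_flux_continuous[OF assms(1) g(1)])
  show "- spow (1 / (p - 1)) (flux p g 0) = 0" by (simp add: flux_def)
  fix r
  {
    assume r: "r \<in> {0..R}"
    show "(g has_real_derivative - spow (1 / (p - 1)) (flux p g r)) (at r within {0..R})"
      by (rule has_field_derivative_transform_within[OF picard_deriv[OF assms(1) g(1) r], where d = 1])
         (use r g(2) in auto)
  }
  assume r: "r \<in> {0<..<R}"
  have "((\<lambda>r. integral {0..r} (\<lambda>t. t * spow (p - 1) (clamp2 (g t)))) has_real_derivative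
     r * spow (p - 1) (clamp2 (g r))) (at r within {0..R})"
    by (rule integral_has_real_derivative[OF flux_integrand_continuous[OF assms(1) g(1)]]) (use r in auto)
  moreover have "at r within {0..R} = at r"
    by (rule at_within_interior) (use r in auto)
  moreover have "clamp2 (g r) = g r"
    by (rule clamp2_id[OF bd]) (use r in auto)
  ultimately have "((\<lambda>r. integral {0..r} (\<lambda>t. t * spow (p - 1) (clamp2 (g t)))) has_real_derivative
     r * spow (p - 1) (g r)) (at r)" by simp
  from DERIV_minus[OF this]
  have "((\<lambda>r. - integral {0..r} (\<lambda>t. t * spow (p - 1) (clamp2 (g t)))) has_real_derivative
     - 1 * r * phi_p p (g r)) (at r)" by (simp add: phi_p_eq_spow)
  then show "((\<lambda>s. s * phi_p p (- spow (1 / (p - 1)) (flux p g s))) has_real_derivative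
     - 1 * r * phi_p p (g r)) (at r)"
    by (rule has_field_derivative_transform_within_open[where S = "{0<..<R}"])
       (use r assms(1) in \<open>auto simp: phi_p_eq_spow spow_inverse flux_def\<close>)
qed

text \<open>The energy bound presupposes an inactive clamp, and the clamp is inactive by the bound.
  The circle is broken at the first point where the modulus reaches 3/2: up to there the clamp is
  inactive, hence the modulus is at most 1.\<close>

lemma picard_fixpoint_bound:
  assumes "p \<ge> 2" and g: "continuous_on {0..R} g" "\<And>r. r \<in> {0..R} \<Longrightarrow> g r = picard p g r"
    and x: "x \<in> {0..R}"
  shows "\<bar>g x\<bar> \<le> 1"
proof -
  have g0: "g 0 = 1" using g(2)[of 0] x by (simp add: picard_nonpos)
  have small: "\<bar>g y\<bar> \<le> 1" if "y \<in> {0..R}" "\<And>r. r \<in> {0..y} \<Longrightarrow> \<bar>g r\<bar> \<le> 2" for y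
  proof -
    have "rsol p 1 y g (\<lambda>r. - spow (1 / (p - 1)) (flux p g r))"
      by (rule picard_fixpoint_rsol)
         (use that g assms(1) in \<open>auto intro: continuous_on_subset\<close>)
    from rsol_abs_le[OF this, of y] show ?thesis using that assms(1) g0 by simp
  qed
  define S where "S = {r \<in> {0..R}. \<bar>g r\<bar> \<ge> 3 / 2}"
  have "S = {}"
  proof (rule ccontr)
    assume ne: "S \<noteq> {}"
    have "compact S"
    proof -
      have "closed S"
        unfolding S_def by (rule continuous_on_closed_Collect_le) (auto intro!: continuous_intros g(1))
      moreover have "bounded S" by (rule bounded_subset[of "{0..R}"]) (auto simp: S_def)
      ultimately show ?thesis by (simp add: compact_eq_bounded_closed)
    qed
    then obtain y where y: "y \<in> S" "\<And>z. z \<in> S \<Longrightarrow> y \<le> z"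
      using compact_attains_inf[OF _ ne] by blast
    have lt: "\<bar>g r\<bar> < 3 / 2" if "r \<in> {0..<y}" for r
      using y that by (force simp: S_def)
    have "\<bar>g y\<bar> \<le> 2"
    proof -
      have "y > 0" using y g0 by (cases "y = 0") (auto simp: S_def)
      have "continuous_on (closure {0..<y}) (\<lambda>r. \<bar>g r\<bar>)"
        using y \<open>y > 0\<close> by (auto intro!: continuous_intros continuous_on_subset[OF g(1)] simp: S_def)
      then have "\<bar>g y\<bar> \<le> 3 / 2"
        by (rule continuous_le_on_closure) (use \<open>y > 0\<close> lt in \<open>auto intro: less_imp_le\<close>)
      then show ?thesis by simp
    qed
    then have "\<bar>g r\<bar> \<le> 2" if "r \<in> {0..y}" for r
      using lt[of r] that by (cases "r = y") auto
    then have "\<bar>g y\<bar> \<le> 1" using small[of y] y by (simp add: S_def)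
    then show False using y by (simp add: S_def)
  qed
  then have "\<bar>g r\<bar> \<le> 2" if "r \<in> {0..R}" for r using that by (force simp: S_def)
  then show ?thesis using small[OF x] x by auto
qed

lemma picard_fixpoint_unique:
  assumes "p \<ge> 2" and g: "continuous_on {0..R} g" "\<And>r. r \<in> {0..R} \<Longrightarrow> g r = picard p g r"
    and h: "continuous_on {0..R} h" "\<And>r. r \<in> {0..R} \<Longrightarrow> h r = picard p h r"
    and x: "x \<in> {0..R}"
  shows "g x = h x"
proof (rule rsol_unique[OF _ _ assms(1) _ _ x])
  show "rsol p 1 R g (\<lambda>r. - spow (1 / (p - 1)) (flux p g r))"
    by (rule picard_fixpoint_rsol[OF assms(1) g]) (use picard_fixpoint_bound[OF assms(1) g] in force)+
  show "rsol p 1 R h (\<lambda>r. - spow (1 / (p - 1)) (flux p h r))"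
    by (rule picard_fixpoint_rsol[OF assms(1) h]) (use picard_fixpoint_bound[OF assms(1) h] in force)+
  show "g 0 = h 0" "g 0 \<noteq> 0" using g(2)[of 0] h(2)[of 0] x by (auto simp: picard_nonpos)
qed

section \<open>The normalized solution on the half-line\<close>

definition pfix :: "real \<Rightarrow> nat \<Rightarrow> real \<Rightarrow> real" where
  "pfix p n = (SOME g. continuous_on {0..real n} g \<and> (\<forall>r\<in>{0..real n}. g r = picard p g r))"

text \<open>Glues the solutions chosen on the intervals up to each natural number; for p \<ge> 2
  they agree on common intervals by uniqueness.\<close>

definition profile :: "real \<Rightarrow> real \<Rightarrow> real" where
  "profile p r = pfix p (nat \<lceil>r\<rceil>) r"

definition profile' :: "real \<Rightarrow> real \<Rightarrow> real" where
  "profile' p r = - spow (1 / (p - 1)) (flux p (profile p) r)"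

lemma pfix:
  assumes "p \<ge> 2"
  shows "continuous_on {0..real n} (pfix p n)" "r \<in> {0..real n} \<Longrightarrow> pfix p n r = picard p (pfix p n) r"
  using someI_ex[OF picard_fixpoint_exists[OF assms, of "real n"]] unfolding pfix_def by auto

lemma profile_eq_pfix:
  assumes "p \<ge> 2" "r \<in> {0..real n}"
  shows "profile p r = pfix p n r"
proof -
  define m where "m = nat \<lceil>r\<rceil>"
  have m: "r \<le> real m" "m \<le> n" using assms by (auto simp: m_def)
  show ?thesis
    unfolding profile_def m_def[symmetric]
  proof (rule picard_fixpoint_unique[OF assms(1), of "real m" "pfix p m" "pfix p n"])
    show "continuous_on {0..real m} (pfix p n)"
      by (rule continuous_on_subset[OF pfix(1)[OF assms(1)]]) (use m in auto)
    fix x assume "x \<in> {0..real m}"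
    then show "pfix p m x = picard p (pfix p m) x" "pfix p n x = picard p (pfix p n) x"
      using pfix(2)[OF assms(1), of x m] pfix(2)[OF assms(1), of x n] m by auto
  qed (use m assms pfix(1)[OF assms(1)] in auto)
qed

lemma profile_fixpoint:
  assumes "p \<ge> 2"
  shows "continuous_on {0..R} (profile p)" "r \<ge> 0 \<Longrightarrow> profile p r = picard p (profile p) r"
proof -
  obtain n where n: "R \<le> real n" using real_arch_simple by blast
  have "continuous_on {0..real n} (profile p)"
    using pfix(1)[OF assms] profile_eq_pfix[OF assms] by (metis continuous_on_cong)
  then show "continuous_on {0..R} (profile p)"
    by (rule continuous_on_subset) (use n in auto)
next
  assume "r \<ge> 0"
  obtain n where n: "r \<le> real n" using real_arch_simple by blast
  have "profile p r = picard p (pfix p n) r"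
    using profile_eq_pfix[OF assms, of r n] pfix(2)[OF assms, of r n] n \<open>r \<ge> 0\<close> by simp
  also have "\<dots> = picard p (profile p) r"
    by (rule picard_cong, rule profile_eq_pfix[OF assms, symmetric]) (use n in auto)
  finally show "profile p r = picard p (profile p) r" .
qed

lemma profile_0: "p \<ge> 2 \<Longrightarrow> profile p 0 = 1"
  using profile_fixpoint(2)[of p 0] by (simp add: picard_nonpos)

lemma profile_abs_le: "p \<ge> 2 \<Longrightarrow> r \<ge> 0 \<Longrightarrow> \<bar>profile p r\<bar> \<le> 1"
  by (rule picard_fixpoint_bound[of p r]) (auto intro: profile_fixpoint)

lemma rsol_profile: 
  assumes "p \<ge> 2" 
  shows "rsol p 1 R (profile p) (profile' p)"
  unfolding profile'_def
  by (rule picard_fixpoint_rsol[OF assms profile_fixpoint(1)[OF assms] profile_fixpoint(2)[OF assms]])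
     (use profile_abs_le[OF assms] in force)+

lemma profile_unique:
  assumes "p \<ge> 2" "rsol p 1 R u u'" "u 0 = 1" "x \<in> {0..R}"
  shows "u x = profile p x"
  by (rule rsol_unique[OF assms(2) rsol_profile[OF assms(1)]]) (use assms profile_0 in auto)

text \<open>Compactness yields a uniform limit on the fixed interval, and uniqueness identifies it.
  A subsequence is enough for the crossing argument at the end.\<close>

lemma profile_subsequence:
  fixes q :: "nat \<Rightarrow> real"
  assumes q: "q \<longlonglongrightarrow> p" "\<And>j. 2 \<le> q j"
  obtains k where "strict_mono (k :: nat \<Rightarrow> nat)"
    "\<And>e. 0 < e \<Longrightarrow> \<forall>\<^sub>F j in sequentially. \<forall>x\<in>{0..R}. \<bar>profile (q (k j)) x - profile p x\<bar> < e"
proof -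
  have "p \<ge> 2" using q by (intro LIMSEQ_le_const) auto
  obtain g k where g: "continuous_on {0..R} g" "strict_mono (k :: nat \<Rightarrow> nat)"
    "\<And>r. r \<in> {0..R} \<Longrightarrow> g r = picard p g r"
    "\<And>e. 0 < e \<Longrightarrow> \<forall>\<^sub>F j in sequentially. \<forall>x\<in>{0..R}. \<bar>profile (q (k j)) x - g x\<bar> < e"
    by (rule picard_compactness[OF q, of R "\<lambda>j. profile (q j)" "\<lambda>j. profile (q j)"])
       (use profile_fixpoint q(2) in auto)
  have "g x = profile p x" if "x \<in> {0..R}" for x
    by (rule picard_fixpoint_unique[OF \<open>p \<ge> 2\<close> g(1,3) profile_fixpoint[OF \<open>p \<ge> 2\<close>] that]) auto
  then show ?thesis using that[OF g(2)] g(4) by simp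
qed

section \<open>Zeros of the normalized radial solution\<close>

lemma profile_deriv:
  assumes "p \<ge> 2" "0 < r"
  shows "(profile p has_real_derivative profile' p r) (at r)"
    "((\<lambda>s. s * spow (p - 1) (profile' p s)) has_real_derivative - r * spow (p - 1) (profile p r)) (at r)"
  using rsol_deriv[OF rsol_profile[OF assms(1), of "r + 1"], of r] assms by auto

lemma profile_continuous:
  assumes "p \<ge> 2" "0 \<le> a"
  shows "continuous_on {a..b} (profile p)" "continuous_on {a..b} (profile' p)"
  using rsol_continuous[OF rsol_profile[OF assms(1), of b]] assms
  by (auto intro: continuous_on_subset)

lemma profile'_nonzero:
  assumes "p \<ge> 2" "0 \<le> r" "profile p r = 0"
  shows "profile' p r \<noteq> 0"
  using rsol_simple_zero[OF rsol_profile[OF assms(1), of r], of r] assms profile_0 by auto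

text \<open>Suppose u stays positive. If u' is negative once, the decreasing function r |u'|^(p-2)
  u' stays below a negative constant, which makes u fall at least logarithmically. Otherwise u is
  nondecreasing, so the derivative of that function stays below a negative constant and u' becomes
  negative.\<close>

lemma oscillation:
  fixes u u' :: "real \<Rightarrow> real"
  assumes "p \<ge> 2" "a > 0"
    and du: "\<And>r. r \<ge> a \<Longrightarrow> (u has_real_derivative u' r) (at r)"
    and dY: "\<And>r. r \<ge> a \<Longrightarrow> ((\<lambda>s. s * spow (p - 1) (u' s)) has_real_derivative - r * spow (p - 1) (u r)) (at r)"
  shows "\<exists>r>a. u r \<le> 0"
proof (rule ccontr)
  assume "\<not> ?thesis"
  then have pos: "u r > 0" if "r > a" for r using that by force
  define Y where "Y = (\<lambda>s. s * spow (p - 1) (u' s))"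
  show False
  proof (cases "\<exists>b>a. u' b < 0")
    case True
    then obtain b where b: "b > a" "u' b < 0" by blast
    define c where "c = - Y b"
    have "c > 0" using b \<open>a > 0\<close> by (simp add: c_def Y_def mult_pos_neg)
    \<comment> \<open>Beyond d the ratio c/r is at most 1, so the exponent 1/(p - 1) \<le> 1 can
      only increase it.\<close>
    define d where "d = max b c"
    have d: "d > a" "d > 0" "d \<ge> c" "d \<ge> b" using b \<open>a > 0\<close> by (auto simp: d_def)
    have u'le: "u' r \<le> - (c / r)" if r: "r \<ge> d" for r
    proof -
      have "Y r \<le> Y b"
      proof (rule DERIV_nonpos_imp_nonincreasing[where f = Y])
        fix x assume "b \<le> x" "x \<le> r"
        then have x: "x > a" using b by simp
        have "- x * spow (p - 1) (u x) \<le> 0" using x pos[OF x] \<open>a > 0\<close> by (simp add: spow_nonneg)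
        then show "\<exists>y. (Y has_real_derivative y) (at x) \<and> y \<le> 0"
          using dY[of x] x unfolding Y_def by auto
      qed (use r d in auto)
      then have "spow (p - 1) (u' r) \<le> - (c / r)"
        using r d by (simp add: c_def Y_def field_simps)
      then have "spow (1 / (p - 1)) (spow (p - 1) (u' r)) \<le> spow (1 / (p - 1)) (- (c / r))"
        using \<open>p \<ge> 2\<close> by (intro spow_mono) auto
      also have "\<dots> = - ((c / r) powr (1 / (p - 1)))"
        using \<open>c > 0\<close> r d by (simp add: spow_pos)
      also have "\<dots> \<le> - ((c / r) powr 1)"
        using powr_mono'[of "1 / (p - 1)" 1 "c / r"] \<open>c > 0\<close> r d \<open>p \<ge> 2\<close> by simp
      finally show ?thesis using \<open>c > 0\<close> r d \<open>p \<ge> 2\<close> by (simp add: spow_inverse)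
    qed
    \<comment> \<open>Chosen so that c (ln r - ln d) = u(d) + c exceeds the height u(d) that is
      left.\<close>
    define r where "r = d * exp (u d / c + 1)"
    have "d \<le> r"
      using pos[OF d(1)] \<open>c > 0\<close> d by (simp add: r_def)
    have "u r + c * ln r \<le> u d + c * ln d"
    proof (rule DERIV_nonpos_imp_nonincreasing[where f = "\<lambda>r. u r + c * ln r"])
      fix x assume x: "d \<le> x" "x \<le> r"
      have "((\<lambda>r. u r + c * ln r) has_real_derivative u' x + c * (1 / x)) (at x)"
        using x d du[of x] by (auto intro!: derivative_eq_intros)
      then show "\<exists>y. ((\<lambda>r. u r + c * ln r) has_real_derivative y) (at x) \<and> y \<le> 0"
        using u'le[of x] x by auto
    qed (use \<open>d \<le> r\<close> in auto)
    moreover have "c * ln r = c * ln d + u d + c"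
      using d \<open>c > 0\<close> by (simp add: r_def ln_mult algebra_simps)
    ultimately have "u r < 0" using \<open>c > 0\<close> by simp
    then show False using pos[of r] d \<open>d \<le> r\<close> by simp
  next
    case False
    then have u'nn: "u' r \<ge> 0" if "r > a" for r using that by force
    define b where "b = a + 1"
    have b: "b > a" "b > 1" using \<open>a > 0\<close> by (auto simp: b_def)
    define m where "m = spow (p - 1) (u b)"
    have "m > 0" using pos[OF b(1)] by (simp add: m_def)
    have um: "spow (p - 1) (u r) \<ge> m" if "r \<ge> b" for r
    proof -
      have "u b \<le> u r"
      proof (rule DERIV_nonneg_imp_nondecreasing[where f = u])
        fix x assume "b \<le> x" "x \<le> r"
        then show "\<exists>y. (u has_real_derivative y) (at x) \<and> y \<ge> 0"
          using du[of x] u'nn[of x] b by (intro exI[of _ "u' x"]) auto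
      qed (use that in auto)
      then show ?thesis unfolding m_def using \<open>p \<ge> 2\<close> by (intro spow_mono) auto
    qed
    \<comment> \<open>A decrease of Y at rate at least m over this distance brings it to -1 or
      below.\<close>
    define r where "r = b + (Y b + 1) / m"
    have "Y b \<ge> 0" using u'nn[OF b(1)] b by (simp add: Y_def spow_nonneg)
    then have "r \<ge> b" using \<open>m > 0\<close> by (simp add: r_def)
    have "Y r + m * r \<le> Y b + m * b"
    proof (rule DERIV_nonpos_imp_nonincreasing[where f = "\<lambda>r. Y r + m * r"])
      fix x assume x: "b \<le> x" "x \<le> r"
      have "(Y has_real_derivative - x * spow (p - 1) (u x)) (at x)"
        unfolding Y_def using dY[of x] x b by simp
      then have "((\<lambda>r. Y r + m * r) has_real_derivative - x * spow (p - 1) (u x) + m) (at x)"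
        by (auto intro!: derivative_eq_intros)
      moreover have "1 * m \<le> x * spow (p - 1) (u x)"
        using um[OF x(1)] x b \<open>m > 0\<close> by (intro mult_mono) auto
      ultimately show "\<exists>y. ((\<lambda>r. Y r + m * r) has_real_derivative y) (at x) \<and> y \<le> 0"
        by (intro exI[of _ "- x * spow (p - 1) (u x) + m"]) auto
    qed (use \<open>r \<ge> b\<close> in auto)
    moreover have "m * r = m * b + Y b + 1" using \<open>m > 0\<close> by (simp add: r_def field_simps)
    ultimately have "Y r < 0" by simp
    moreover have "Y r \<ge> 0" using u'nn[of r] \<open>r \<ge> b\<close> b by (simp add: Y_def spow_nonneg)
    ultimately show False by simp
  qed
qed

text \<open>Oscillation applied to the profile and then to its negative gives values of both weak
  signs beyond a. The shift by 1 is there because \<open>oscillation\<close> starts from a positive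
  radius.\<close>

lemma profile_zero_beyond:
  assumes "p \<ge> 2" "a \<ge> 0"
  shows "\<exists>r>a. profile p r = 0"
proof -
  define b where "b = a + 1"
  have b: "b > 0" "b > a" using assms by (auto simp: b_def)
  obtain r1 where r1: "r1 > b" "profile p r1 \<le> 0"
    using oscillation[OF assms(1) b(1), of "profile p" "profile' p"] profile_deriv[OF assms(1)] b by auto
  have "\<exists>r>r1. - profile p r \<le> 0"
  proof (rule oscillation[OF assms(1), of r1 "\<lambda>r. - profile p r" "\<lambda>r. - profile' p r"])
    fix r assume "r1 \<le> r"
    then have r: "r > 0" using r1 b by simp
    show "((\<lambda>r. - profile p r) has_real_derivative - profile' p r) (at r)"
      by (rule DERIV_minus[OF profile_deriv(1)[OF assms(1) r]])
    show "((\<lambda>s. s * spow (p - 1) (- profile' p s)) has_real_derivative - r * spow (p - 1) (- profile p r)) (at r)"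
      using DERIV_minus[OF profile_deriv(2)[OF assms(1) r]] by simp
  qed (use r1 b in auto)
  then obtain r2 where r2: "r2 > r1" "profile p r2 \<ge> 0" by auto
  have "\<exists>x\<ge>r1. x \<le> r2 \<and> profile p x = 0"
    by (rule IVT') (use r1 r2 b profile_continuous[OF assms(1), of r1] in auto)
  then show ?thesis using r1 b by (metis less_trans less_le_trans)
qed

text \<open>Between two zeros the profile rises to its maximal modulus \<open>M\<close> at an interior critical point,
  where the flux vanishes; integrating the equation from there bounds the slope by a multiple of \<open>M\<close>.\<close>

lemma profile_zero_gap:
  assumes "p \<ge> 2" and xy: "0 < x" "x < y" "y \<le> R" and z: "profile p x = 0" "profile p y = 0"
  shows "y - x \<ge> 2 / (R\<^sup>2 / x) powr (1 / (p - 1))"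
proof -
  define U U' where "U = profile p" and "U' = profile' p"
  define e where "e = 1 / (p - 1)"
  have e: "e > 0" "(p - 1) * e = 1" using assms by (auto simp: e_def)
  define B where "B = (R\<^sup>2 / x) powr e"
  have "B > 0" using xy by (simp add: B_def)
  have cU: "continuous_on {x..y} U"
    unfolding U_def by (rule profile_continuous) (use assms in auto)
  have "\<exists>c\<in>{x..y}. \<forall>t\<in>{x..y}. \<bar>U t\<bar> \<le> \<bar>U c\<bar>"
    by (rule continuous_attains_sup) (use xy cU in \<open>auto intro!: continuous_intros\<close>)
  then obtain c where c: "c \<in> {x..y}" "\<And>t. t \<in> {x..y} \<Longrightarrow> \<bar>U t\<bar> \<le> \<bar>U c\<bar>"
    by blast
  define M where "M = \<bar>U c\<bar>"
  have dU: "(U has_real_derivative U' t) (at t)" if "t > 0" for t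
    unfolding U_def U'_def by (rule profile_deriv) (use assms that in auto)
  have dY: "((\<lambda>s. s * spow (p - 1) (U' s)) has_real_derivative - t * spow (p - 1) (U t)) (at t)" if "t > 0" for t
    unfolding U_def U'_def by (rule profile_deriv) (use assms that in auto)
  have "M > 0"
  proof (rule ccontr)
    assume "\<not> M > 0"
    then have U0: "U t = 0" if "t \<in> {x..y}" for t using c(2)[OF that] by (simp add: M_def)
    define t where "t = (x + y) / 2"
    have t: "x < t" "t < y" "t > 0" using xy by (auto simp: t_def)
    have "(U has_real_derivative 0) (at t)"
      by (rule has_field_derivative_transform_within_open[where f = "\<lambda>_. 0" and S = "{x<..<y}"])
         (use t U0 in auto)
    then have "U' t = 0" using dU[OF t(3)] DERIV_unique by blast
    then show False
      using profile'_nonzero[of p t] assms(1) U0[of t] t by (simp add: U_def U'_def)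
  qed
  then have cxy: "x < c" "c < y" using c(1) z by (auto simp: M_def U_def order_less_le)
  have "U' c = 0"
  proof (cases "U c > 0")
    case True
    have "U t \<le> U c" if "\<bar>c - t\<bar> < min (c - x) (y - c)" for t
    proof -
      have "t \<in> {x..y}" using that by (simp add: abs_if split: if_splits)
      then show ?thesis using c(2)[of t] True by linarith
    qed
    then show ?thesis
      by (intro DERIV_local_max[OF dU, of c "min (c - x) (y - c)"]) (use cxy xy in auto)
  next
    case False
    have "U c \<le> U t" if "\<bar>c - t\<bar> < min (c - x) (y - c)" for t
    proof -
      have "t \<in> {x..y}" using that by (simp add: abs_if split: if_splits)
      then show ?thesis using c(2)[of t] False by linarith
    qed
    then show ?thesis
      by (intro DERIV_local_min[OF dU, of c "min (c - x) (y - c)"]) (use cxy xy in auto)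
  qed
  have slope: "\<bar>U' t\<bar> \<le> M * B" if t: "t \<in> {x..y}" for t
  proof -
    have "norm (t * spow (p - 1) (U' t) - c * spow (p - 1) (U' c)) \<le> (R * M powr (p - 1)) * norm (t - c)"
    proof (rule field_differentiable_bound[where S = "{x..y}" and f' = "\<lambda>t. - t * spow (p - 1) (U t)"])
      fix s assume s: "s \<in> {x..y}"
      show "((\<lambda>t. t * spow (p - 1) (U' t)) has_real_derivative - s * spow (p - 1) (U s)) (at s within {x..y})"
        using dY[of s] s xy by (auto intro: has_field_derivative_at_within)
      show "norm (- s * spow (p - 1) (U s)) \<le> R * M powr (p - 1)"
        unfolding real_norm_def abs_mult abs_minus_cancel abs_spow using s xy c(2)[OF s] \<open>p \<ge> 2\<close>
        by (intro mult_mono powr_mono2) (auto simp: M_def)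
    qed (use t c in auto)
    also have "\<dots> \<le> (R * M powr (p - 1)) * R"
      using t c xy by (intro mult_left_mono) auto
    finally have "t * \<bar>U' t\<bar> powr (p - 1) \<le> R\<^sup>2 * M powr (p - 1)"
      using \<open>U' c = 0\<close> t xy by (simp add: abs_mult abs_spow power2_eq_square mult_ac)
    moreover have "x * \<bar>U' t\<bar> powr (p - 1) \<le> t * \<bar>U' t\<bar> powr (p - 1)"
      using t by (intro mult_right_mono) auto
    ultimately have "\<bar>U' t\<bar> powr (p - 1) \<le> R\<^sup>2 / x * M powr (p - 1)"
      using xy by (simp add: field_simps)
    then have "(\<bar>U' t\<bar> powr (p - 1)) powr e \<le> (R\<^sup>2 / x * M powr (p - 1)) powr e"
      using e by (intro powr_mono2) auto
    then show ?thesis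
      using e \<open>M > 0\<close> xy powr_mult[of "R\<^sup>2 / x" "M powr (p - 1)" e]
      by (simp only: powr_powr B_def) (simp add: mult.commute)
  qed
  \<comment> \<open>The amplitude M cancels. Each of the two zeros is at distance at least 1/B from
    the extremum, which gives the factor 2 in the gap.\<close>
  have step: "\<bar>s - c\<bar> \<ge> 1 / B" if s: "s \<in> {x, y}" for s
  proof -
    have "norm (U c - U s) \<le> (M * B) * norm (c - s)"
      by (rule field_differentiable_bound[where S = "{x..y}" and f' = U'])
         (use s c xy slope dU in \<open>auto intro: has_field_derivative_at_within\<close>)
    then have "M \<le> M * (B * \<bar>s - c\<bar>)"
      using s z by (auto simp: M_def U_def abs_minus_commute mult_ac)
    then have "1 \<le> B * \<bar>s - c\<bar>" using \<open>M > 0\<close> by simp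
    then show ?thesis using \<open>B > 0\<close> by (simp add: field_simps)
  qed
  show ?thesis
    using step[of x] step[of y] cxy by (simp add: B_def e_def)
qed

text \<open>The profile has modulus at most 1, so the flux at t is at most t. The descent from
  height 1 at the origin is only one half of an arch, hence 1 where the gap between zeros has
  2.\<close>

lemma profile_first_zero:
  assumes "p \<ge> 2" and x: "0 < x" "x \<le> R" "profile p x = 0"
  shows "x \<ge> 1 / R powr (1 / (p - 1))"
proof -
  define U U' where "U = profile p" and "U' = profile' p"
  define e where "e = 1 / (p - 1)"
  have e: "e > 0" "(p - 1) * e = 1" using assms by (auto simp: e_def)
  have r: "rsol p 1 R U U'" unfolding U_def U'_def by (rule rsol_profile[OF assms(1)])
  have slope: "\<bar>U' t\<bar> \<le> R powr e" if t: "t \<in> {0..R}" for t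
  proof -
    have "\<bar>U' t\<bar> = \<bar>flux p U t\<bar> powr e"
      by (simp add: U'_def profile'_def U_def abs_spow e_def)
    also have "\<bar>flux p U t\<bar> \<le> t"
    proof (cases "t = 0")
      case False
      have "norm (integral {0..t} (\<lambda>s. s * spow (p - 1) (clamp2 (U s)))) \<le> t * (t - 0)"
      proof (rule integral_bound)
        show "continuous_on {0..t} (\<lambda>s. s * spow (p - 1) (clamp2 (U s)))"
          unfolding U_def by (intro flux_integrand_continuous assms(1) profile_fixpoint(1))
        fix s assume s: "s \<in> {0..t}"
        then have le: "\<bar>U s\<bar> \<le> 1" unfolding U_def using profile_abs_le[OF assms(1)] by simp
        then have "\<bar>spow (p - 1) (clamp2 (U s))\<bar> \<le> 1 powr (p - 1)"
          unfolding abs_spow using assms(1) by (intro powr_mono2) (auto simp: clamp2_id)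
        then have "\<bar>s\<bar> * \<bar>spow (p - 1) (clamp2 (U s))\<bar> \<le> t * 1"
          using s by (intro mult_mono) auto
        then show "norm (s * spow (p - 1) (clamp2 (U s))) \<le> t" by (simp add: abs_mult)
      qed (use t in auto)
      then show ?thesis using False t by (simp add: flux_def field_simps)
    qed (simp add: flux_def)
    then have "\<bar>flux p U t\<bar> powr e \<le> R powr e"
      using t e by (intro powr_mono2) auto
    finally show ?thesis .
  qed
  have "norm (U x - U 0) \<le> R powr e * norm (x - 0)"
    by (rule field_differentiable_bound[where S = "{0..R}" and f' = U'])
       (use r x slope in \<open>auto simp: rsol_def\<close>)
  then have "1 \<le> R powr e * x" using x profile_0[OF assms(1)] by (simp add: U_def)
  then show ?thesis using x by (simp add: field_simps e_def)
qed

section \<open>The radial eigenvalues\<close>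

text \<open>The lower bound for the first zero gives x \<ge> 1/R, so \<open>R\<^sup>2 / x\<close> is
  at most the cube of R. The resulting bound is uniform over all pairs of zeros up to R.\<close>

lemma profile_zero_gap':
  assumes "p \<ge> 2" "R \<ge> 1" and xy: "0 < x" "x < y" "y \<le> R" and z: "profile p x = 0" "profile p y = 0"
  shows "y - x \<ge> 2 * R powr (- 3 / (p - 1))"
proof -
  define e where "e = 1 / (p - 1)"
  have e: "e > 0" "e \<le> 1" using assms by (auto simp: e_def)
  have "1 / R powr 1 \<le> 1 / R powr e"
    using e assms by (intro divide_left_mono powr_mono) auto
  also have "\<dots> \<le> x"
    unfolding e_def using assms by (intro profile_first_zero) auto
  finally have "R\<^sup>2 / x \<le> R ^ 3"
    using assms by (simp add: field_simps power2_eq_square power3_eq_cube)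
  then have "(R\<^sup>2 / x) powr e \<le> (R ^ 3) powr e"
    using xy e by (intro powr_mono2) auto
  also have "(R ^ 3) powr e = R powr (3 * e)"
    using assms by (simp add: powr_powr flip: powr_numeral)
  finally have "2 / R powr (3 * e) \<le> 2 / (R\<^sup>2 / x) powr e"
    using xy by (intro divide_left_mono) auto
  also have "\<dots> \<le> y - x"
    unfolding e_def by (rule profile_zero_gap[OF assms(1) xy z])
  finally show ?thesis
    by (simp add: e_def powr_minus_divide)
qed

text \<open>The value 0 at index 0 is not a zero of the profile; it starts the recursion, so that
  the positive zeros are numbered from 1.\<close>

primrec nu :: "real \<Rightarrow> nat \<Rightarrow> real" where
  "nu p 0 = 0"
| "nu p (Suc i) = Inf {r. nu p i < r \<and> profile p r = 0}"

text \<open>The infimum is attained because the zeros beyond a keep a positive distance from a, by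
  the gap estimates; so their set is closed.\<close>

lemma nu_Suc_aux:
  assumes "p \<ge> 2" and a: "a \<ge> 0" "a = 0 \<or> profile p a = 0"
  defines "S \<equiv> {r. a < r \<and> profile p r = 0}"
  shows "Inf S \<in> S" "\<And>r. r \<in> S \<Longrightarrow> Inf S \<le> r"
proof -
  obtain z where z: "z > a" "profile p z = 0"
    using profile_zero_beyond[OF assms(1) a(1)] by blast
  obtain d where d: "d > 0" "\<And>r. r \<in> S \<Longrightarrow> a + d \<le> r"
  proof (cases "a = 0")
    case True
    define R where "R = z"
    show ?thesis
    proof (rule that[of "min z (1 / R powr (1 / (p - 1)))"])
      fix r assume "r \<in> S"
      then show "a + min z (1 / R powr (1 / (p - 1))) \<le> r"
        using profile_first_zero[OF assms(1), of r R] True z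
        by (cases "r \<le> R") (auto simp: S_def R_def)
    qed (use z True in \<open>auto simp: R_def\<close>)
  next
    case False
    then have "a > 0" using a by simp
    define R where "R = max 1 z"
    show ?thesis
    proof (rule that[of "min (z - a) (2 * R powr (- 3 / (p - 1)))"])
      fix r assume "r \<in> S"
      then show "a + min (z - a) (2 * R powr (- 3 / (p - 1))) \<le> r"
        using profile_zero_gap'[OF assms(1), of R a r] False z a \<open>a > 0\<close>
        by (cases "r \<le> R") (auto simp: S_def R_def)
    qed (use z \<open>a > 0\<close> in \<open>auto simp: R_def\<close>)
  qed
  have "S = {r \<in> {a + d..}. profile p r = 0}" using d by (auto simp: S_def)
  moreover have "closed {r \<in> {a + d..}. profile p r = 0}"
  proof (rule continuous_closed_preimage_constant)
    show "continuous_on {a + d..} (profile p)"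
    proof (intro continuous_at_imp_continuous_on ballI)
      fix x assume "x \<in> {a + d..}"
      then have "x > 0" using d a by simp
      then show "isCont (profile p) x"
        using profile_deriv(1)[OF assms(1)] DERIV_isCont by blast
    qed
  qed auto
  ultimately have "closed S" by simp
  moreover have "S \<noteq> {}" using z by (auto simp: S_def)
  moreover have bdd: "bdd_below S" by (auto simp: S_def bdd_below_def intro: less_imp_le)
  ultimately show "Inf S \<in> S" by (intro closed_contains_Inf)
  fix r assume "r \<in> S"
  then show "Inf S \<le> r" using bdd by (intro cInf_lower)
qed

context
  fixes p :: real
  assumes p: "p \<ge> 2"
begin

lemma nu_zero: "nu p i \<ge> 0 \<and> (nu p i = 0 \<or> profile p (nu p i) = 0)"
proof (induction i)
  case (Suc i)
  then show ?case using nu_Suc_aux(1)[OF p, of "nu p i"] by auto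
qed simp

lemma nu_less_Suc: "nu p i < nu p (Suc i)"
  using nu_Suc_aux(1)[OF p, of "nu p i"] nu_zero[of i] by auto

lemma profile_nu_Suc: "profile p (nu p (Suc i)) = 0"
  using nu_Suc_aux(1)[OF p, of "nu p i"] nu_zero[of i] by auto

lemma nu_Suc_le: "nu p i < r \<Longrightarrow> profile p r = 0 \<Longrightarrow> nu p (Suc i) \<le> r"
  using nu_Suc_aux(2)[OF p, of "nu p i"] nu_zero[of i] by auto

lemma nu_strict_mono: "strict_mono (nu p)"
  using nu_less_Suc by (simp add: strict_mono_Suc_iff)

lemma nu_pos: "i > 0 \<Longrightarrow> nu p i > 0"
  using strict_monoD[OF nu_strict_mono, of 0 i] by simp

text \<open>With g the power of R, the first zero contributes at least g and each further gap at
  least 2g.\<close>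

lemma nu_gap:
  assumes "R \<ge> 1" "nu p (Suc i) \<le> R"
  shows "(2 * real (Suc i) - 1) * R powr (- 3 / (p - 1)) \<le> nu p (Suc i)"
  using assms(2)
proof (induction i)
  case 0
  have "R powr (- 3 / (p - 1)) \<le> R powr (- (1 / (p - 1)))"
    using assms(1) p by (intro powr_mono) (auto simp: field_simps)
  also have "\<dots> = 1 / R powr (1 / (p - 1))" by (rule powr_minus_divide)
  also have "\<dots> \<le> nu p (Suc 0)"
    by (rule profile_first_zero) (use p nu_pos[of "Suc 0"] profile_nu_Suc[of 0] 0 in auto)
  finally show ?case by (simp del: nu.simps)
next
  case (Suc i)
  have "nu p (Suc i) \<le> R" using nu_less_Suc[of "Suc i"] Suc.prems by linarith
  note IH = Suc.IH[OF this]
  have "2 * R powr (- 3 / (p - 1)) \<le> nu p (Suc (Suc i)) - nu p (Suc i)"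
    by (rule profile_zero_gap'[OF p assms(1) nu_pos nu_less_Suc Suc.prems profile_nu_Suc profile_nu_Suc]) simp
  then show ?case using IH by (simp add: algebra_simps del: nu.simps)
qed

text \<open>Take R = 2k - 1 in \<open>nu_gap\<close>. If the k-th zero exceeds R there is nothing to
  show, as the power is at most 1. The bound tends to 2k - 1 as p tends to infinity.\<close>

lemma nu_lower_bound:
  assumes "k \<ge> 1"
  shows "(2 * real k - 1) * (2 * real k - 1) powr (- 3 / (p - 1)) \<le> nu p k"
proof -
  obtain i where k: "k = Suc i" using assms by (cases k) auto
  define R where "R = 2 * real k - 1"
  have "R \<ge> 1" using assms by (simp add: R_def)
  show ?thesis
  proof (cases "nu p k \<le> R")
    case True
    then show ?thesis using nu_gap[OF \<open>R \<ge> 1\<close>, of i] by (simp add: k R_def del: nu.simps)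
  next
    case False
    have "R powr (- 3 / (p - 1)) \<le> R powr 0" using \<open>R \<ge> 1\<close> p by (intro powr_mono) auto
    then have "R * R powr (- 3 / (p - 1)) \<le> R * 1" using \<open>R \<ge> 1\<close> by (intro mult_left_mono) auto
    then show ?thesis using False by (simp add: R_def)
  qed
qed

text \<open>The gap estimate prevents the zeros from accumulating, so \<open>nu p\<close> passes
  every x and no zero is missed by the enumeration.\<close>

lemma profile_zero_iff_nu: "profile p x = 0 \<and> x > 0 \<longleftrightarrow> (\<exists>i\<ge>1. x = nu p i)"
proof
  assume x: "profile p x = 0 \<and> x > 0"
  define R where "R = max 1 x"
  define g where "g = R powr (- 3 / (p - 1))"
  have "R \<ge> 1" "g > 0" by (auto simp: R_def g_def)
  obtain n where n: "real n * g > R" using ex_less_of_nat_mult[OF \<open>g > 0\<close>] by auto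
  have "nu p (Suc n) > R"
  proof (rule ccontr)
    assume "\<not> nu p (Suc n) > R"
    then have "(2 * real (Suc n) - 1) * g \<le> nu p (Suc n)"
      unfolding g_def by (intro nu_gap \<open>R \<ge> 1\<close>) simp
    moreover have "real n * g \<le> (2 * real (Suc n) - 1) * g"
      using \<open>g > 0\<close> by (intro mult_right_mono) auto
    ultimately show False using n \<open>\<not> nu p (Suc n) > R\<close> by linarith
  qed
  then have ex: "\<exists>i. x \<le> nu p i" by (intro exI[of _ "Suc n"]) (simp add: R_def del: nu.simps)
  define i where "i = (LEAST i. x \<le> nu p i)"
  have i: "x \<le> nu p i" unfolding i_def using ex by (rule LeastI_ex)
  then have "i \<noteq> 0" using x by (cases i) auto
  then obtain j where j: "i = Suc j" by (cases i) auto
  have "\<not> x \<le> nu p j" using not_less_Least[of j "\<lambda>i. x \<le> nu p i"] j by (simp add: i_def)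
  then have "nu p i \<le> x" unfolding j using nu_Suc_le[of j x] x by simp
  then show "\<exists>i\<ge>1. x = nu p i" using i j by (intro exI[of _ i]) auto
next
  assume "\<exists>i\<ge>1. x = nu p i"
  then obtain j where "x = nu p (Suc j)" by (metis Suc_le_D One_nat_def)
  then show "profile p x = 0 \<and> x > 0" using profile_nu_Suc[of j] nu_pos[of "Suc j"] by (simp del: nu.simps)
qed

section \<open>Continuous dependence of the zeros on the exponent\<close>

lemma profile_sign_change:
  assumes "profile p x = 0" "x > 0" "\<delta> > 0"
  obtains a b where "x - \<delta> < a" "a < x" "x < b" "b < x + \<delta>" "0 < a" "profile p a * profile p b < 0"
proof -
  define D where "D = profile' p x"
  have "D \<noteq> 0" using profile'_nonzero[OF p _ assms(1)] assms(2) by (simp add: D_def)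
  have d: "(profile p has_real_derivative D) (at x)"
    unfolding D_def by (rule profile_deriv(1)[OF p assms(2)])
  define \<eta> where "\<eta> = min \<delta> x"
  have "\<eta> > 0" using assms by (simp add: \<eta>_def)
  show ?thesis
  proof (cases "D > 0")
    case True
    obtain d1 where d1: "d1 > 0" "\<And>h. h > 0 \<Longrightarrow> h < d1 \<Longrightarrow> profile p x < profile p (x + h)"
      using DERIV_pos_inc_right[OF d True] by blast
    obtain d2 where d2: "d2 > 0" "\<And>h. h > 0 \<Longrightarrow> h < d2 \<Longrightarrow> profile p (x - h) < profile p x"
      using DERIV_pos_inc_left[OF d True] by blast
    define h where "h = min \<eta> (min d1 d2) / 2"
    have h: "h > 0" "h < \<eta>" "h < d1" "h < d2" using \<open>\<eta> > 0\<close> d1 d2 by (auto simp: h_def)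
    show ?thesis
      by (rule that[of "x - h" "x + h"])
         (use h d1(2)[of h] d2(2)[of h] assms in \<open>auto simp: \<eta>_def mult_neg_pos\<close>)
  next
    case False
    then have "D < 0" using \<open>D \<noteq> 0\<close> by simp
    obtain d1 where d1: "d1 > 0" "\<And>h. h > 0 \<Longrightarrow> h < d1 \<Longrightarrow> profile p (x + h) < profile p x"
      using DERIV_neg_dec_right[OF d \<open>D < 0\<close>] by blast
    obtain d2 where d2: "d2 > 0" "\<And>h. h > 0 \<Longrightarrow> h < d2 \<Longrightarrow> profile p x < profile p (x - h)"
      using DERIV_neg_dec_left[OF d \<open>D < 0\<close>] by blast
    define h where "h = min \<eta> (min d1 d2) / 2"
    have h: "h > 0" "h < \<eta>" "h < d1" "h < d2" using \<open>\<eta> > 0\<close> d1 d2 by (auto simp: h_def)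
    show ?thesis
      by (rule that[of "x - h" "x + h"])
         (use h d1(2)[of h] d2(2)[of h] assms in \<open>auto simp: \<eta>_def mult_pos_neg\<close>)
  qed
qed

end

text \<open>Induction on k. From above: the sign change at the limiting zero persists under uniform
  convergence and lies beyond the previous zero. From below: the limit profile is bounded away from
  0 strictly between its two zeros, while near the previous zero a new one is excluded by the
  uniform gap.\<close>

lemma nu_tendsto:
  fixes q :: "nat \<Rightarrow> real"
  assumes p: "p \<ge> 2" and q: "\<And>j. 2 \<le> q j"
    and unif: "\<And>e. 0 < e \<Longrightarrow> \<forall>\<^sub>F j in sequentially. \<forall>x\<in>{0..R}. \<bar>profile (q j) x - profile p x\<bar> < e"
    and R: "nu p k + 1 \<le> R"
  shows "(\<lambda>j. nu (q j) k) \<longlonglongrightarrow> nu p k"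
  using R
proof (induction k)
  case (Suc k)
  define a b where "a = nu p k" and "b = nu p (Suc k)"
  have ab: "a < b" "0 \<le> a" "b + 1 \<le> R" "R \<ge> 1"
    using nu_less_Suc[OF p, of k] nu_zero[OF p, of k] Suc.prems by (auto simp: a_def b_def simp del: nu.simps)
  have IH: "(\<lambda>j. nu (q j) k) \<longlonglongrightarrow> a"
    unfolding a_def by (rule Suc.IH) (use ab in \<open>simp add: a_def\<close>)
  have upper: "\<forall>\<^sub>F j in sequentially. nu (q j) (Suc k) < b + \<delta>" if "\<delta> > 0" for \<delta>
  proof -
    define h where "h = (b - a) / 2"
    have "h > 0" using ab by (simp add: h_def)
    define \<eta> where "\<eta> = min \<delta> (min 1 h)"
    have \<eta>: "\<eta> > 0" "\<eta> \<le> \<delta>" "\<eta> \<le> 1" "\<eta> \<le> h" using that \<open>h > 0\<close> by (auto simp: \<eta>_def)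
    then have "b - \<eta> > a" using ab by (simp add: h_def field_simps)
    obtain c d where cd: "b - \<eta> < c" "c < b" "b < d" "d < b + \<eta>" "0 < c" "profile p c * profile p d < 0"
      using profile_sign_change[OF p, of b \<eta>] profile_nu_Suc[OF p, of k] ab \<eta> by (auto simp: b_def simp del: nu.simps)
    define m where "m = min \<bar>profile p c\<bar> \<bar>profile p d\<bar>"
    have "m > 0" using cd by (auto simp: m_def)
    have "\<forall>\<^sub>F j in sequentially. nu (q j) k < b - \<eta>"
      using order_tendstoD(2)[OF IH] \<open>b - \<eta> > a\<close> by blast
    with unif[OF \<open>m > 0\<close>] show ?thesis
    proof eventually_elim
      case (elim j)
      have c: "\<bar>profile (q j) c - profile p c\<bar> < \<bar>profile p c\<bar>"
        using elim(1)[rule_format, of c] cd ab \<eta> by (auto simp: m_def)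
      have d: "\<bar>profile (q j) d - profile p d\<bar> < \<bar>profile p d\<bar>"
        using elim(1)[rule_format, of d] cd ab \<eta> by (auto simp: m_def)
      have con: "continuous_on {c..d} (profile (q j))"
        by (rule profile_continuous) (use q cd in auto)
      have "\<exists>x\<ge>c. x \<le> d \<and> profile (q j) x = 0"
      proof (cases "profile p c > 0")
        case True
        then have "profile p d < 0" using cd(6) by (simp add: mult_less_0_iff)
        then show ?thesis
          by (intro IVT2') (use True c d cd con in auto)
      next
        case False
        then have "profile p c < 0" "profile p d > 0" using cd(6) by (auto simp: mult_less_0_iff)
        then show ?thesis
          by (intro IVT') (use c d cd con in auto)
      qed
      then obtain x where x: "c \<le> x" "x \<le> d" "profile (q j) x = 0" by blast
      have "nu (q j) (Suc k) \<le> x"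
        by (rule nu_Suc_le[OF q]) (use x elim(2) cd in auto)
      then show ?case using x cd \<eta> by linarith
    qed
  qed
  have lower: "\<forall>\<^sub>F j in sequentially. b - \<delta> < nu (q j) (Suc k)" if "\<delta> > 0" for \<delta>
  proof -
    \<comment> \<open>For exponents at least 2 all gaps up to R are at least twice this number; one
      half is given up to the error in the k-th zero. For k = 0 the interval may start at 0, where
      the profile is 1.\<close>
    define g where "g = (if k = 0 then 0 else 1 / R powr 3)"
    define I where "I = {a + g..b - \<delta>}"
    have "profile p x \<noteq> 0" if x: "x \<in> I" for x
    proof
      assume z: "profile p x = 0"
      have "x \<noteq> 0" using z profile_0[OF p] by auto
      moreover have "a + g \<le> x" "x < b" "g \<ge> 0" using x \<open>\<delta> > 0\<close> by (auto simp: I_def g_def)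
      moreover have "a < x"
      proof (cases "k = 0")
        case True
        then show ?thesis using calculation by (simp add: a_def g_def)
      next
        case False
        then have "g > 0" using ab by (simp add: g_def)
        then show ?thesis using calculation by simp
      qed
      ultimately show False using nu_Suc_le[OF p, of k x] z by (simp add: a_def b_def del: nu.simps)
    qed
    moreover have cI: "continuous_on I (\<lambda>x. \<bar>profile p x\<bar>)"
      unfolding I_def by (intro continuous_intros profile_continuous p) (use ab in \<open>auto simp: g_def\<close>)
    ultimately obtain m where m: "m > 0" "\<And>x. x \<in> I \<Longrightarrow> m \<le> \<bar>profile p x\<bar>"
    proof (cases "I = {}")
      case False
      have "compact I" by (simp add: I_def)
      then obtain y where "y \<in> I" "\<And>x. x \<in> I \<Longrightarrow> \<bar>profile p y\<bar> \<le> \<bar>profile p x\<bar>"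
        using continuous_attains_inf[OF _ False cI] by blast
      then show ?thesis
        using that[of "\<bar>profile p y\<bar>"] \<open>\<And>x. x \<in> I \<Longrightarrow> profile p x \<noteq> 0\<close> by auto
    qed (use that[of 1] in auto)
    have "\<forall>\<^sub>F j in sequentially. a - 1 / R powr 3 < nu (q j) k"
      using order_tendstoD(1)[OF IH, of "a - 1 / R powr 3"] ab by auto
    with unif[OF m(1)] show ?thesis
    proof eventually_elim
      case (elim j)
      define y where "y = nu (q j) (Suc k)"
      have zy: "profile (q j) y = 0" unfolding y_def by (rule profile_nu_Suc[OF q])
      have "y > 0" unfolding y_def by (rule nu_pos[OF q]) simp
      have xy: "nu (q j) k < y" unfolding y_def by (rule nu_less_Suc[OF q])
      show ?case
      proof (rule ccontr)
        assume "\<not> b - \<delta> < nu (q j) (Suc k)"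
        then have y: "y \<le> b - \<delta>" "y \<le> R" using ab that by (auto simp: y_def simp del: nu.simps)
        have "a + g \<le> y"
        proof (cases "k = 0")
          case True
          then show ?thesis using \<open>y > 0\<close> by (simp add: a_def g_def)
        next
          case False
          then obtain i where i: "k = Suc i" by (cases k) auto
          have "2 * R powr (- 3 / (q j - 1)) \<le> y - nu (q j) k"
            by (rule profile_zero_gap'[OF q \<open>R \<ge> 1\<close> _ xy y(2) _ zy])
               (use nu_pos[OF q, of k] profile_nu_Suc[OF q, of _ i] False i in auto)
          moreover have "R powr (- 3) \<le> R powr (- 3 / (q j - 1))"
            using ab q[of j] by (intro powr_mono) (auto simp: field_simps)
          moreover have "R powr (- 3) = 1 / R powr 3" by (rule powr_minus_divide)
          ultimately show ?thesis using elim(2) False by (simp add: g_def)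
        qed
        then have "y \<in> I" using y by (simp add: I_def)
        then have "m \<le> \<bar>profile p y\<bar>" by (rule m(2))
        moreover have "\<bar>profile (q j) y - profile p y\<bar> < m"
          using elim(1) y \<open>y > 0\<close> by auto
        ultimately show False using zy by simp
      qed
    qed
  qed
  have "(\<lambda>j. nu (q j) (Suc k)) \<longlonglongrightarrow> b"
  proof (rule tendstoI)
    fix e :: real assume "e > 0"
    from upper[OF this] lower[OF this]
    show "\<forall>\<^sub>F j in sequentially. dist (nu (q j) (Suc k)) b < e"
      by eventually_elim (auto simp: dist_real_def simp del: nu.simps)
  qed
  then show ?case by (simp only: b_def)
qed simp

lemma nu_subsequence:
  fixes q :: "nat \<Rightarrow> real"
  assumes q: "q \<longlonglongrightarrow> p" "\<And>j. 2 \<le> q j"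
  obtains r where "strict_mono (r :: nat \<Rightarrow> nat)" "(\<lambda>j. nu (q (r j)) k) \<longlonglongrightarrow> nu p k"
proof -
  have "p \<ge> 2" using q by (intro LIMSEQ_le_const) auto
  obtain r where r: "strict_mono (r :: nat \<Rightarrow> nat)"
    "\<And>e. 0 < e \<Longrightarrow> \<forall>\<^sub>F j in sequentially. \<forall>x\<in>{0..nu p k + 1}. \<bar>profile (q (r j)) x - profile p x\<bar> < e"
    using profile_subsequence[OF q, of "nu p k + 1"] by blast
  show ?thesis
    by (rule that[OF r(1)], rule nu_tendsto[OF \<open>p \<ge> 2\<close> q(2) r(2)]) auto
qed

lemma radial_eigenvalue_iff_nu:
  assumes "p \<ge> 2"
  shows "radial_eigenvalue p \<mu> \<longleftrightarrow> (\<exists>i\<ge>1. \<mu> = nu p i powr p)"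
proof
  assume "radial_eigenvalue p \<mu>"
  then obtain u u' x where u: "rsol p \<mu> 1 u u'" "u 1 = 0" "x \<in> {0..1}" "u x \<noteq> 0"
    unfolding radial_eigenvalue_rsol by blast
  have "\<mu> > 0" by (rule radial_eigenvalue_pos[OF u(1) _ u(2-4)]) (use assms in simp)
  define c where "c = \<mu> powr (1 / p)"
  have c: "c > 0" "c powr p = \<mu>" using \<open>\<mu> > 0\<close> assms by (auto simp: c_def powr_powr)
  have scaled: "rsol p 1 c (\<lambda>s. a * u (s / c)) (\<lambda>s. a / c * u' (s / c))" for a
    using rsol_scale[OF u(1) c(1), of a] assms c \<open>\<mu> > 0\<close> by simp
  \<comment> \<open>By the energy bound a solution starting from 0 vanishes identically, so u can be
    divided by its initial value.\<close>
  have "u 0 \<noteq> 0"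
  proof
    assume "u 0 = 0"
    then have "1 * u (x * c / c) = 0"
      by (intro rsol_zero_start[OF scaled[of 1], of "x * c"]) (use assms u c in \<open>auto simp: mult_le_cancel_right1\<close>)
    then show False using u(4) c by simp
  qed
  have "1 / u 0 * u (c / c) = profile p c"
    by (rule profile_unique[OF assms scaled[of "1 / u 0"]]) (use \<open>u 0 \<noteq> 0\<close> c in auto)
  then have "profile p c = 0 \<and> c > 0" using u(2) c by simp
  then show "\<exists>i\<ge>1. \<mu> = nu p i powr p" using profile_zero_iff_nu[OF assms] c by metis
next
  assume "\<exists>i\<ge>1. \<mu> = nu p i powr p"
  then obtain i where i: "i \<ge> 1" "\<mu> = nu p i powr p" by blast
  define x where "x = nu p i"
  have x: "profile p x = 0" "x > 0" using profile_zero_iff_nu[OF assms, of x] i(1) by (auto simp: x_def)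
  have "rsol p (1 / (1 / x) powr p) (x * (1 / x)) (\<lambda>s. 1 * profile p (s / (1 / x))) (\<lambda>s. 1 / (1 / x) * profile' p (s / (1 / x)))"
    by (rule rsol_scale[OF rsol_profile[OF assms]]) (use x assms in auto)
  moreover have "1 / (1 / x) powr p = \<mu>" using x i by (simp add: powr_divide x_def)
  ultimately have "rsol p \<mu> 1 (\<lambda>s. profile p (s * x)) (\<lambda>s. x * profile' p (s * x))" using x by simp
  then show "radial_eigenvalue p \<mu>"
    unfolding radial_eigenvalue_rsol using x profile_0[OF assms]
    by (intro exI[of _ "\<lambda>s. profile p (s * x)"] exI[of _ "\<lambda>s. x * profile' p (s * x)"] conjI)
       (auto intro!: bexI[of _ 0])
qed

lemma kth_radial_eigenvalue_nu:
  assumes "p \<ge> 2" "k \<ge> 1"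
  shows "kth_radial_eigenvalue p k (nu p k powr p)"
proof -
  have less: "nu p i powr p < nu p j powr p \<longleftrightarrow> i < j" for i j
  proof -
    have *: "nu p i powr p < nu p j powr p" if "i < j" for i j
      using nu_zero[OF assms(1), of i] assms(1) strict_monoD[OF nu_strict_mono[OF assms(1)] that]
      by (intro powr_less_mono2) auto
    show ?thesis using *[of i j] *[of j i] by (cases i j rule: linorder_cases) auto
  qed
  have inj: "inj_on (\<lambda>i. nu p i powr p) A" for A
  proof (rule inj_onI)
    fix i j assume "nu p i powr p = nu p j powr p"
    then show "i = j" using less[of i j] less[of j i] by simp
  qed
  have "{\<nu>. radial_eigenvalue p \<nu> \<and> \<nu> < nu p k powr p} = (\<lambda>i. nu p i powr p) ` {1..<k}"
    using less by (auto simp: radial_eigenvalue_iff_nu[OF assms(1)])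
  then show ?thesis
    unfolding kth_radial_eigenvalue_def using inj assms
    by (auto simp: card_image radial_eigenvalue_iff_nu[OF assms(1)])
qed

section \<open>Zeros for p = 2\<close>

text \<open>Comparison with the order-zero Bessel equation. Here k stands for r h', and e is the
  defect of h in that equation; the derivative of the weighted Wronskian is -\<sigma>
  \<open>profile 2\<close> e. The factor \<sigma> fixes the sign of the profile.\<close>

lemma wronskian_less:
  assumes ab: "0 \<le> a" "a < b" and pos: "\<And>r. a < r \<Longrightarrow> r < b \<Longrightarrow> \<sigma> * profile 2 r > 0"
    and c: "continuous_on {a..b} h" "continuous_on {a..b} k"
    and dh: "\<And>r. a < r \<Longrightarrow> r < b \<Longrightarrow> (h has_real_derivative k r / r) (at r)"
    and dk: "\<And>r. a < r \<Longrightarrow> r < b \<Longrightarrow> (k has_real_derivative - r * h r + e r) (at r)"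
    and e: "\<And>r. a < r \<Longrightarrow> r < b \<Longrightarrow> e r > 0"
  shows "b * (\<sigma> * profile' 2 b) * h b - \<sigma> * profile 2 b * k b < a * (\<sigma> * profile' 2 a) * h a - \<sigma> * profile 2 a * k a"
proof (rule DERIV_neg_imp_decreasing_open[where f = "\<lambda>r. r * (\<sigma> * profile' 2 r) * h r - \<sigma> * profile 2 r * k r"])
  show "continuous_on {a..b} (\<lambda>r. r * (\<sigma> * profile' 2 r) * h r - \<sigma> * profile 2 r * k r)"
    by (intro continuous_intros c profile_continuous) (use ab in auto)
  fix r assume r: "a < r" "r < b"
  then have "r > 0" using ab by simp
  have dU: "(profile 2 has_real_derivative profile' 2 r) (at r)"
    by (rule profile_deriv) (use \<open>r > 0\<close> in auto)
  have dY: "((\<lambda>s. s * profile' 2 s) has_real_derivative - r * profile 2 r) (at r)"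
    using profile_deriv(2)[of 2 r] \<open>r > 0\<close> by simp
  have "((\<lambda>s. \<sigma> * (s * profile' 2 s) * h s - \<sigma> * profile 2 s * k s) has_real_derivative
     (\<sigma> * (- r * profile 2 r) * h r + k r / r * (\<sigma> * (r * profile' 2 r)))
     - (\<sigma> * profile' 2 r * k r + (- r * h r + e r) * (\<sigma> * profile 2 r))) (at r)"
    by (intro DERIV_diff DERIV_mult DERIV_cmult dU dY dh dk r)
  moreover have "(\<sigma> * (- r * profile 2 r) * h r + k r / r * (\<sigma> * (r * profile' 2 r)))
     - (\<sigma> * profile' 2 r * k r + (- r * h r + e r) * (\<sigma> * profile 2 r)) = - (\<sigma> * profile 2 r * e r)"
    using \<open>r > 0\<close> by (simp add: field_simps)
  moreover have "- (\<sigma> * profile 2 r * e r) < 0"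
    using pos[OF r] e[OF r] by simp
  moreover have "(\<lambda>s. \<sigma> * (s * profile' 2 s) * h s - \<sigma> * profile 2 s * k s) =
      (\<lambda>r. r * (\<sigma> * profile' 2 r) * h r - \<sigma> * profile 2 r * k r)"
    by (simp add: fun_eq_iff mult_ac)
  ultimately show "\<exists>y. ((\<lambda>r. r * (\<sigma> * profile' 2 r) * h r - \<sigma> * profile 2 r * k r) has_real_derivative y) (at r) \<and> y < 0"
    by metis
qed (use ab in auto)

text \<open>After multiplication by sqrt r the profile oscillates with squared frequency
  \<open>1 + 1 / (4 * r\<^sup>2)\<close>, hence faster than the sine. The comparison function is a
  shifted sine divided by sqrt r.\<close>

lemma nu_2_gap: "nu 2 (Suc (Suc i)) \<le> nu 2 (Suc i) + pi"
proof (rule ccontr)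
  assume *: "\<not> ?thesis"
  define a where "a = nu 2 (Suc i)"
  define b where "b = a + pi"
  have "a > 0" unfolding a_def by (rule nu_pos) auto
  have Ua: "profile 2 a = 0" unfolding a_def by (rule profile_nu_Suc) auto
  have nz: "profile 2 r \<noteq> 0" if "a < r" "r \<le> b" for r
    using nu_Suc_le[of 2 "Suc i" r] that * by (auto simp: a_def b_def simp del: nu.simps)
  define \<sigma> where "\<sigma> = sgn (profile 2 b)"
  have "a < b" by (simp add: b_def)
  have sb: "\<sigma> * profile 2 b > 0" using nz[of b] \<open>a < b\<close> by (auto simp: \<sigma>_def sgn_if)
  have pos: "\<sigma> * profile 2 r > 0" if r: "a < r" "r \<le> b" for r
  proof (rule ccontr)
    assume "\<not> \<sigma> * profile 2 r > 0"
    moreover have "continuous_on {r..b} (\<lambda>r. \<sigma> * profile 2 r)"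
      by (intro continuous_intros profile_continuous) (use r \<open>a > 0\<close> in auto)
    ultimately have "\<exists>x\<ge>r. x \<le> b \<and> \<sigma> * profile 2 x = 0"
      by (intro IVT') (use sb r in auto)
    then obtain x where "r \<le> x" "x \<le> b" "\<sigma> * profile 2 x = 0" by blast
    then show False using nz[of x] r sb by auto
  qed
  let ?h = "\<lambda>r. sin (r - a) / sqrt r"
  let ?k = "\<lambda>r. sqrt r * cos (r - a) - sin (r - a) / (2 * sqrt r)"
  have "b * (\<sigma> * profile' 2 b) * ?h b - \<sigma> * profile 2 b * ?k b < a * (\<sigma> * profile' 2 a) * ?h a - \<sigma> * profile 2 a * ?k a"
  proof (rule wronskian_less[where e = "\<lambda>r. sin (r - a) / (4 * r * sqrt r)"])
    show "continuous_on {a..b} ?h" "continuous_on {a..b} ?k"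
      using \<open>a > 0\<close> by (auto intro!: continuous_intros)
    fix r assume r: "a < r" "r < b"
    then have "r > 0" using \<open>a > 0\<close> by simp
    define s where "s = sqrt r"
    have s: "s > 0" "r = s * s" using \<open>r > 0\<close> by (auto simp: s_def)
    have ds: "(sqrt has_real_derivative inverse s / 2) (at r)"
      unfolding s_def by (rule DERIV_real_sqrt) (use \<open>r > 0\<close> in auto)
    have dsin: "((\<lambda>r. sin (r - a)) has_real_derivative cos (r - a)) (at r)"
      by (auto intro!: derivative_eq_intros)
    have dcos: "((\<lambda>r. cos (r - a)) has_real_derivative - sin (r - a)) (at r)"
      by (auto intro!: derivative_eq_intros)
    have "sqrt r \<noteq> 0" "2 * sqrt r \<noteq> 0" using \<open>r > 0\<close> by auto
    from DERIV_divide[OF dsin ds this(1)]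
    have "(?h has_real_derivative (cos (r - a) * s - sin (r - a) * (inverse s / 2)) / (s * s)) (at r)"
      by (simp add: s_def)
    moreover have "(cos (r - a) * s - sin (r - a) * (inverse s / 2)) / (s * s) = ?k r / r"
      unfolding s_def[symmetric] s(2)[symmetric] using s by (simp add: field_simps)
    ultimately show "(?h has_real_derivative ?k r / r) (at r)" by simp
    from DERIV_diff[OF DERIV_mult[OF ds dcos] DERIV_divide[OF dsin DERIV_cmult[OF ds, of 2] \<open>2 * sqrt r \<noteq> 0\<close>]]
    have "(?k has_real_derivative (inverse s / 2 * cos (r - a) + - sin (r - a) * s)
       - (cos (r - a) * (2 * s) - sin (r - a) * (2 * (inverse s / 2))) / (2 * s * (2 * s))) (at r)"
      by (simp add: s_def)
    moreover have "(inverse s / 2 * cos (r - a) + - sin (r - a) * s)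
       - (cos (r - a) * (2 * s) - sin (r - a) * (2 * (inverse s / 2))) / (2 * s * (2 * s))
       = - r * ?h r + sin (r - a) / (4 * r * sqrt r)"
    proof -
      have "\<And>S C :: real. (inverse s / 2 * C + - S * s) - (C * (2 * s) - S * (2 * (inverse s / 2))) / (2 * s * (2 * s))
         = - (s * s) * (S / s) + S / (4 * (s * s) * s)"
        using s(1) by (simp add: field_simps)
      from this[of "cos (r - a)" "sin (r - a)"] show ?thesis
        unfolding s_def[symmetric] by (simp only: s(2)[symmetric])
    qed
    ultimately show "(?k has_real_derivative - r * ?h r + sin (r - a) / (4 * r * sqrt r)) (at r)" by simp
    have "sin (r - a) > 0" by (rule sin_gt_zero) (use r in \<open>auto simp: b_def\<close>)
    then show "sin (r - a) / (4 * r * sqrt r) > 0" using \<open>r > 0\<close> by simp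
  qed (use pos \<open>a > 0\<close> \<open>a < b\<close> in auto)
  \<comment> \<open>At a both the profile and \<open>?h\<close> vanish; at b, half a period later,
    \<open>?h\<close> vanishes and \<open>?k\<close> equals - sqrt b.\<close>
  then have "\<sigma> * profile 2 b * sqrt b < 0" using Ua by (simp add: b_def)
  moreover have "\<sigma> * profile 2 b * sqrt b > 0"
    by (rule mult_pos_pos[OF sb]) (use \<open>a > 0\<close> \<open>a < b\<close> in simp)
  ultimately show False by linarith
qed

text \<open>The comparison function is the Taylor polynomial of \<open>J\<^sub>0\<close> of degree 8.\<close>

lemma nu_2_1: "nu 2 (Suc 0) \<le> 241 / 100"
proof (rule ccontr)
  assume *: "\<not> ?thesis"
  \<comment> \<open>The first zero of J_0 is about 2.4048; at 2.41 the Taylor polynomial below is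
    already negative.\<close>
  define b :: real where "b = 241 / 100"
  have nz: "profile 2 r \<noteq> 0" if "0 \<le> r" "r \<le> b" for r
    using nu_Suc_le[of 2 0 r] that * profile_0[of 2] by (cases "r = 0") (auto simp: b_def simp del: nu.simps(2))
  have pos: "profile 2 r > 0" if r: "0 \<le> r" "r \<le> b" for r
  proof (rule ccontr)
    assume "\<not> profile 2 r > 0"
    then have "\<exists>x\<ge>0. x \<le> r \<and> profile 2 x = 0"
      by (intro IVT2' profile_continuous) (use r profile_0[of 2] in auto)
    then obtain x where "0 \<le> x" "x \<le> r" "profile 2 x = 0" by blast
    then show False using nz[of x] r by auto
  qed
  have Y: "b * profile' 2 b \<le> 0 * profile' 2 0"
  proof (rule DERIV_nonpos_imp_decreasing_open[where f = "\<lambda>r. r * profile' 2 r"])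
    show "continuous_on {0..b} (\<lambda>r. r * profile' 2 r)"
      by (intro continuous_intros profile_continuous) auto
    fix r assume r: "0 < r" "r < b"
    have "- r * profile 2 r \<le> 0" using pos[of r] r by simp
    then show "\<exists>y. ((\<lambda>r. r * profile' 2 r) has_real_derivative y) (at r) \<and> y \<le> 0"
      using profile_deriv(2)[of 2 r] r by auto
  qed (auto simp: b_def)
  \<comment> \<open>Stopping at a positive coefficient makes the defect, r times the last term,
    positive. \<open>?k\<close> is r times the derivative.\<close>
  let ?h = "\<lambda>r. 1 - r ^ 2 / 4 + r ^ 4 / 64 - r ^ 6 / 2304 + r ^ 8 / (147456 :: real)"
  let ?k = "\<lambda>r. - (r ^ 2) / 2 + r ^ 4 / 16 - r ^ 6 / 384 + r ^ 8 / (18432 :: real)"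
  have "b * (1 * profile' 2 b) * ?h b - 1 * profile 2 b * ?k b < 0 * (1 * profile' 2 0) * ?h 0 - 1 * profile 2 0 * ?k 0"
  proof (rule wronskian_less[where e = "\<lambda>r. r ^ 9 / 147456"])
    show "continuous_on {0..b} ?h" "continuous_on {0..b} ?k"
      by (intro continuous_intros; simp)+
    fix r assume r: "0 < r" "r < b"
    have "(?h has_real_derivative - r / 2 + r ^ 3 / 16 - r ^ 5 / 384 + r ^ 7 / 18432) (at r)"
      by (auto intro!: derivative_eq_intros)
    moreover have "- r / 2 + r ^ 3 / 16 - r ^ 5 / 384 + r ^ 7 / 18432 = ?k r / r"
      using r by (simp add: field_simps power_def eval_nat_numeral)
    ultimately show "(?h has_real_derivative ?k r / r) (at r)" by simp
    show "(?k has_real_derivative - r * ?h r + r ^ 9 / 147456) (at r)"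
      by (auto intro!: derivative_eq_intros simp: algebra_simps eval_nat_numeral)
  qed (use pos in \<open>auto simp: b_def\<close>)
  then have "b * profile' 2 b * ?h b < profile 2 b * ?k b" by simp
  \<comment> \<open>With a positive profile and a nonpositive slope at b, these signs contradict the
    strict inequality just derived.\<close>
  moreover have "?h b \<le> 0" "?k b \<le> 0" by (simp_all add: b_def power_divide)
  then have "b * profile' 2 b * ?h b \<ge> 0" "profile 2 b * ?k b \<le> 0"
    using Y pos[of b] by (auto intro!: mult_nonpos_nonpos mult_nonneg_nonpos simp: b_def)
  ultimately show False by linarith
qed

lemma nu_2_le: "nu 2 (Suc i) \<le> 241 / 100 + pi * real i"
proof (induction i)
  case 0
  then show ?case using nu_2_1 by (simp del: nu.simps)
next
  case (Suc i)
  then show ?case using nu_2_gap[of i] by (simp add: algebra_simps del: nu.simps)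
qed

section \<open>Positivity of Bessel functions\<close>

text \<open>\<open>bessel n (x\<^sup>2)\<close> is \<open>2\<^sup>n n! x\<^sup>-\<^sup>n J\<^sub>n(x)\<close>.\<close>

definition bcoeff :: "nat \<Rightarrow> nat \<Rightarrow> real" where
  "bcoeff n j = (- 1 / 4) ^ j * fact n / (fact j * fact (n + j))"

definition bessel :: "nat \<Rightarrow> real \<Rightarrow> real" where
  "bessel n t = (\<Sum>j. bcoeff n j * t ^ j)"

definition bessel' :: "nat \<Rightarrow> real \<Rightarrow> real" where
  "bessel' n t = (\<Sum>j. diffs (bcoeff n) j * t ^ j)"

definition bessel'' :: "nat \<Rightarrow> real \<Rightarrow> real" where
  "bessel'' n t = (\<Sum>j. diffs (diffs (bcoeff n)) j * t ^ j)"

lemma summable_bcoeff: "summable (\<lambda>j. bcoeff n j * t ^ j)"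
proof (rule summable_comparison_test)
  show "summable (\<lambda>j. inverse (fact j) * \<bar>t\<bar> ^ j)" by (rule summable_exp)
  show "\<exists>N. \<forall>j\<ge>N. norm (bcoeff n j * t ^ j) \<le> inverse (fact j) * \<bar>t\<bar> ^ j"
  proof (intro exI allI impI)
    fix j
    have "fact n \<le> (fact (n + j) :: real)" by (rule fact_mono) simp
    moreover have "\<bar>(- 1 / 4 :: real) ^ j\<bar> \<le> 1" by (simp add: power_abs power_le_one)
    ultimately have "\<bar>(- 1 / 4 :: real) ^ j\<bar> * (fact n / fact (n + j)) \<le> 1 * 1"
      by (intro mult_mono) auto
    then have "\<bar>(- 1 / 4 :: real) ^ j\<bar> * (fact n / fact (n + j)) * (inverse (fact j) * \<bar>t\<bar> ^ j) \<le> 1 * (inverse (fact j) * \<bar>t\<bar> ^ j)"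
      by (intro mult_right_mono) auto
    moreover have "norm (bcoeff n j * t ^ j) = \<bar>(- 1 / 4 :: real) ^ j\<bar> * (fact n / fact (n + j)) * (inverse (fact j) * \<bar>t\<bar> ^ j)"
      by (simp add: bcoeff_def abs_mult power_abs field_simps)
    ultimately show "norm (bcoeff n j * t ^ j) \<le> inverse (fact j) * \<bar>t\<bar> ^ j" by simp
  qed
qed

lemma bessel_deriv: "(bessel n has_real_derivative bessel' n t) (at t)"
  unfolding bessel_def[abs_def] bessel'_def
  by (rule termdiffs_strong_converges_everywhere[OF summable_bcoeff])

lemma summable_bcoeff': "summable (\<lambda>j. diffs (bcoeff n) j * t ^ j)"
  by (rule termdiff_converges_all[OF summable_bcoeff])

lemma bessel'_deriv: "(bessel' n has_real_derivative bessel'' n t) (at t)"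
  unfolding bessel'_def[abs_def] bessel''_def
  by (rule termdiffs_strong_converges_everywhere[OF summable_bcoeff'])

lemma bessel_0 [simp]: "bessel n 0 = 1"
  unfolding bessel_def powser_zero by (simp add: bcoeff_def)

text \<open>Bessel's equation of order n after division by the n-th power of x and the substitution
  \<open>t = x\<^sup>2\<close>; it amounts to the recursion of the coefficients.\<close>

lemma bessel_ode: "t * bessel'' n t + (real n + 1) * bessel' n t + bessel n t / 4 = 0"
proof -
  define d where "d = diffs (bcoeff n)"
  have s2: "(\<lambda>j. diffs d j * t ^ j) sums bessel'' n t"
    unfolding bessel''_def d_def by (intro summable_sums termdiff_converges_all[OF summable_bcoeff'])
  have "(\<lambda>j. t * (diffs d j * t ^ j)) sums (t * bessel'' n t)" by (rule sums_mult[OF s2])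
  moreover have "t * (diffs d j * t ^ j) = real (Suc j) * d (Suc j) * t ^ Suc j" for j
    by (simp add: diffs_def)
  ultimately have "(\<lambda>j. real (Suc j) * d (Suc j) * t ^ Suc j) sums (t * bessel'' n t)" by simp
  then have "(\<lambda>j. real j * d j * t ^ j) sums (t * bessel'' n t + real 0 * d 0 * t ^ 0)"
    by (rule sums_Suc)
  moreover have "(\<lambda>j. (real n + 1) * (d j * t ^ j)) sums ((real n + 1) * bessel' n t)"
    unfolding bessel'_def d_def by (intro sums_mult summable_sums summable_bcoeff')
  moreover have "(\<lambda>j. bcoeff n j * t ^ j / 4) sums (bessel n t / 4)"
    unfolding bessel_def by (intro sums_divide summable_sums summable_bcoeff)
  ultimately have "(\<lambda>j. real j * d j * t ^ j + (real n + 1) * (d j * t ^ j) + bcoeff n j * t ^ j / 4) sums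
    (t * bessel'' n t + real 0 * d 0 * t ^ 0 + (real n + 1) * bessel' n t + bessel n t / 4)"
    by (intro sums_add)
  moreover have "real j * d j * t ^ j + (real n + 1) * (d j * t ^ j) + bcoeff n j * t ^ j / 4 = 0" for j
  proof -
    have "d j = - bcoeff n j / (4 * (real n + real j + 1))"
      by (simp add: d_def diffs_def bcoeff_def field_simps del: of_nat_Suc) (simp add: algebra_simps)
    then have "(real j + real n + 1) * d j + bcoeff n j / 4 = 0"
      by (simp add: field_simps)
    moreover have "real j * d j * t ^ j + (real n + 1) * (d j * t ^ j) + bcoeff n j * t ^ j / 4 =
      ((real j + real n + 1) * d j + bcoeff n j / 4) * t ^ j" by (simp add: algebra_simps)
    ultimately show ?thesis by simp
  qed
  ultimately show ?thesis using sums_unique2[OF sums_zero] by fastforce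
qed

text \<open>The Wronskian v'h - vh' is nondecreasing, so v/h is too. The first conclusion hands the
  lower bound on v'/v to the next comparison when several are chained.\<close>

lemma sturm_compare:
  fixes v v' h h' q s :: "real \<Rightarrow> real"
  assumes ab: "a < b"
    and c: "continuous_on {a..b} v" "continuous_on {a..b} v'" "continuous_on {a..b} h" "continuous_on {a..b} h'"
    and dv: "\<And>x. x \<in> {a<..<b} \<Longrightarrow> (v has_real_derivative v' x) (at x)"
    and dv': "\<And>x. x \<in> {a<..<b} \<Longrightarrow> (v' has_real_derivative q x * v x) (at x)"
    and dh: "\<And>x. x \<in> {a<..<b} \<Longrightarrow> (h has_real_derivative h' x) (at x)"
    and dh': "\<And>x. x \<in> {a<..<b} \<Longrightarrow> (h' has_real_derivative s x * h x) (at x)"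
    and qs: "\<And>x. x \<in> {a<..<b} \<Longrightarrow> s x \<le> q x"
    and v: "\<And>x. x \<in> {a<..<b} \<Longrightarrow> v x > 0" and h: "\<And>x. x \<in> {a..b} \<Longrightarrow> h x > 0"
    and init: "v a * h' a \<le> v' a * h a"
  shows "v b * h' b \<le> v' b * h b" "v b > 0"
proof -
  have W: "v x * h' x \<le> v' x * h x" if x: "x \<in> {a..b}" for x
  proof -
    have "v' a * h a - v a * h' a \<le> v' x * h x - v x * h' x"
    proof (rule DERIV_nonneg_imp_increasing_open[where f = "\<lambda>x. v' x * h x - v x * h' x"])
      show "continuous_on {a..x} (\<lambda>x. v' x * h x - v x * h' x)"
        by (rule continuous_on_subset[of "{a..b}"]) (use x in \<open>auto intro!: continuous_intros c\<close>)
      fix y assume y': "a < y" "y < x"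
      then have y: "y \<in> {a<..<b}" using x by auto
      have "((\<lambda>x. v' x * h x - v x * h' x) has_real_derivative
         (q y * v y * h y + h' y * v' y) - (v' y * h' y + s y * h y * v y)) (at y)"
        by (intro DERIV_diff DERIV_mult dv dv' dh dh' y)
      moreover have "(q y * v y * h y + h' y * v' y) - (v' y * h' y + s y * h y * v y) = (q y - s y) * v y * h y"
        by (simp add: algebra_simps)
      moreover have "(q y - s y) * v y * h y \<ge> 0"
        using qs[OF y] v[OF y] h[of y] y by simp
      ultimately show "\<exists>z. ((\<lambda>x. v' x * h x - v x * h' x) has_real_derivative z) (at y) \<and> z \<ge> 0"
        by metis
    qed (use x in auto)
    then show ?thesis using init by simp
  qed
  then show "v b * h' b \<le> v' b * h b" using ab by simp
  \<comment> \<open>v may vanish at a, so the quotient is followed from an interior point, where it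
    is positive.\<close>
  define m where "m = (a + b) / 2"
  have m: "m \<in> {a<..<b}" using ab by (simp add: m_def)
  have "v m / h m \<le> v b / h b"
  proof (rule DERIV_nonneg_imp_increasing_open[where f = "\<lambda>x. v x / h x"])
    show "continuous_on {m..b} (\<lambda>x. v x / h x)"
      by (rule continuous_on_subset[of "{a..b}"]) (use m h in \<open>force intro!: continuous_intros c\<close>)+
    fix y assume y': "m < y" "y < b"
    then have y: "y \<in> {a<..<b}" using m by auto
    have "h y > 0" using h y by auto
    then have "((\<lambda>x. v x / h x) has_real_derivative (v' y * h y - v y * h' y) / (h y * h y)) (at y)"
      by (intro DERIV_divide dv dh y) auto
    moreover have "(v' y * h y - v y * h' y) / (h y * h y) \<ge> 0"
      using W[of y] y \<open>h y > 0\<close> by auto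
    ultimately show "\<exists>z. ((\<lambda>x. v x / h x) has_real_derivative z) (at y) \<and> z \<ge> 0" by metis
  qed (use m in auto)
  moreover have "v m / h m > 0" using v[OF m] h[of m] m by auto
  ultimately have "v b / h b > 0" by linarith
  then show "v b > 0" using h[of b] ab by (simp add: zero_less_divide_iff)
qed

lemma cos_ge_quadratic: "1 - x\<^sup>2 / 2 \<le> cos (x::real)"
proof -
  have "cos x = 1 - 2 * (sin (x / 2))\<^sup>2" using cos_double_sin[of "x / 2"] by simp
  moreover have "(sin (x / 2))\<^sup>2 \<le> (x / 2)\<^sup>2"
    using abs_sin_x_le_abs_x[of "x / 2"] unfolding abs_le_square_iff .
  ultimately show ?thesis by (simp add: power_divide)
qed

text \<open>With \<open>v = x\<^sup>n\<^sup>+\<^sup>1\<^sup>/\<^sup>2 bessel n (x\<^sup>2)\<close> the equation reads \<open>v'' = ((n\<^sup>2 - 1/4) / x\<^sup>2 - 1) v\<close>.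
  It is compared with an exponential up to \<open>n - 1\<close>, with a linear function up to the turning point
  \<open>sqrt (n\<^sup>2 - 1/4)\<close>, and with a trigonometric function of frequency \<open>K\<close> beyond it.\<close>

lemma bessel_pos:
  fixes n :: nat and b K \<beta> \<kappa> :: real
  assumes n: "n \<ge> 2" and b: "real n < b" and K: "K > 0" "b\<^sup>2 * (1 - K\<^sup>2) \<le> (real n)\<^sup>2 - 1 / 4"
    and \<beta>: "0 \<le> \<beta>" "\<beta> \<le> 1" "K * (b - real n + 1 / (7 * real n)) \<le> pi / 2 + \<beta>"
    and \<kappa>: "\<kappa> > 0" "\<kappa>\<^sup>2 * real n \<le> 2" "K * \<beta> * (1 + \<kappa>) < \<kappa> * (1 - \<beta>\<^sup>2 / 2)"
    and x: "0 \<le> x" "x \<le> b"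
  shows "bessel n (x\<^sup>2) > 0"
proof (rule ccontr)
  assume neg: "\<not> ?thesis"
  define N where "N = real n"
  have N: "N \<ge> 2" using n by (simp add: N_def)
  define f where "f = (\<lambda>x. bessel n (x\<^sup>2))"
  define f' where "f' = (\<lambda>x. bessel' n (x\<^sup>2))"
  have df: "(f has_real_derivative 2 * x * f' x) (at x)" for x
    unfolding f_def f'_def
    by (rule DERIV_cong[OF DERIV_chain2[OF bessel_deriv DERIV_square[OF DERIV_ident]]]) simp
  have df': "(f' has_real_derivative 2 * x * bessel'' n (x\<^sup>2)) (at x)" for x
    unfolding f'_def
    by (rule DERIV_cong[OF DERIV_chain2[OF bessel'_deriv DERIV_square[OF DERIV_ident]]]) simp
  have cf: "continuous_on A f" "continuous_on A f'" for A
    using df df' by (auto intro!: continuous_at_imp_continuous_on DERIV_isCont)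
  define S where "S = {y \<in> {0..b}. f y \<le> 0}"
  have "closed S" unfolding S_def by (rule continuous_on_closed_Collect_le) (auto intro!: cf)
  moreover have "x \<in> S" using neg x by (simp add: S_def f_def)
  moreover have bdd: "bdd_below S" by (auto simp: S_def bdd_below_def)
  ultimately have InfS: "Inf S \<in> S" by (intro closed_contains_Inf) auto
  \<comment> \<open>The first point where positivity fails. Every comparison below may be run up to
    \<xi> if \<xi> lies in its range, and would then give v(\<xi>) > 0; so \<xi> lies beyond each
    stage in turn.\<close>
  define \<xi> where "\<xi> = Inf S"
  have \<xi>: "0 \<le> \<xi>" "\<xi> \<le> b" "f \<xi> \<le> 0" using InfS by (auto simp: S_def \<xi>_def)
  have fpos: "f y > 0" if "0 \<le> y" "y < \<xi>" for y
    using cInf_lower[OF _ bdd, of y] that \<xi> by (force simp: S_def \<xi>_def)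
  have "\<xi> > 0" using \<xi> by (cases "\<xi> = 0") (auto simp: f_def)
  define \<nu> where "\<nu> = N\<^sup>2 - 1 / 4"
  define q where "q = (\<lambda>x. \<nu> / x\<^sup>2 - 1)"
  define v where "v = (\<lambda>x. x powr (N + 1 / 2) * f x)"
  define v' where "v' = (\<lambda>x. (N + 1 / 2) * x powr (N - 1 / 2) * f x + 2 * x powr (N + 3 / 2) * f' x)"
  have cv: "continuous_on {a..c} v" "continuous_on {a..c} v'" if "a \<ge> 0" for a c
    unfolding v_def v'_def using N that by (auto intro!: continuous_intros cf continuous_on_powr')
  have dv: "(v has_real_derivative v' x) (at x)" if "x > 0" for x
  proof -
    have "(v has_real_derivative (N + 1 / 2) * x powr (N + 1 / 2 - 1) * f x + 2 * x * f' x * x powr (N + 1 / 2)) (at x)"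
      unfolding v_def by (intro DERIV_mult has_real_derivative_powr that df)
    moreover have "x * x powr (N + 1 / 2) = x powr (N + 3 / 2)"
      using that powr_add[of x 1 "N + 1 / 2"] by (simp add: add.commute)
    moreover have "(N + 1 / 2) * x powr (N + 1 / 2 - 1) * f x + 2 * x * f' x * x powr (N + 1 / 2) =
        (N + 1 / 2) * x powr (N - 1 / 2) * f x + 2 * (x * x powr (N + 1 / 2)) * f' x" by simp
    ultimately show ?thesis by (simp only: v'_def)
  qed
  have dv': "(v' has_real_derivative q x * v x) (at x)" if "x > 0" for x
  proof -
    define P where "P = x powr (N - 3 / 2)"
    have pw: "x powr (N - 1 / 2) = x * P" "x powr (N + 1 / 2) = x\<^sup>2 * P" "x powr (N + 3 / 2) = x ^ 3 * P"
      using that powr_add[of x 1 "N - 3 / 2"] powr_add[of x 2 "N - 3 / 2"] powr_add[of x 3 "N - 3 / 2"]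
      by (simp_all add: P_def powr_numeral add.commute)
    let ?D = "((N + 1 / 2) * ((N - 1 / 2) * x powr (N - 1 / 2 - 1)) * f x + 2 * x * f' x * ((N + 1 / 2) * x powr (N - 1 / 2)))
       + (2 * ((N + 3 / 2) * x powr (N + 3 / 2 - 1)) * f' x + 2 * x * bessel'' n (x\<^sup>2) * (2 * x powr (N + 3 / 2)))"
    have "(v' has_real_derivative ?D) (at x)"
      unfolding v'_def by (intro DERIV_add DERIV_mult DERIV_cmult has_real_derivative_powr that df df')
    moreover have "?D = q x * v x"
    proof -
      have e: "N - 1 / 2 - 1 = N - 3 / 2" "N + 3 / 2 - 1 = N + 1 / 2" by auto
      have ode: "x\<^sup>2 * bessel'' n (x\<^sup>2) = - (N + 1) * f' x - f x / 4"
        using bessel_ode[of "x\<^sup>2" n] by (simp add: f_def f'_def N_def algebra_simps)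
      have "?D = P * (\<nu> * f x + 4 * (N + 1) * (x\<^sup>2 * f' x) + 4 * x\<^sup>2 * (x\<^sup>2 * bessel'' n (x\<^sup>2)))"
        unfolding e pw P_def[symmetric] by (simp add: \<nu>_def power2_eq_square power3_eq_cube algebra_simps)
      also have "\<dots> = P * (\<nu> - x\<^sup>2) * f x"
        unfolding ode by (simp add: algebra_simps)
      also have "\<dots> = q x * v x"
        unfolding v_def pw q_def using that by (simp add: field_simps)
      finally show ?thesis .
    qed
    ultimately show ?thesis by simp
  qed
  have vpos: "v y > 0" if "0 < y" "y < \<xi>" for y
    using fpos[of y] that by (simp add: v_def)
  have v\<xi>: "\<not> v \<xi> > 0" using \<xi> \<open>\<xi> > 0\<close> by (simp add: v_def mult_le_0_iff not_less)
  define x0 where "x0 = sqrt \<nu>"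
  define x1 where "x1 = N - 1"
  have "\<nu> > 0"
  proof -
    have "N\<^sup>2 \<ge> 2\<^sup>2" using N by (intro power_mono) auto
    then show ?thesis by (simp add: \<nu>_def)
  qed
  have x0: "x0 > 0" "x0\<^sup>2 = \<nu>" using \<open>\<nu> > 0\<close> by (auto simp: x0_def)
  have "x0 \<le> N" unfolding x0_def by (rule real_le_lsqrt) (use N in \<open>auto simp: \<nu>_def\<close>)
  \<comment> \<open>The turning point is N - 1/(8N) to leading order; the 7 leaves room for the
    remainder and explains the term 1/(7n) in the hypothesis on \<beta>.\<close>
  have "N - 1 / (7 * N) \<le> x0"
    unfolding x0_def
  proof (rule real_le_rsqrt)
    have "(1 / (7 * N))\<^sup>2 \<le> (1 / 14)\<^sup>2"
      using N by (intro power_mono) (auto simp: field_simps)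
    moreover have "(N - 1 / (7 * N))\<^sup>2 = N\<^sup>2 - 2 / 7 + (1 / (7 * N))\<^sup>2"
      using N by (simp add: power2_diff)
    ultimately show "(N - 1 / (7 * N))\<^sup>2 \<le> \<nu>" by (simp add: \<nu>_def power_divide)
  qed
  have "1 / (7 * N) < 1" using N by (simp add: field_simps)
  then have x1: "0 < x1" "x1 < x0" using N \<open>N - 1 / (7 * N) \<le> x0\<close> unfolding x1_def by linarith+
  have stage1: "v c * (\<kappa> * exp (\<kappa> * c)) \<le> v' c * exp (\<kappa> * c)" "v c > 0" if c: "0 < c" "c \<le> x1" "c \<le> \<xi>" for c
  proof -
    have "\<kappa>\<^sup>2 \<le> q y" if y: "y \<in> {0<..<c}" for y
    proof -
      \<comment> \<open>q decreases, so its lower bound is checked at N - 1. Adding the square of N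
        - 1 to both sides gives at most \<open>N\<^sup>2 - 1\<close>, below \<nu>.\<close>
      have "\<kappa>\<^sup>2 * x1\<^sup>2 \<le> 2 * N - 2"
      proof -
        have "\<kappa>\<^sup>2 * N * x1\<^sup>2 \<le> 2 * x1\<^sup>2"
          using \<kappa>(2) by (intro mult_right_mono) (auto simp: N_def)
        also have "\<dots> \<le> (2 * N - 2) * N"
          using N by (simp add: x1_def power2_eq_square algebra_simps)
        finally have "N * (\<kappa>\<^sup>2 * x1\<^sup>2) \<le> N * (2 * N - 2)" by (simp add: mult_ac)
        then show ?thesis using N by simp
      qed
      moreover have "x1\<^sup>2 = N\<^sup>2 - 2 * N + 1" by (simp add: x1_def power2_diff)
      moreover have "(\<kappa>\<^sup>2 + 1) * x1\<^sup>2 = \<kappa>\<^sup>2 * x1\<^sup>2 + x1\<^sup>2" by (simp add: algebra_simps)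
      ultimately have "(\<kappa>\<^sup>2 + 1) * x1\<^sup>2 \<le> \<nu>" unfolding \<nu>_def by linarith
      moreover have "y\<^sup>2 \<le> x1\<^sup>2" using y c by (intro power_mono) auto
      then have "(\<kappa>\<^sup>2 + 1) * y\<^sup>2 \<le> (\<kappa>\<^sup>2 + 1) * x1\<^sup>2" by (intro mult_left_mono) auto
      ultimately have "(\<kappa>\<^sup>2 + 1) * y\<^sup>2 \<le> \<nu>" by linarith
      then show ?thesis using y by (simp add: q_def field_simps)
    qed
    moreover have "v 0 = 0" "v' 0 = 0" using N by (auto simp: v_def v'_def)
    moreover have "((\<lambda>x. exp (\<kappa> * x)) has_real_derivative \<kappa> * exp (\<kappa> * y)) (at y)"
      "((\<lambda>x. \<kappa> * exp (\<kappa> * x)) has_real_derivative \<kappa>\<^sup>2 * exp (\<kappa> * y)) (at y)" for y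
      by (auto intro!: derivative_eq_intros simp: power2_eq_square)
    ultimately show "v c * (\<kappa> * exp (\<kappa> * c)) \<le> v' c * exp (\<kappa> * c)" "v c > 0"
      using c by (intro sturm_compare[of 0 c v v' "\<lambda>x. exp (\<kappa> * x)" "\<lambda>x. \<kappa> * exp (\<kappa> * x)" q "\<lambda>_. \<kappa>\<^sup>2"];
        auto intro!: cv continuous_intros dv dv' vpos)+
  qed
  have "x1 < \<xi>" using stage1(2)[of \<xi>] v\<xi> \<open>\<xi> > 0\<close> by force
  then have s1: "v x1 * \<kappa> \<le> v' x1" using stage1(1)[of x1] x1 by simp
  define l where "l = (\<lambda>x. 1 + \<kappa> * (x - x1))"
  have stage2: "v c * \<kappa> \<le> v' c * l c" "v c > 0" if c: "x1 < c" "c \<le> x0" "c \<le> \<xi>" for c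
  proof -
    have "0 \<le> q y" if y: "y \<in> {x1<..<c}" for y
    proof -
      have "y\<^sup>2 \<le> x0\<^sup>2" using y c x1 by (intro power_mono) auto
      then show ?thesis using x0 y x1 by (simp add: q_def field_simps)
    qed
    moreover have "(l has_real_derivative \<kappa>) (at y)" for y
      unfolding l_def by (auto intro!: derivative_eq_intros)
    moreover have "l y > 0" if "y \<ge> x1" for y using that \<kappa> by (simp add: l_def add_pos_nonneg)
    ultimately show "v c * \<kappa> \<le> v' c * l c" "v c > 0"
      using c x1 s1 by (intro sturm_compare[of x1 c v v' l "\<lambda>_. \<kappa>" q "\<lambda>_. 0"];
        auto intro!: cv continuous_intros dv dv' vpos simp: l_def)+
  qed
  have "x0 < \<xi>" using stage2(2)[of \<xi>] v\<xi> \<open>x1 < \<xi>\<close> by force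
  then have s2: "v x0 * \<kappa> \<le> v' x0 * l x0" "v x0 > 0" using stage2[of x0] x1 by auto
  \<comment> \<open>A lower bound for v'/v at the turning point: the linear comparison function has
    slope \<kappa> and grows from 1 to at most 1 + \<kappa>, since the turning point is at most 1
    beyond N - 1.\<close>
  define y0 where "y0 = \<kappa> / (1 + \<kappa>)"
  have "y0 > 0" using \<kappa> by (simp add: y0_def)
  have "l x0 \<le> 1 + \<kappa>" "l x0 > 0"
    using \<open>x0 \<le> N\<close> \<kappa> x1 by (auto simp: l_def x1_def add_pos_nonneg)
  have s3: "v x0 * y0 \<le> v' x0"
  proof -
    have "v x0 * \<kappa> / (1 + \<kappa>) \<le> v x0 * \<kappa> / l x0"
      using \<open>l x0 \<le> 1 + \<kappa>\<close> \<open>l x0 > 0\<close> s2 \<kappa> by (intro divide_left_mono) auto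
    also have "\<dots> \<le> v' x0" using s2 \<open>l x0 > 0\<close> by (simp add: field_simps)
    finally show ?thesis by (simp add: y0_def)
  qed
  \<comment> \<open>The oscillation of frequency K with logarithmic derivative \<open>y0\<close> at
    the turning point. It stays positive past the phase pi/2, by an excess that \<beta> measures;
    the last hypothesis on \<kappa> guarantees this excess.\<close>
  define h where "h = (\<lambda>x. y0 * sin (K * (x - x0)) + K * cos (K * (x - x0)))"
  define h' where "h' = (\<lambda>x. K * (y0 * cos (K * (x - x0)) - K * sin (K * (x - x0))))"
  have dh: "(h has_real_derivative h' y) (at y)" "(h' has_real_derivative - K\<^sup>2 * h y) (at y)" for y
    unfolding h_def h'_def by (auto intro!: derivative_eq_intros simp: power2_eq_square algebra_simps)
  have hpos: "h y > 0" if y: "x0 \<le> y" "y \<le> b" for y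
  proof -
    define \<theta> where "\<theta> = K * (y - x0)"
    have "\<theta> \<ge> 0" using y K by (simp add: \<theta>_def)
    have "\<theta> \<le> K * (b - N + 1 / (7 * N))"
      unfolding \<theta>_def using y K \<open>N - 1 / (7 * N) \<le> x0\<close> by (intro mult_left_mono) auto
    then have le: "\<theta> \<le> pi / 2 + \<beta>" using \<beta>(3) by (simp add: N_def)
    show ?thesis
    proof (cases "\<theta> < pi / 2")
      case True
      then have "cos \<theta> > 0" "sin \<theta> \<ge> 0"
        using \<open>\<theta> \<ge> 0\<close> by (auto intro!: cos_gt_zero_pi sin_ge_zero)
      then show ?thesis
        using \<open>y0 > 0\<close> K by (simp add: h_def \<theta>_def[symmetric] add_nonneg_pos)
    next
      case False
      define \<phi> where "\<phi> = \<theta> - pi / 2"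
      have \<phi>: "0 \<le> \<phi>" "\<phi> \<le> \<beta>" using False le by (auto simp: \<phi>_def)
      have tr: "sin \<theta> = cos \<phi>" "cos \<theta> = - sin \<phi>"
        by (simp_all add: \<phi>_def cos_diff sin_diff)
      have "sin \<phi> \<le> \<beta>" using sin_x_le_x[of \<phi>] \<phi> by linarith
      moreover have "\<phi>\<^sup>2 \<le> \<beta>\<^sup>2" using \<phi> by (intro power_mono) auto
      then have "1 - \<beta>\<^sup>2 / 2 \<le> cos \<phi>" using cos_ge_quadratic[of \<phi>] by linarith
      ultimately have "y0 * (1 - \<beta>\<^sup>2 / 2) \<le> y0 * cos \<phi>" "K * sin \<phi> \<le> K * \<beta>"
        using K \<open>y0 > 0\<close> by (auto intro!: mult_left_mono)
      moreover have "K * \<beta> < y0 * (1 - \<beta>\<^sup>2 / 2)"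
        using \<kappa>(1,3) by (simp add: y0_def field_simps)
      ultimately show ?thesis by (simp add: h_def \<theta>_def[symmetric] tr)
    qed
  qed
  \<comment> \<open>The hypothesis on K says exactly that this holds at y = b, where q is
    smallest.\<close>
  have qK: "- K\<^sup>2 \<le> q y" if "x0 < y" "y \<le> b" for y
  proof (cases "1 - K\<^sup>2 \<ge> 0")
    case True
    have "y\<^sup>2 \<le> b\<^sup>2" using that x0 by (intro power_mono) auto
    then have "y\<^sup>2 * (1 - K\<^sup>2) \<le> b\<^sup>2 * (1 - K\<^sup>2)" using True by (intro mult_right_mono) auto
    then have "y\<^sup>2 * (1 - K\<^sup>2) \<le> \<nu>" using K by (simp add: \<nu>_def N_def)
    then show ?thesis using that x0 by (simp add: q_def field_simps)
  next
    case False
    have "\<nu> / y\<^sup>2 \<ge> 0" using \<open>\<nu> > 0\<close> by simp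
    then show ?thesis using False by (simp add: q_def)
  qed
  have "v \<xi> > 0"
  proof (rule sturm_compare(2)[of x0 \<xi> v v' h h' q "\<lambda>_. - K\<^sup>2"])
    have "v x0 * y0 * K \<le> v' x0 * K" using s3 K by (intro mult_right_mono) auto
    then show "v x0 * h' x0 \<le> v' x0 * h x0" by (simp add: h_def h'_def mult_ac)
    show "continuous_on {x0..\<xi>} h" "continuous_on {x0..\<xi>} h'"
      using dh by (auto intro!: continuous_at_imp_continuous_on DERIV_isCont)
  qed (use \<open>x0 < \<xi>\<close> \<xi> x0 dh hpos qK in \<open>auto intro!: cv dv dv' vpos\<close>)
  then show False using v\<xi> by simp
qed

section \<open>Integrals of functions with bounded support\<close>

context
  fixes f :: "'a::euclidean_space \<Rightarrow> real" and K :: "'a set"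
  assumes cont: "continuous_on UNIV f" and K: "bounded K" and zero: "\<And>x. x \<notin> K \<Longrightarrow> f x = 0"
begin

lemma has_integral_bounded_support:
  assumes "K \<subseteq> cbox a b"
  shows "(f has_integral integral (cbox a b) f) UNIV"
proof (rule has_integral_on_superset)
  show "(f has_integral integral (cbox a b) f) (cbox a b)"
    by (intro integrable_integral integrable_continuous continuous_on_subset[OF cont]) auto
qed (use assms zero in auto)

lemma integrable_bounded_support: "f integrable_on UNIV"
proof -
  obtain a b where "K \<subseteq> cbox a b" using bounded_subset_cbox_symmetric[OF K] by blast
  then show ?thesis using has_integral_bounded_support by blast
qed

lemma integral_shift_bounded_support: "integral UNIV (\<lambda>x. f (x + c)) = integral UNIV f"
proof -
  obtain a b where ab: "K \<subseteq> cbox a b" using bounded_subset_cbox_symmetric[OF K] by blast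
  have "(f has_integral integral (cbox a b) f) (cbox ((a - c) + c) ((b - c) + c))"
    using ab by (simp add: integrable_integral integrable_continuous continuous_on_subset[OF cont])
  then have "((\<lambda>x. f (x + c)) has_integral integral (cbox a b) f) (cbox (a - c) (b - c))"
    by (subst (asm) has_integral_shift_cbox_iff[symmetric]) (simp add: o_def add.commute)
  then have "((\<lambda>x. f (x + c)) has_integral integral (cbox a b) f) UNIV"
  proof (rule has_integral_on_superset)
    fix x assume "x \<notin> cbox (a - c) (b - c)"
    then have "x + c \<notin> cbox a b" by (auto simp: mem_box inner_simps algebra_simps)
    then show "f (x + c) = 0" using ab zero by auto
  qed auto
  then show ?thesis using has_integral_bounded_support[OF ab] by (simp add: integral_unique)
qed

lemma integral_pos_bounded_support:
  assumes nonneg: "\<And>x. f x \<ge> 0" and pos: "f x0 > 0"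
  shows "integral UNIV f > 0"
proof -
  have "isCont f x0" using cont by (simp add: continuous_on_eq_continuous_at)
  then obtain d where d: "d > 0" "\<And>y. dist y x0 < d \<Longrightarrow> dist (f y) (f x0) < f x0 / 2"
    using pos unfolding continuous_at_eps_delta by (meson half_gt_zero)
  have ball: "f x0 / 2 \<le> f y" if "y \<in> ball x0 d" for y
    using d(2)[of y] that by (simp add: dist_commute dist_real_def abs_if split: if_splits)
  obtain a b where ab: "x0 \<in> box a b" "cbox a b \<subseteq> ball x0 d"
    using d(1) by (meson centre_in_ball open_ball open_contains_cbox)
  have cb: "0 < Henstock_Kurzweil_Integration.content (cbox a b)"
    using ab(1) by (simp add: content_pos_lt_eq mem_box) (meson order_less_trans)
  have "0 < f x0 / 2 * Henstock_Kurzweil_Integration.content (cbox a b)" using pos cb by simp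
  also have "\<dots> = integral (cbox a b) (\<lambda>_. f x0 / 2)" by (simp add: mult.commute)
  also have "\<dots> \<le> integral (cbox a b) f"
    using ab(2) ball by (intro integral_le integrable_continuous continuous_on_subset[OF cont]) auto
  also have "\<dots> \<le> integral UNIV f"
    using nonneg by (intro integral_subset_le integrable_bounded_support integrable_continuous continuous_on_subset[OF cont]) auto
  finally show ?thesis .
qed

end

text \<open>Translation invariance of the integral is differentiated; no Fubini argument is needed.\<close>

lemma integral_directional_derivative_eq_0:
  fixes f g :: "'a::euclidean_space \<Rightarrow> real"
  assumes f: "continuous_on UNIV f" and g: "continuous_on UNIV g" and K: "bounded K"
    and zero: "\<And>x. x \<notin> K \<Longrightarrow> f x = 0" "\<And>x. x \<notin> K \<Longrightarrow> g x = 0"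
    and deriv: "\<And>x. ((\<lambda>t. f (x + t *\<^sub>R e)) has_real_derivative g x) (at 0)"
  shows "integral UNIV g = 0"
proof -
  obtain r where r: "\<And>x. x \<in> K \<Longrightarrow> norm x \<le> r" using K by (auto simp: bounded_iff)
  have bd: "bounded (cball 0 (r + norm e) :: 'a set)" by simp
  obtain a b :: 'a where ab: "cball 0 (r + norm e) \<subseteq> cbox a b"
    using bounded_subset_cbox_symmetric[OF bd] by blast
  \<comment> \<open>The box is so large that outside it x and all its shifts by t e with 0 \<le> t
    \<le> 1 miss the support; all difference quotients vanish there.\<close>
  define S where "S = cbox a b"
  have KS: "x + t *\<^sub>R e \<notin> K" if "x \<notin> S" "0 \<le> t" "t \<le> 1" for x t
  proof
    assume "x + t *\<^sub>R e \<in> K"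
    have "norm x \<le> norm (x + t *\<^sub>R e) + norm (t *\<^sub>R e)" by (metis add_diff_cancel norm_triangle_ineq4)
    also have "\<dots> \<le> r + norm e"
      using r[OF \<open>x + t *\<^sub>R e \<in> K\<close>] that by (intro add_mono) (auto simp: mult_left_le_one_le)
    finally show False using ab that by (auto simp: S_def)
  qed
  obtain M where M: "\<And>x. norm (g x) \<le> M"
  proof -
    have "compact (g ` S)"
      unfolding S_def by (intro compact_continuous_image continuous_on_subset[OF g]) auto
    then obtain M where M: "\<And>x. x \<in> S \<Longrightarrow> norm (g x) \<le> M" "M > 0"
      using compact_imp_bounded bounded_pos by (metis imageI)
    have "norm (g x) \<le> M" for x
    proof (cases "x \<in> S")
      case False
      then show ?thesis using KS[OF False, of 0] zero(2) M by auto
    qed (use M in auto)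
    then show ?thesis using that by blast
  qed
  have dline: "((\<lambda>t. f (x + t *\<^sub>R e)) has_real_derivative g (x + t *\<^sub>R e)) (at t)" for x t
  proof -
    have "((\<lambda>s. f ((x + t *\<^sub>R e) + (s - t) *\<^sub>R e)) has_real_derivative g (x + t *\<^sub>R e) * 1) (at t)"
      by (rule DERIV_chain2[where g = "\<lambda>s. s - t" and f = "\<lambda>s. f ((x + t *\<^sub>R e) + s *\<^sub>R e)"])
         (use deriv[of "x + t *\<^sub>R e"] in \<open>auto intro!: derivative_eq_intros\<close>)
    then show ?thesis by (simp add: algebra_simps)
  qed
  have lip: "norm (f (x + t *\<^sub>R e) - f x) \<le> M * norm t" if "t \<ge> 0" for x t
  proof -
    have "norm (f (x + t *\<^sub>R e) - f (x + 0 *\<^sub>R e)) \<le> M * norm (t - 0)"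
      by (rule field_differentiable_bound[where S = "{0..t}" and f = "\<lambda>t. f (x + t *\<^sub>R e)" and f' = "\<lambda>t. g (x + t *\<^sub>R e)"])
         (use that dline M in \<open>auto intro: has_field_derivative_at_within\<close>)
    then show ?thesis by simp
  qed
  define h where "h = (\<lambda>j. 1 / real (Suc j))"
  have h: "h j > 0" "h j \<le> 1" for j by (auto simp: h_def)
  have hlim: "h \<longlonglongrightarrow> 0" unfolding h_def by (rule LIMSEQ_Suc[OF lim_1_over_n])
  define F where "F = (\<lambda>j x. (f (x + h j *\<^sub>R e) - f x) / h j)"
  have cF: "continuous_on UNIV (F j)" for j
    unfolding F_def using h(1)[of j]
    by (intro continuous_intros continuous_on_compose2[OF f] f) auto
  have F0: "integral S (F j) = 0" for j
  proof -
    have c1: "continuous_on UNIV (\<lambda>x. f (x + h j *\<^sub>R e))"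
      by (intro continuous_intros continuous_on_compose2[OF f]) auto
    have z: "f (x + h j *\<^sub>R e) = 0" "f x = 0" if "x \<notin> S" for x
      using KS[OF that, of "h j"] KS[OF that, of 0] h[of j] zero by auto
    have S: "bounded S" by (simp add: S_def)
    have "integral UNIV (F j) = (integral UNIV (\<lambda>x. f (x + h j *\<^sub>R e)) - integral UNIV f) / h j"
      unfolding F_def
      by (simp add: integral_diff integrable_bounded_support[OF c1 S z(1)] integrable_bounded_support[OF f S z(2)])
    then have "integral UNIV (F j) = 0"
      using integral_shift_bounded_support[OF f S z(2)] by simp
    moreover have "(F j has_integral integral S (F j)) UNIV"
      unfolding S_def by (rule has_integral_bounded_support[OF cF S]) (use z in \<open>auto simp: F_def S_def\<close>)
    ultimately show ?thesis by (simp add: integral_unique)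
  qed
  have "(\<lambda>j. integral S (F j)) \<longlonglongrightarrow> integral S g"
  proof (rule dominated_convergence(2)[where h = "\<lambda>_. M"])
    show "F j integrable_on S" for j
      unfolding S_def by (intro integrable_continuous continuous_on_subset[OF cF]) auto
    show "(\<lambda>_. M) integrable_on S" unfolding S_def by (rule integrable_const)
    fix x
    show "norm (F j x) \<le> M" for j
      using lip[of "h j" x] h(1)[of j] by (simp add: F_def field_simps)
    have "((\<lambda>t. (f (x + t *\<^sub>R e) - f x) / t) \<longlongrightarrow> g x) (at 0)"
      using deriv[of x] by (simp add: DERIV_def)
    moreover have "h j \<noteq> 0" for j using h(1)[of j] by simp
    then have "filterlim h (at 0) sequentially"
      using hlim by (simp add: filterlim_at)
    ultimately show "(\<lambda>j. F j x) \<longlonglongrightarrow> g x"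
      unfolding F_def by (rule filterlim_compose)
  qed
  then have "integral S g = 0" using F0 by (simp add: LIMSEQ_const_iff)
  moreover have "(g has_integral integral S g) UNIV"
    unfolding S_def
  proof (rule has_integral_bounded_support[OF g, of "cbox a b"])
    fix x assume "x \<notin> cbox a b"
    then show "g x = 0" using KS[of x 0] zero(2) by (auto simp: S_def)
  qed auto
  ultimately show ?thesis by (simp add: integral_unique)
qed

section \<open>Monotonicity of the first eigenvalue in p\<close>

lemma admissible_continuous:
  assumes "admissible \<Omega> u D"
  shows "continuous_on A u" "continuous_on A D"
proof -
  have "continuous (at x) u" for x
    using assms has_derivative_continuous unfolding admissible_def by blast
  then show "continuous_on A u" by (simp add: continuous_at_imp_continuous_on)
  have "continuous_on UNIV D" using assms by (simp add: admissible_def)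
  then show "continuous_on A D" by (rule continuous_on_subset) auto
qed

lemma admissible_D_zero:
  assumes "admissible \<Omega> u D" "x \<notin> closure {x. u x \<noteq> 0}"
  shows "D x = 0"
proof -
  have "((\<lambda>_. 0) has_derivative (\<lambda>_. 0)) (at x)" by simp
  then have "(u has_derivative (\<lambda>_. 0)) (at x)"
    by (rule has_derivative_transform_within_open[where s = "- closure {x. u x \<noteq> 0}"])
       (use assms(2) closure_subset[of "{x. u x \<noteq> 0}"] in auto)
  moreover have "(u has_derivative blinfun_apply (D x)) (at x)"
    using assms(1) by (simp add: admissible_def)
  ultimately have "blinfun_apply (D x) = (\<lambda>_. 0)"
    using has_derivative_unique by blast
  then show ?thesis by (intro blinfun_eqI) simp
qed

lemma admissible_bounded: "admissible \<Omega> u D \<Longrightarrow> bounded (closure {x. u x \<noteq> 0})"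
  by (simp add: admissible_def compact_imp_bounded)

lemma admissible_zero: "x \<notin> closure {x. u x \<noteq> 0} \<Longrightarrow> u x = 0"
  using closure_subset[of "{x. u x \<noteq> 0}"] by auto

lemma admissible_integrable:
  assumes "admissible \<Omega> u D" "p > 0"
  shows "(\<lambda>x. \<bar>u x\<bar> powr p) integrable_on UNIV" "(\<lambda>x. norm (D x) powr p) integrable_on UNIV"
    "integral UNIV (\<lambda>x. \<bar>u x\<bar> powr p) > 0" "integral UNIV (\<lambda>x. norm (D x) powr p) > 0"
proof -
  let ?K = "closure {x. u x \<noteq> 0}"
  have c: "continuous_on UNIV (\<lambda>x. \<bar>u x\<bar> powr p)" "continuous_on UNIV (\<lambda>x. norm (D x) powr p)"
    by (rule continuous_on_powr';
        use assms(2) in \<open>auto intro!: continuous_intros admissible_continuous[OF assms(1)]\<close>)+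
  have z: "\<bar>u x\<bar> powr p = 0" "norm (D x) powr p = 0" if "x \<notin> ?K" for x
    using admissible_zero[OF that] admissible_D_zero[OF assms(1) that] by auto
  note K = admissible_bounded[OF assms(1)]
  show "(\<lambda>x. \<bar>u x\<bar> powr p) integrable_on UNIV" "(\<lambda>x. norm (D x) powr p) integrable_on UNIV"
    by (rule integrable_bounded_support[OF c(1) K z(1)] integrable_bounded_support[OF c(2) K z(2)]; assumption)+
  obtain x0 where x0: "u x0 \<noteq> 0" using assms(1) by (auto simp: admissible_def)
  then show "integral UNIV (\<lambda>x. \<bar>u x\<bar> powr p) > 0"
  proof -
    assume x0: "u x0 \<noteq> 0"
    have pos: "\<bar>u x0\<bar> powr p > 0" using x0 by simp
    have nn: "\<bar>u x\<bar> powr p \<ge> 0" for x by simp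
    show ?thesis by (rule integral_pos_bounded_support[OF c(1) K z(1) nn pos])
  qed
  \<comment> \<open>A vanishing gradient would make u a nonzero constant, whose support is
    unbounded.\<close>
  have "\<exists>x. D x \<noteq> 0"
  proof (rule ccontr)
    assume "\<not> (\<exists>x. D x \<noteq> 0)"
    then have D0: "D x = 0" for x by simp
    have "(u has_derivative (\<lambda>_. 0)) (at x)" for x
    proof -
      have "(u has_derivative blinfun_apply (D x)) (at x)" using assms(1) by (simp add: admissible_def)
      then show ?thesis by (simp add: D0 zero_blinfun.rep_eq)
    qed
    then have "\<exists>c. \<forall>x\<in>UNIV. u x = c"
      by (intro has_derivative_zero_constant) auto
    then have "u x \<noteq> 0" for x using x0 by auto
    then have "?K = UNIV" by simp
    then show False using K by simp
  qed
  then obtain x1 where "D x1 \<noteq> 0" by blast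
  then show "integral UNIV (\<lambda>x. norm (D x) powr p) > 0"
  proof -
    assume x1: "D x1 \<noteq> 0"
    have pos: "norm (D x1) powr p > 0" using x1 by simp
    have nn: "norm (D x) powr p \<ge> 0" for x by simp
    show ?thesis by (rule integral_pos_bounded_support[OF c(2) K z(2) nn pos])
  qed
qed

definition rayleigh :: "real \<Rightarrow> (real^2 \<Rightarrow> real) \<Rightarrow> (real^2 \<Rightarrow> ((real^2) \<Rightarrow>\<^sub>L real)) \<Rightarrow> real" where
  "rayleigh p u D = integral UNIV (\<lambda>x. norm (D x) powr p) / integral UNIV (\<lambda>x. \<bar>u x\<bar> powr p)"

lemma lambda1_altdef: "lambda1 \<Omega> p = Inf {rayleigh p u D | u D. admissible \<Omega> u D}"
  by (simp add: lambda1_def rayleigh_def)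

lemma rayleigh_pos: "admissible \<Omega> u D \<Longrightarrow> p > 0 \<Longrightarrow> rayleigh p u D > 0"
  using admissible_integrable[of \<Omega> u D p] by (simp add: rayleigh_def)

lemma lambda1_le: "admissible \<Omega> u D \<Longrightarrow> p > 0 \<Longrightarrow> lambda1 \<Omega> p \<le> rayleigh p u D"
  unfolding lambda1_altdef using rayleigh_pos
  by (intro cInf_lower bdd_belowI[of _ 0]) (auto intro: less_imp_le)

text \<open>The given admissible function makes the set nonempty, without which its infimum would be
  unspecified.\<close>

lemma lambda1_ge:
  assumes "admissible \<Omega> u0 D0" "\<And>u D. admissible \<Omega> u D \<Longrightarrow> c \<le> rayleigh p u D"
  shows "c \<le> lambda1 \<Omega> p"
  unfolding lambda1_altdef using assms by (intro cInf_greatest) auto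

lemma lambda1_nonneg: "admissible \<Omega> u0 D0 \<Longrightarrow> p > 0 \<Longrightarrow> 0 \<le> lambda1 \<Omega> p"
  using rayleigh_pos by (intro lambda1_ge[of \<Omega> u0 D0]) (auto intro: less_imp_le)

lemma admissible_abs_powr:
  assumes "admissible \<Omega> u D" "s > 1"
  shows "admissible \<Omega> (\<lambda>x. \<bar>u x\<bar> powr s) (\<lambda>x. (s * spow (s - 1) (u x)) *\<^sub>R D x)"
proof -
  have "((\<lambda>x. \<bar>u x\<bar> powr s) has_derivative blinfun_apply ((s * spow (s - 1) (u x)) *\<^sub>R D x)) (at x)" for x
  proof -
    have "((\<lambda>v. \<bar>v\<bar> powr s) has_derivative (*) (s * spow (s - 1) (u x))) (at (u x))"
      using has_derivative_abs_powr[OF assms(2), of "u x"] by (simp add: has_field_derivative_def)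
    moreover have "(u has_derivative blinfun_apply (D x)) (at x)"
      using assms(1) by (simp add: admissible_def)
    ultimately have "((\<lambda>x. \<bar>u x\<bar> powr s) has_derivative (\<lambda>h. s * spow (s - 1) (u x) * blinfun_apply (D x) h)) (at x)"
      by (rule has_derivative_compose[rotated])
    moreover have "(\<lambda>h. s * spow (s - 1) (u x) * blinfun_apply (D x) h) = blinfun_apply ((s * spow (s - 1) (u x)) *\<^sub>R D x)"
      by (simp add: fun_eq_iff scaleR_blinfun.rep_eq)
    ultimately show ?thesis by simp
  qed
  moreover have "continuous_on UNIV (\<lambda>x. (s * spow (s - 1) (u x)) *\<^sub>R D x)"
    using assms(2) by (intro continuous_intros admissible_continuous[OF assms(1)]) auto
  moreover have "{x. \<bar>u x\<bar> powr s \<noteq> 0} = {x. u x \<noteq> 0}" by auto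
  ultimately show ?thesis using assms(1) unfolding admissible_def by auto
qed

text \<open>For the test function \<open>\<bar>u\<bar> powr s\<close> the denominator becomes the
  integral of \<open>\<bar>u\<bar> powr q\<close>, and Hoelder's inequality with weights 1 - p/q and
  p/q splits the numerator.\<close>

lemma rayleigh_abs_powr:
  assumes "admissible \<Omega> u D" "1 < p" "p < q"
  defines "s \<equiv> q / p"
  shows "rayleigh p (\<lambda>x. \<bar>u x\<bar> powr s) (\<lambda>x. (s * spow (s - 1) (u x)) *\<^sub>R D x) \<le> s powr p * rayleigh q u D powr (p / q)"
proof -
  define \<theta> where "\<theta> = p / q"
  have \<theta>: "0 < \<theta>" "\<theta> < 1" "q * \<theta> = p" using assms by (auto simp: \<theta>_def)
  have s: "s > 1" "s * p = q" "(s - 1) * p = q * (1 - \<theta>)" using assms by (auto simp: s_def \<theta>_def field_simps)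
  define A where "A = integral UNIV (\<lambda>x. \<bar>u x\<bar> powr q)"
  define B where "B = integral UNIV (\<lambda>x. norm (D x) powr q)"
  have "q > 0" using assms by simp
  note int = admissible_integrable[OF assms(1) this]
  have AB: "A > 0" "B > 0" using int by (auto simp: A_def B_def)
  let ?v = "\<lambda>x. \<bar>u x\<bar> powr s" and ?V = "\<lambda>x. (s * spow (s - 1) (u x)) *\<^sub>R D x"
  define C where "C = s powr p * (A powr (1 - \<theta>) * B powr \<theta>)"
  have iA: "((\<lambda>x. \<bar>u x\<bar> powr q) has_integral A) UNIV" and iB: "((\<lambda>x. norm (D x) powr q) has_integral B) UNIV"
    using int by (auto simp: A_def B_def)
  have "integral UNIV (\<lambda>x. norm (?V x) powr p) \<le> C * ((1 - \<theta>) * (A / A) + \<theta> * (B / B))"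
  proof (rule has_integral_le)
    show "((\<lambda>x. norm (?V x) powr p) has_integral integral UNIV (\<lambda>x. norm (?V x) powr p)) UNIV"
      by (rule integrable_integral, rule admissible_integrable[OF admissible_abs_powr[OF assms(1) s(1)]])
         (use assms in simp)
    show "((\<lambda>x. C * ((1 - \<theta>) * (\<bar>u x\<bar> powr q / A) + \<theta> * (norm (D x) powr q / B))) has_integral
        C * ((1 - \<theta>) * (A / A) + \<theta> * (B / B))) UNIV"
      by (intro has_integral_mult_right has_integral_add has_integral_divide iA iB)
    fix x
    have eq: "norm (?V x) powr p = s powr p * (\<bar>u x\<bar> powr (q * (1 - \<theta>)) * norm (D x) powr (q * \<theta>))"
      using s \<theta> by (simp add: abs_mult abs_spow powr_mult powr_powr)
    show "norm (?V x) powr p \<le> C * ((1 - \<theta>) * (\<bar>u x\<bar> powr q / A) + \<theta> * (norm (D x) powr q / B))"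
    proof (cases "u x = 0 \<or> D x = 0")
      case True
      then show ?thesis unfolding eq using \<theta> AB by (auto simp: C_def)
    next
      case False
      \<comment> \<open>Young's inequality for the normalized integrands; its integral over the
        plane is Hoelder's inequality.\<close>
      have y: "(\<bar>u x\<bar> powr q / A) powr (1 - \<theta>) * (norm (D x) powr q / B) powr \<theta>
          \<le> (1 - \<theta>) * (\<bar>u x\<bar> powr q / A) + \<theta> * (norm (D x) powr q / B)"
        by (rule Youngs_inequality_0) (use \<theta> AB False in auto)
      have "norm (?V x) powr p = C * ((\<bar>u x\<bar> powr q / A) powr (1 - \<theta>) * (norm (D x) powr q / B) powr \<theta>)"
        unfolding eq C_def using AB by (simp add: powr_divide powr_powr)
      also have "\<dots> \<le> C * ((1 - \<theta>) * (\<bar>u x\<bar> powr q / A) + \<theta> * (norm (D x) powr q / B))"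
        by (rule mult_left_mono[OF y]) (simp add: C_def)
      finally show ?thesis .
    qed
  qed
  also have "\<dots> = C" using AB by simp
  finally have le: "integral UNIV (\<lambda>x. norm (?V x) powr p) \<le> C" .
  have "integral UNIV (\<lambda>x. \<bar>?v x\<bar> powr p) = A"
    using s by (simp add: A_def powr_powr)
  then have "rayleigh p ?v ?V \<le> C / A"
    unfolding rayleigh_def using le AB by (simp add: divide_right_mono)
  also have "C / A = s powr p * (B / A) powr \<theta>"
    using AB by (simp add: C_def powr_divide powr_diff)
  also have "B / A = rayleigh q u D" by (simp add: rayleigh_def A_def B_def)
  finally show ?thesis by (simp add: \<theta>_def)
qed

text \<open>Lindqvist's monotonicity: test the \<open>p\<close>-quotient with \<open>\<bar>u\<bar>\<^sup>q\<^sup>/\<^sup>p\<close>.\<close>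

lemma lambda1_powr_mono:
  assumes "admissible \<Omega> u0 D0" "1 < p" "p \<le> q"
  shows "p * lambda1 \<Omega> p powr (1 / p) \<le> q * lambda1 \<Omega> q powr (1 / q)"
proof (cases "p = q")
  case False
  then have "p < q" using assms by simp
  define s where "s = q / p"
  have "s > 0" using assms by (simp add: s_def)
  define T where "T = lambda1 \<Omega> p powr (1 / p)"
  have T: "T \<ge> 0" "T powr p = lambda1 \<Omega> p"
    using lambda1_nonneg[OF assms(1), of p] assms by (auto simp: T_def powr_powr)
  have "(T / s) powr q \<le> lambda1 \<Omega> q"
  proof (rule lambda1_ge[OF assms(1)])
    fix u D assume ad: "admissible \<Omega> u D"
    define r where "r = rayleigh q u D"
    have "r > 0" unfolding r_def by (rule rayleigh_pos[OF ad]) (use assms in simp)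
    have "s > 1" using \<open>p < q\<close> assms by (simp add: s_def)
    have "T powr p \<le> s powr p * r powr (p / q)"
      unfolding T(2) r_def s_def
      by (rule order_trans[OF lambda1_le[OF admissible_abs_powr[OF ad]] rayleigh_abs_powr[OF ad]])
         (use assms \<open>p < q\<close> in auto)
    also have "\<dots> = (s * r powr (1 / q)) powr p"
      using \<open>s > 0\<close> by (simp add: powr_mult powr_powr)
    finally have "T \<le> s * r powr (1 / q)"
      using powr_less_mono2[of p "s * r powr (1 / q)" T] \<open>s > 0\<close> assms by (force simp: not_le)
    then have "T / s \<le> r powr (1 / q)" using \<open>s > 0\<close> by (simp add: field_simps)
    then have "(T / s) powr q \<le> (r powr (1 / q)) powr q"
      using T \<open>s > 0\<close> assms by (intro powr_mono2) auto
    also have "\<dots> = r" using \<open>r > 0\<close> assms by (simp add: powr_powr)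
    finally show "(T / s) powr q \<le> rayleigh q u D" by (simp add: r_def)
  qed
  then have "((T / s) powr q) powr (1 / q) \<le> lambda1 \<Omega> q powr (1 / q)"
    using assms by (intro powr_mono2) auto
  then have "T / s \<le> lambda1 \<Omega> q powr (1 / q)"
    using T \<open>s > 0\<close> assms by (simp add: powr_powr)
  then show ?thesis using assms by (simp add: s_def T_def field_simps)
qed simp

section \<open>Lower bound for the sector at p = 2\<close>

definition plane :: "real^2 \<Rightarrow> complex" where
  "plane x = Complex (x $ 1) (x $ 2)"

lemma plane_simps [simp]: "Re (plane x) = x $ 1" "Im (plane x) = x $ 2"
  by (simp_all add: plane_def)

lemma norm_vec2: "norm (x :: real^2) = sqrt ((x $ 1)\<^sup>2 + (x $ 2)\<^sup>2)"
  by (simp add: norm_vec_def L2_set_def sum_2)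

lemma norm_vec2_sq: "(norm (x :: real^2))\<^sup>2 = (x $ 1)\<^sup>2 + (x $ 2)\<^sup>2"
  by (simp add: norm_vec2)

lemma norm_plane: "norm (plane x) = norm x"
  by (simp add: cmod_def norm_vec2)

lemma continuous_on_plane [continuous_intros]: "continuous_on A plane"
  unfolding plane_def[abs_def] by (intro continuous_intros)

lemma plane_axis:
  "plane (x + t *\<^sub>R axis 1 1) = plane x + of_real t"
  "plane (x + t *\<^sub>R axis 2 1) = plane x + \<i> * of_real t"
  by (auto simp: complex_eq_iff axis_def)

lemma norm_sq_axis:
  "(norm (x + t *\<^sub>R axis 1 1 :: real^2))\<^sup>2 = (norm x)\<^sup>2 + 2 * x $ 1 * t + t\<^sup>2"
  "(norm (x + t *\<^sub>R axis 2 1 :: real^2))\<^sup>2 = (norm x)\<^sup>2 + 2 * x $ 2 * t + t\<^sup>2"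
  unfolding norm_vec2_sq by (auto simp: axis_def power2_eq_square algebra_simps)

text \<open>The functional is evaluated at its own gradient vector \<open>w\<close>.\<close>

lemma norm_blinfun_vec2_ge:
  fixes L :: "(real^2) \<Rightarrow>\<^sub>L real"
  shows "(L (axis 1 1))\<^sup>2 + (L (axis 2 1))\<^sup>2 \<le> (norm L)\<^sup>2"
proof -
  define a b where "a = L (axis 1 1)" and "b = L (axis 2 1)"
  define w :: "real^2" where "w = a *\<^sub>R axis 1 1 + b *\<^sub>R axis 2 1"
  have "L w = a\<^sup>2 + b\<^sup>2"
    by (simp add: w_def blinfun.add_right blinfun.scaleR_right a_def b_def power2_eq_square)
  moreover have nw: "norm w = sqrt (a\<^sup>2 + b\<^sup>2)"
    by (simp add: norm_vec2 w_def axis_def)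
  ultimately have "sqrt (a\<^sup>2 + b\<^sup>2) * sqrt (a\<^sup>2 + b\<^sup>2) \<le> norm L * sqrt (a\<^sup>2 + b\<^sup>2)"
    using norm_blinfun[of L w] by simp
  moreover have "sqrt (a\<^sup>2 + b\<^sup>2) \<ge> 0" by simp
  ultimately have "sqrt (a\<^sup>2 + b\<^sup>2) \<le> norm L"
    using mult_right_le_imp_le[of "sqrt (a\<^sup>2 + b\<^sup>2)" "sqrt (a\<^sup>2 + b\<^sup>2)" "norm L"]
    by (metis norm_ge_zero order_le_less)
  then have "(sqrt (a\<^sup>2 + b\<^sup>2))\<^sup>2 \<le> (norm L)\<^sup>2" by (intro power_mono) auto
  then show ?thesis by (simp add: a_def b_def)
qed

text \<open>If \<open>V = \<nabla>w / w\<close> for a positive \<open>w\<close> with \<open>-\<Delta>w = \<Lambda>w\<close>, then \<open>div V + \<bar>V\<bar>\<^sup>2 = -\<Lambda>\<close>; Jacobi's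
  completion of the square \<open>\<bar>\<nabla>u - uV\<bar>\<^sup>2 \<ge> 0\<close> together with \<open>\<integral> div (u\<^sup>2 V) = 0\<close> bounds the
  Rayleigh quotient from below by \<open>\<Lambda>\<close>.\<close>

lemma rayleigh_2_ge:
  fixes \<Omega> S :: "(real^2) set" and V W :: "2 \<Rightarrow> real^2 \<Rightarrow> real"
  assumes ad: "admissible \<Omega> u D" and S: "\<Omega> \<subseteq> S" "open S"
    and V: "\<And>i x. x \<in> S \<Longrightarrow> ((\<lambda>t. V i (x + t *\<^sub>R axis i 1)) has_real_derivative W i x) (at 0)"
    and cont: "\<And>i. continuous_on S (V i)" "\<And>i. continuous_on S (W i)"
    and div: "\<And>x. x \<in> S \<Longrightarrow> W 1 x + W 2 x + (V 1 x)\<^sup>2 + (V 2 x)\<^sup>2 \<le> - \<Lambda>"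
  shows "\<Lambda> \<le> rayleigh 2 u D"
proof -
  let ?K = "closure {x. u x \<noteq> 0}"
  have KS: "?K \<subseteq> S" using ad S by (auto simp: admissible_def)
  have u: "(u has_derivative blinfun_apply (D x)) (at x)" for x
    using ad by (simp add: admissible_def)
  define f g where "f = (\<lambda>i x. (u x)\<^sup>2 * V i x)"
    and "g = (\<lambda>i x. 2 * u x * D x (axis i 1) * V i x + (u x)\<^sup>2 * W i x)"
  have u0: "u x = 0" if "x \<notin> ?K" for x using admissible_zero[OF that] .
  \<comment> \<open>The fields live on S only; products with u extend by zero because the support of
    u is a closed subset of the open set S.\<close>
  have glue: "continuous_on UNIV F" if "continuous_on S F" "\<And>x. x \<notin> ?K \<Longrightarrow> F x = 0" for F :: "real^2 \<Rightarrow> real"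
  proof -
    have "continuous_on (- ?K) F"
      by (rule continuous_on_eq[OF continuous_on_const[of _ 0]]) (use that in auto)
    then have "continuous_on (S \<union> - ?K) F"
      using that S by (intro continuous_on_open_Un) auto
    moreover have "S \<union> - ?K = UNIV" using KS by auto
    ultimately show ?thesis by simp
  qed
  have cu: "continuous_on S u" by (rule admissible_continuous(1)[OF ad])
  have cD: "continuous_on S (\<lambda>x. D x e)" for e
    by (rule bounded_bilinear.continuous_on[OF bounded_bilinear_blinfun_apply admissible_continuous(2)[OF ad] continuous_on_const])
  have z: "f i x = 0" "g i x = 0" if "x \<notin> ?K" for i x
    using u0[OF that] by (auto simp: f_def g_def)
  have "continuous_on S (f i)" for i
    unfolding f_def by (rule continuous_on_mult[OF continuous_on_power[OF cu] cont(1)])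
  then have cf: "continuous_on UNIV (f i)" for i by (rule glue) (rule z(1))
  have "continuous_on S (g i)" for i
    unfolding g_def
    by (rule continuous_on_add[OF continuous_on_mult[OF continuous_on_mult[OF continuous_on_mult_left[OF cu] cD] cont(1)]
          continuous_on_mult[OF continuous_on_power[OF cu] cont(2)]])
  then have cg: "continuous_on UNIV (g i)" for i by (rule glue) (rule z(2))
  note bd = admissible_bounded[OF ad]
  have du: "((\<lambda>t. u (x + t *\<^sub>R e)) has_real_derivative D x e) (at 0)" for x e
  proof -
    have "((\<lambda>t. x + t *\<^sub>R e) has_derivative (\<lambda>t. t *\<^sub>R e)) (at 0)"
      by (auto intro!: derivative_eq_intros)
    from has_derivative_compose[OF this, of u "D x"] u[of x]
    have "((\<lambda>t. u (x + t *\<^sub>R e)) has_derivative (\<lambda>t. D x (t *\<^sub>R e))) (at 0)" by simp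
    moreover have "(\<lambda>t. D x (t *\<^sub>R e)) = (*) (D x e)"
      by (simp add: fun_eq_iff blinfun.scaleR_right)
    ultimately show ?thesis by (simp add: has_field_derivative_def)
  qed
  have df: "((\<lambda>t. f i (x + t *\<^sub>R axis i 1)) has_real_derivative g i x) (at 0)" for i x
  proof (cases "x \<in> S")
    case True
    show ?thesis
      unfolding f_def g_def
      by (rule DERIV_cong[OF DERIV_mult[OF DERIV_square[OF du] V[OF True]]]) (simp add: mult_ac)
  next
    case False
    then have "x \<in> - ?K" using KS by auto
    define T where "T = (\<lambda>t. x + t *\<^sub>R axis i 1) -` (- ?K)"
    have "open T"
      unfolding T_def by (intro open_vimage open_Compl closed_closure continuous_intros)
    have "((\<lambda>t. f i (x + t *\<^sub>R axis i 1)) has_real_derivative 0) (at 0)"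
    proof (rule has_field_derivative_transform_within_open[where f = "\<lambda>_. 0" and S = T])
      show "0 \<in> T" using \<open>x \<in> - ?K\<close> by (simp add: T_def)
      fix t assume "t \<in> T"
      then show "0 = f i (x + t *\<^sub>R axis i 1)"
        by (intro z(1)[symmetric]) (simp add: T_def)
    qed (use \<open>open T\<close> in auto)
    then show ?thesis using z(2)[of x i] \<open>x \<in> - ?K\<close> by simp
  qed
  have g0: "integral UNIV (g i) = 0" for i
    by (rule integral_directional_derivative_eq_0[OF cf cg bd z df])
  have gi: "(g i has_integral 0) UNIV" for i
    using integrable_integral[OF integrable_bounded_support[OF cg bd z(2)]] g0 by simp
  have p2: "(0::real) < 2" by simp
  note int = admissible_integrable[OF ad p2]
  define A B where "A = integral UNIV (\<lambda>x. \<bar>u x\<bar> powr 2)" and "B = integral UNIV (\<lambda>x. norm (D x) powr 2)"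
  have "0 + 0 \<le> B - \<Lambda> * A"
  proof (rule has_integral_le)
    show "((\<lambda>x. g 1 x + g 2 x) has_integral 0 + 0) UNIV" by (intro has_integral_add gi)
    show "((\<lambda>x. norm (D x) powr 2 - \<Lambda> * \<bar>u x\<bar> powr 2) has_integral B - \<Lambda> * A) UNIV"
      unfolding A_def B_def by (intro has_integral_diff has_integral_mult_right integrable_integral int)
    fix x
    have pw: "norm (D x) powr 2 = (norm (D x))\<^sup>2" "\<bar>u x\<bar> powr 2 = (u x)\<^sup>2" by simp_all
    show "g 1 x + g 2 x \<le> norm (D x) powr 2 - \<Lambda> * \<bar>u x\<bar> powr 2"
    proof (cases "x \<in> S")
      case True
      define a b where "a = D x (axis 1 1)" and "b = D x (axis 2 1)"
      have "(u x)\<^sup>2 * (W 1 x + W 2 x + (V 1 x)\<^sup>2 + (V 2 x)\<^sup>2) \<le> (u x)\<^sup>2 * (- \<Lambda>)"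
        by (intro mult_left_mono div True) auto
      moreover have "0 \<le> (a - u x * V 1 x)\<^sup>2 + (b - u x * V 2 x)\<^sup>2" by simp
      moreover have "g 1 x + g 2 x = a\<^sup>2 + b\<^sup>2 + (u x)\<^sup>2 * (W 1 x + W 2 x + (V 1 x)\<^sup>2 + (V 2 x)\<^sup>2)
          - ((a - u x * V 1 x)\<^sup>2 + (b - u x * V 2 x)\<^sup>2)"
        unfolding g_def a_def[symmetric] b_def[symmetric] by (simp add: power2_eq_square algebra_simps)
      moreover have "(u x)\<^sup>2 * (- \<Lambda>) = - (\<Lambda> * (u x)\<^sup>2)" by simp
      ultimately have "g 1 x + g 2 x \<le> a\<^sup>2 + b\<^sup>2 - \<Lambda> * (u x)\<^sup>2" by linarith
      moreover have "a\<^sup>2 + b\<^sup>2 \<le> (norm (D x))\<^sup>2"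
        unfolding a_def b_def by (rule norm_blinfun_vec2_ge)
      ultimately show ?thesis unfolding pw by linarith
    next
      case False
      then have "u x = 0" using KS by (intro u0) blast
      then show ?thesis by (simp add: g_def)
    qed
  qed
  then have "\<Lambda> * A \<le> B" by simp
  moreover have "A > 0" using int by (simp add: A_def)
  ultimately show ?thesis
    unfolding rayleigh_def A_def[symmetric] B_def[symmetric] by (simp add: field_simps)
qed

section \<open>Application to the sector\<close>

lemma sector_plane:
  assumes "x \<in> sector n" "n \<ge> 1"
  shows "0 < Im (plane x ^ n)" "norm x < 1" "x \<noteq> 0"
proof -
  obtain \<rho> \<theta> where \<rho>: "0 < \<rho>" "\<rho> < 1" "0 < \<theta>" "\<theta> < pi / real n" "x $ 1 = \<rho> * cos \<theta>" "x $ 2 = \<rho> * sin \<theta>"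
    using assms(1) by (auto simp: sector_def)
  have z: "plane x = of_real \<rho> * cis \<theta>" using \<rho> by (simp add: complex_eq_iff)
  have "plane x ^ n = of_real (\<rho> ^ n) * cis (real n * \<theta>)"
    unfolding z by (simp add: power_mult_distrib Complex.DeMoivre)
  then have "Im (plane x ^ n) = \<rho> ^ n * sin (real n * \<theta>)" by simp
  moreover have "0 < sin (real n * \<theta>)"
    using \<rho> assms(2) by (intro sin_gt_zero) (auto simp: field_simps)
  ultimately show "0 < Im (plane x ^ n)" using \<rho> by simp
  have "norm x = \<rho>" using \<rho>(1) by (simp flip: norm_plane add: z norm_mult)
  then show "norm x < 1" "x \<noteq> 0" using \<rho> by auto
qed

text \<open>The positive function is \<open>w = Im (z\<^sup>n) bessel n (b\<^sup>2\<bar>z\<bar>\<^sup>2)\<close>.\<close>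

lemma rayleigh_2_sector_ge:
  fixes b :: real and n :: nat
  assumes n: "n \<ge> 2" and b: "b > 0"
    and pos: "\<And>x. 0 \<le> x \<Longrightarrow> x \<le> b \<Longrightarrow> bessel n (x\<^sup>2) > 0"
    and ad: "admissible (sector n) u D"
  shows "b\<^sup>2 \<le> rayleigh 2 u D"
proof -
  \<comment> \<open>This open set consists of n rotated sectors, the given one among them. On all of
    it the harmonic factor \<open>h\<close> is positive, and openness follows from continuity
    without describing angles.\<close>
  define S where "S = {x :: real^2. 0 < Im (plane x ^ n)} \<inter> ball 0 1"
  define z where "z = plane"
  define h where "h = (\<lambda>x. Im (z x ^ n))"
  define dz where "dz = (\<lambda>i::2. if i = 1 then 1 else \<i>)"
  define h1 where "h1 = (\<lambda>i x. Im (dz i * (of_nat n * z x ^ (n - 1))))"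
  define h2 where "h2 = (\<lambda>i x. Im (dz i * (dz i * (of_nat n * (of_nat (n - 1) * z x ^ (n - 1 - 1))))))"
  define s where "s = (\<lambda>x :: real^2. b\<^sup>2 * (norm x)\<^sup>2)"
  define g where "g = (\<lambda>x. bessel n (s x))"
  define g1 where "g1 = (\<lambda>x. bessel' n (s x))"
  define g2 where "g2 = (\<lambda>x. bessel'' n (s x))"
  \<comment> \<open>The gradient of the logarithm of \<open>h * g\<close>, by components;
    \<open>W i\<close> is the derivative of \<open>V i\<close> in direction i.\<close>
  define V where "V = (\<lambda>(i::2) x. h1 i x / h x + 2 * b\<^sup>2 * x $ i * g1 x / g x)"
  define W where "W = (\<lambda>i x. (h2 i x * h x - h1 i x * h1 i x) / (h x * h x)
     + (((2 * b\<^sup>2) * g1 x + g2 x * (2 * b\<^sup>2 * x $ i) * (2 * b\<^sup>2 * x $ i)) * g x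
         - (2 * b\<^sup>2 * x $ i * g1 x) * (g1 x * (2 * b\<^sup>2 * x $ i))) / (g x * g x))"
  have cz: "continuous_on A z" for A unfolding z_def by (rule continuous_on_plane)
  have ch: "continuous_on A h" "continuous_on A (h1 i)" "continuous_on A (h2 i)" for A i
    unfolding h_def h1_def h2_def by (intro continuous_intros cz)+
  have cs: "continuous_on A s" for A unfolding s_def by (intro continuous_intros)
  have isC: "continuous_on A (bessel n)" "continuous_on A (bessel' n)" for A
    using bessel_deriv bessel'_deriv by (auto intro!: continuous_at_imp_continuous_on DERIV_isCont)
  have "continuous_on A (bessel'' n)" for A
  proof -
    have "(bessel'' n has_real_derivative (\<Sum>j. diffs (diffs (diffs (bcoeff n))) j * t ^ j)) (at t)" for t
      unfolding bessel''_def[abs_def]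
      by (rule termdiffs_strong_converges_everywhere[OF termdiff_converges_all[OF summable_bcoeff']])
    then show ?thesis by (auto intro!: continuous_at_imp_continuous_on DERIV_isCont)
  qed
  then have cg: "continuous_on A g" "continuous_on A g1" "continuous_on A g2" for A
    unfolding g_def g1_def g2_def
    by (auto intro!: continuous_on_compose2[OF isC(1) cs] continuous_on_compose2[OF isC(2) cs] continuous_on_compose2[OF _ cs])
  have hpos: "h x > 0" if "x \<in> S" for x using that by (simp add: S_def h_def z_def)
  have gpos: "g x > 0" if "x \<in> S" for x
  proof -
    have "b * norm x \<le> b" using that b by (simp add: S_def)
    then show ?thesis using pos[of "b * norm x"] b by (simp add: g_def s_def power_mult_distrib)
  qed
  have dzline: "((\<lambda>t. z (x + t *\<^sub>R axis i 1)) has_vector_derivative dz i) (at 0)" for i x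
  proof -
    have "z (x + t *\<^sub>R axis i 1) = z x + t *\<^sub>R dz i" for t
      using plane_axis[of x t] exhaust_2[of i] by (auto simp: z_def dz_def scaleR_conv_of_real mult.commute)
    then show ?thesis by (auto intro!: derivative_eq_intros)
  qed
  have dpow: "((\<lambda>t. Im (c * z (x + t *\<^sub>R axis i 1) ^ m)) has_real_derivative Im (c * (dz i * (of_nat m * z x ^ (m - 1))))) (at 0)" for c i x m
  proof -
    have "((\<lambda>w. c * w ^ m) has_field_derivative c * (of_nat m * z x ^ (m - 1))) (at (z (x + 0 *\<^sub>R axis i 1)))"
      by (auto intro!: derivative_eq_intros)
    from field_vector_diff_chain_at[OF dzline this]
    have "((\<lambda>t. c * z (x + t *\<^sub>R axis i 1) ^ m) has_vector_derivative (dz i * (c * (of_nat m * z x ^ (m - 1))))) (at 0)"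
      by (simp add: o_def)
    from has_field_derivative_Im[OF this] show ?thesis by (simp add: mult_ac)
  qed
  have dh: "((\<lambda>t. h (x + t *\<^sub>R axis i 1)) has_real_derivative h1 i x) (at 0)" for i x
    using dpow[of 1 x i n] by (simp add: h_def h1_def)
  have dh1: "((\<lambda>t. h1 i (x + t *\<^sub>R axis i 1)) has_real_derivative h2 i x) (at 0)" for i x
    using dpow[of "dz i * of_nat n" x i "n - 1"] by (simp add: h1_def h2_def mult_ac)
  have ds: "((\<lambda>t. s (x + t *\<^sub>R axis i 1)) has_real_derivative 2 * b\<^sup>2 * x $ i) (at 0)" for i x
  proof -
    have "s (x + t *\<^sub>R axis i 1) = b\<^sup>2 * ((norm x)\<^sup>2 + 2 * x $ i * t + t\<^sup>2)" for t
      using norm_sq_axis[of x t] exhaust_2[of i] by (auto simp: s_def)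
    then show ?thesis by (auto intro!: derivative_eq_intros)
  qed
  have dx: "((\<lambda>t. 2 * b\<^sup>2 * (x + t *\<^sub>R axis i 1) $ i) has_real_derivative 2 * b\<^sup>2) (at 0)" for i x
    by (auto intro!: derivative_eq_intros simp: axis_def)
  have dg: "((\<lambda>t. g (x + t *\<^sub>R axis i 1)) has_real_derivative g1 x * (2 * b\<^sup>2 * x $ i)) (at 0)" for i x
    using DERIV_chain2[OF _ ds[of x i], of "bessel n" "g1 x"] bessel_deriv[of n "s x"] by (simp add: g_def g1_def)
  have dg1: "((\<lambda>t. g1 (x + t *\<^sub>R axis i 1)) has_real_derivative g2 x * (2 * b\<^sup>2 * x $ i)) (at 0)" for i x
    using DERIV_chain2[OF _ ds[of x i], of "bessel' n" "g2 x"] bessel'_deriv[of n "s x"] by (simp add: g1_def g2_def)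
  show ?thesis
  proof (rule rayleigh_2_ge[OF ad, where S = S and V = V and W = W])
    show "sector n \<subseteq> S" using sector_plane n by (auto simp: S_def)
    show "open S"
      unfolding S_def by (intro open_Int open_Collect_less continuous_intros) auto
    show "continuous_on S (V i)" "continuous_on S (W i)" for i
      unfolding V_def W_def using hpos gpos
      by (intro continuous_intros ch cg; force)+
    fix x assume x: "x \<in> S"
    then have hg: "h x \<noteq> 0" "g x \<noteq> 0" using hpos gpos by force+
    show "((\<lambda>t. V i (x + t *\<^sub>R axis i 1)) has_real_derivative W i x) (at 0)" for i
    proof -
      have "h (x + 0 *\<^sub>R axis i 1) \<noteq> 0" "g (x + 0 *\<^sub>R axis i 1) \<noteq> 0" using hg by auto
      from DERIV_add[OF DERIV_divide[OF dh1 dh this(1)] DERIV_divide[OF DERIV_mult[OF dx dg1] dg this(2)]]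
      show ?thesis by (simp add: V_def W_def)
    qed
    have sum_x: "(x $ 1)\<^sup>2 + (x $ 2)\<^sup>2 = (norm x)\<^sup>2" by (simp add: norm_vec2)
    have harm: "h2 1 x + h2 2 x = 0" by (simp add: h2_def dz_def)
    have euler: "x $ 1 * h1 1 x + x $ 2 * h1 2 x = real n * h x"
    proof -
      have "x $ 1 * h1 1 x + x $ 2 * h1 2 x = Im (z x * (of_nat n * z x ^ (n - 1)))"
        by (simp add: h1_def dz_def z_def)
      also have "z x * (of_nat n * z x ^ (n - 1)) = of_nat n * z x ^ n"
        using n by (cases n) auto
      finally show ?thesis by (simp add: h_def)
    qed
    have ode: "s x * g2 x = - ((real n + 1) * g1 x) - g x / 4"
      using bessel_ode[of "s x" n] unfolding g_def g1_def g2_def by linarith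
    define H where "H = h x"
    define G where "G = g x"
    have HG: "H \<noteq> 0" "G \<noteq> 0" using hg by (auto simp: H_def G_def)
    define q where "q = 2 * b\<^sup>2 * (g1 x / G)"
    define c1 c2 where "c1 = h1 1 x / H" and "c2 = h1 2 x / H"
    have Veq: "V 1 x = c1 + q * x $ 1" "V 2 x = c2 + q * x $ 2"
      by (simp_all add: V_def c1_def c2_def q_def H_def G_def)
    have Weq: "W i x = h2 i x / H - (h1 i x / H)\<^sup>2 + q + 4 * b ^ 4 * (x $ i)\<^sup>2 * g2 x / G - q\<^sup>2 * (x $ i)\<^sup>2" for i
      unfolding W_def H_def[symmetric] G_def[symmetric] q_def
      using HG by (simp add: field_simps power2_eq_square power4_eq_xxxx)
    have e2: "c1 * x $ 1 + c2 * x $ 2 = real n"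
      using euler HG by (simp add: c1_def c2_def H_def field_simps)
    have h2': "h2 1 x / H + h2 2 x / H = 0" using harm by (simp add: add_divide_distrib[symmetric])
    \<comment> \<open>The squares cancel against the derivatives of the denominators. The rest is
      evaluated by harmonicity of \<open>h\<close>, Euler's identity for its homogeneity of degree
      n, and Bessel's equation.\<close>
    have "W 1 x + W 2 x + (V 1 x)\<^sup>2 + (V 2 x)\<^sup>2
       = (h2 1 x / H + h2 2 x / H) + 2 * q + 4 * b ^ 4 * ((x $ 1)\<^sup>2 + (x $ 2)\<^sup>2) * g2 x / G
         + 2 * q * (c1 * x $ 1 + c2 * x $ 2)"
      unfolding Veq Weq c1_def c2_def by (simp add: power2_eq_square algebra_simps add_divide_distrib)
    also have "\<dots> = 2 * q * (real n + 1) + 4 * b\<^sup>2 * (s x * g2 x) / G"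
      unfolding e2 h2' sum_x by (simp add: s_def algebra_simps power4_eq_xxxx power2_eq_square)
    also have "\<dots> = - b\<^sup>2"
      unfolding ode G_def[symmetric] q_def using HG by (simp add: field_simps)
    finally show "W 1 x + W 2 x + (V 1 x)\<^sup>2 + (V 2 x)\<^sup>2 \<le> - b\<^sup>2" by simp
  qed
qed

section \<open>Upper bound by the inradius\<close>

text \<open>The power of the positive part is the mean of the even and the odd power, both of which
  are differentiable at 0 for a > 1.\<close>

lemma has_derivative_max_powr:
  assumes "a > 1"
  shows "((\<lambda>v. (max 0 v) powr a) has_real_derivative a * (max 0 v) powr (a - 1)) (at v)"
proof -
  have "((\<lambda>v. (\<bar>v\<bar> powr a + spow a v) / 2) has_real_derivative (a * spow (a - 1) v + a * \<bar>v\<bar> powr (a - 1)) / 2) (at v)"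
    using assms by (intro DERIV_cdivide DERIV_add has_derivative_abs_powr has_derivative_spow_gt_1)
  moreover have "(\<lambda>v. (\<bar>v\<bar> powr a + spow a v) / 2) = (\<lambda>v. (max 0 v) powr a)"
    by (auto simp: fun_eq_iff spow_def max_def sgn_if)
  moreover have "(a * spow (a - 1) v + a * \<bar>v\<bar> powr (a - 1)) / 2 = a * (max 0 v) powr (a - 1)"
    by (auto simp: spow_def max_def sgn_if)
  ultimately show ?thesis by metis
qed

context
  fixes c :: "real^2" and A \<epsilon> a :: real
  assumes A: "0 < \<epsilon>" "2 * \<epsilon> < A" and a: "a > 1"
begin

text \<open>The distance to c, smoothed at c.\<close>

definition bump_q :: "real^2 \<Rightarrow> real" where
  "bump_q x = sqrt (\<epsilon>\<^sup>2 + (x - c) \<bullet> (x - c))"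

text \<open>A C^1 version of the cone A - |x - c|, the distance to the boundary of the ball, whose
  maximal slope divided by its height is 1/A. The power a > 1 removes the kink at the edge of the
  support.\<close>

definition bump :: "real^2 \<Rightarrow> real" where
  "bump x = (max 0 (A - bump_q x)) powr a"

definition bump' :: "real^2 \<Rightarrow> (real^2) \<Rightarrow>\<^sub>L real" where
  "bump' x = (- (a * (max 0 (A - bump_q x)) powr (a - 1) / bump_q x)) *\<^sub>R blinfun_inner_left (x - c)"

lemma bump_q_pos: "bump_q x > 0"
  unfolding bump_q_def using A by (auto intro!: add_pos_nonneg)

lemma norm_le_bump_q: "norm (x - c) < bump_q x"
  unfolding bump_q_def norm_eq_sqrt_inner using A by simp

lemma bump_q_le: "norm (x - c) \<le> \<epsilon> \<Longrightarrow> bump_q x \<le> 2 * \<epsilon>"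
proof -
  assume "norm (x - c) \<le> \<epsilon>"
  then have "(norm (x - c))\<^sup>2 \<le> \<epsilon>\<^sup>2" by (intro power_mono) auto
  moreover have "(2 * \<epsilon>)\<^sup>2 = 4 * \<epsilon>\<^sup>2" by (simp add: power_mult_distrib)
  ultimately have "\<epsilon>\<^sup>2 + (x - c) \<bullet> (x - c) \<le> (2 * \<epsilon>)\<^sup>2"
    unfolding power2_norm_eq_inner using zero_le_power2[of \<epsilon>] by linarith
  then show ?thesis
    unfolding bump_q_def using A by (intro real_le_lsqrt) auto
qed

lemma continuous_on_bump_q: "continuous_on S bump_q"
  unfolding bump_q_def[abs_def] by (intro continuous_intros)

lemma bump_deriv: "(bump has_derivative blinfun_apply (bump' x)) (at x)"
proof -
  have pos: "0 < \<epsilon>\<^sup>2 + (x - c) \<bullet> (x - c)" using A by (auto intro!: add_pos_nonneg)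
  have "((\<lambda>x. \<epsilon>\<^sup>2 + (x - c) \<bullet> (x - c)) has_derivative (\<lambda>h. 2 * ((x - c) \<bullet> h))) (at x)"
    by (auto intro!: derivative_eq_intros simp: inner_commute)
  from has_derivative_compose[OF this DERIV_real_sqrt[OF pos, unfolded has_field_derivative_def]]
  have dq: "(bump_q has_derivative (\<lambda>h. inverse (bump_q x) / 2 * (2 * ((x - c) \<bullet> h)))) (at x)"
    by (simp add: bump_q_def[abs_def])
  have "((\<lambda>x. A - bump_q x) has_derivative (\<lambda>h. - (inverse (bump_q x) / 2 * (2 * ((x - c) \<bullet> h))))) (at x)"
    using has_derivative_diff[OF has_derivative_const dq, of A] by simp
  from has_derivative_compose[OF this has_derivative_max_powr[OF a, unfolded has_field_derivative_def]]
  have "(bump has_derivative (\<lambda>h. a * (max 0 (A - bump_q x)) powr (a - 1) * - (inverse (bump_q x) / 2 * (2 * ((x - c) \<bullet> h))))) (at x)"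
    by (simp add: bump_def[abs_def])
  moreover have "(\<lambda>h. a * (max 0 (A - bump_q x)) powr (a - 1) * - (inverse (bump_q x) / 2 * (2 * ((x - c) \<bullet> h)))) = blinfun_apply (bump' x)"
    by (simp add: fun_eq_iff bump'_def blinfun.scaleR_left blinfun.minus_left blinfun_inner_left.rep_eq inner_commute field_simps)
  ultimately show ?thesis by simp
qed

lemma bump_admissible:
  assumes "ball c A \<subseteq> \<Omega>"
  shows "admissible \<Omega> bump bump'"
proof -
  have "continuous_on UNIV bump'"
  proof -
    have "bump_q x \<noteq> 0" for x using bump_q_pos[of x] by simp
    moreover have "continuous_on UNIV (\<lambda>x. (max 0 (A - bump_q x)) powr (a - 1))"
      using a by (intro continuous_on_powr' continuous_intros continuous_on_bump_q) auto
    moreover have "continuous_on UNIV (\<lambda>x. blinfun_inner_left (x - c))"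
      by (rule bounded_linear.continuous_on[OF bounded_linear_blinfun_inner_left]) (intro continuous_intros)
    ultimately show ?thesis
      unfolding bump'_def[abs_def]
      by (intro continuous_on_scaleR continuous_on_minus continuous_on_divide continuous_on_mult_left continuous_on_bump_q) auto
  qed
  moreover have sub: "closure {x. bump x \<noteq> 0} \<subseteq> {x. bump_q x \<le> A}"
  proof (rule closure_minimal)
    show "{x. bump x \<noteq> 0} \<subseteq> {x. bump_q x \<le> A}" by (auto simp: bump_def max_def split: if_splits)
    show "closed {x. bump_q x \<le> A}"
      using continuous_on_bump_q[of UNIV] by (intro closed_Collect_le continuous_on_const)
  qed
  have ball: "{x. bump_q x \<le> A} \<subseteq> ball c A"
  proof
    fix x assume "x \<in> {x. bump_q x \<le> A}"
    then have "norm (x - c) < A" using norm_le_bump_q[of x] by simp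
    then show "x \<in> ball c A" by (simp add: dist_norm norm_minus_commute)
  qed
  then have "bounded {x. bump_q x \<le> A}" using bounded_ball bounded_subset by blast
  then have "compact (closure {x. bump x \<noteq> 0})"
    using sub bounded_subset compact_eq_bounded_closed closed_closure by blast
  moreover have "bump c \<noteq> 0"
    using bump_q_le[of c] A by (simp add: bump_def)
  ultimately show ?thesis
    unfolding admissible_def using bump_deriv ball sub assms by blast
qed

lemma norm_bump'_le: "norm (bump' x) \<le> a * A powr (a - 1)"
proof -
  have "norm (bump' x) \<le> a * (max 0 (A - bump_q x)) powr (a - 1) / bump_q x * norm (x - c)"
  proof -
    have "norm (blinfun_inner_left (x - c)) \<le> norm (x - c)"
      by (rule norm_blinfun_bound)
         (use Cauchy_Schwarz_ineq2 in \<open>auto simp: blinfun_inner_left.rep_eq mult.commute\<close>)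
    moreover have "\<bar>- (a * (max 0 (A - bump_q x)) powr (a - 1) / bump_q x)\<bar> =
        a * (max 0 (A - bump_q x)) powr (a - 1) / bump_q x"
      using bump_q_pos[of x] a by simp
    ultimately show ?thesis
      unfolding bump'_def norm_scaleR using bump_q_pos[of x] a by (simp only:) (intro mult_left_mono, auto)
  qed
  also have "\<dots> = a * (max 0 (A - bump_q x)) powr (a - 1) * (norm (x - c) / bump_q x)" by simp
  also have "\<dots> \<le> a * A powr (a - 1) * 1"
    using norm_le_bump_q[of x] bump_q_pos[of x] a A
    by (intro mult_mono powr_mono2) auto
  finally show ?thesis by simp
qed

text \<open>The gradient is bounded by its maximum, the function from below by its values near c.
  The areas involved go into C, which is independent of p and disappears under the p-th
  root.\<close>

lemma rayleigh_bump_le: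
  obtains C where "C > 0" "\<And>p. p > 1 \<Longrightarrow> rayleigh p bump bump' \<le> C * (a * A powr (a - 1) / (A - 2 * \<epsilon>) powr a) powr p"
proof -
  have ad: "admissible UNIV bump bump'" by (rule bump_admissible) simp
  note bd = admissible_bounded[OF ad]
  obtain l r where K: "closure {x. bump x \<noteq> 0} \<subseteq> cbox l r"
    using bounded_subset_cbox_symmetric[OF bd] by blast
  obtain l' r' where s: "c \<in> box l' r'" "cbox l' r' \<subseteq> ball c \<epsilon>"
    using A(1) by (meson centre_in_ball open_ball open_contains_cbox)
  define v1 v2 where "v1 = Henstock_Kurzweil_Integration.content (cbox l r)"
    and "v2 = Henstock_Kurzweil_Integration.content (cbox l' r')"
  have "v2 > 0" unfolding v2_def using s(1) by (simp add: content_pos_lt_eq mem_box) (meson order_less_trans)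
  define M where "M = a * A powr (a - 1)"
  define N where "N = (A - 2 * \<epsilon>) powr a"
  have MN: "M > 0" "N > 0" using a A by (auto simp: M_def N_def)
  show ?thesis
  \<comment> \<open>The summand 1 makes C positive from v1 \<ge> 0 alone.\<close>
  proof (rule that[of "(v1 + 1) / v2"])
    have "v1 \<ge> 0" unfolding v1_def by (rule measure_nonneg)
    then show "(v1 + 1) / v2 > 0" using \<open>v2 > 0\<close> by simp
    fix p :: real assume "p > 1"
    then have p0: "p > 0" by simp
    note int = admissible_integrable[OF ad p0]
    have "integral UNIV (\<lambda>x. norm (bump' x) powr p) = integral (cbox l r) (\<lambda>x. norm (bump' x) powr p)"
    proof (rule integral_unique[OF has_integral_bounded_support[OF _ bd _ K]])
      show "continuous_on UNIV (\<lambda>x. norm (bump' x) powr p)"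
        using \<open>p > 1\<close> by (intro continuous_on_powr' continuous_intros admissible_continuous[OF ad]) auto
      show "norm (bump' x) powr p = 0" if "x \<notin> closure {x. bump x \<noteq> 0}" for x
        using admissible_D_zero[OF ad that] by simp
    qed
    also have "\<dots> \<le> integral (cbox l r) (\<lambda>_. M powr p)"
      using norm_bump'_le \<open>p > 1\<close> unfolding M_def
      by (intro integral_le integrable_on_subcbox[OF int(2)]) (auto intro!: powr_mono2)
    also have "\<dots> = v1 * M powr p" by (simp add: v1_def)
    also have "\<dots> \<le> (v1 + 1) * M powr p" by (intro mult_right_mono) auto
    finally have num: "integral UNIV (\<lambda>x. norm (bump' x) powr p) \<le> (v1 + 1) * M powr p" .
    have "v2 * N powr p = integral (cbox l' r') (\<lambda>_. N powr p)" by (simp add: v2_def)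
    also have "\<dots> \<le> integral (cbox l' r') (\<lambda>x. \<bar>bump x\<bar> powr p)"
    proof (rule integral_le)
      fix x assume "x \<in> cbox l' r'"
      then have "norm (x - c) \<le> \<epsilon>" using s by (auto simp: dist_norm norm_minus_commute dest!: subsetD)
      then have "A - 2 * \<epsilon> \<le> A - bump_q x" using bump_q_le by auto
      then have "N \<le> bump x" unfolding N_def bump_def using A a by (intro powr_mono2) auto
      then show "N powr p \<le> \<bar>bump x\<bar> powr p" using MN \<open>p > 1\<close> by (intro powr_mono2) auto
    qed (auto intro: integrable_on_subcbox[OF int(1)])
    also have "\<dots> \<le> integral UNIV (\<lambda>x. \<bar>bump x\<bar> powr p)"
      by (intro integral_subset_le integrable_on_subcbox[OF int(1)] int) auto
    finally have den: "v2 * N powr p \<le> integral UNIV (\<lambda>x. \<bar>bump x\<bar> powr p)" .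
    have "rayleigh p bump bump' \<le> ((v1 + 1) * M powr p) / (v2 * N powr p)"
      unfolding rayleigh_def using num den int \<open>v2 > 0\<close> MN
      by (intro frac_le) (auto simp: v1_def)
    also have "\<dots> = (v1 + 1) / v2 * (M / N) powr p" using MN by (simp add: powr_divide)
    finally show "rayleigh p bump bump' \<le> (v1 + 1) / v2 * (a * A powr (a - 1) / (A - 2 * \<epsilon>) powr a) powr p"
      by (simp add: M_def N_def)
  qed
qed

end

text \<open>\<open>\<psi> t\<close> is the base of the estimate for the bump with smoothing \<rho> t
  and exponent 1 + t. It tends to 1/\<rho> as t tends to 0; t is fixed before p tends to
  infinity.\<close>

lemma lambda1_powr_le_inradius:
  assumes "ball c \<rho> \<subseteq> \<Omega>" "\<rho> > 0" "1 / \<rho> < L"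
  shows "\<forall>\<^sub>F p in at_top. lambda1 \<Omega> p powr (1 / p) < L"
proof -
  define \<psi> where "\<psi> = (\<lambda>t. (1 + t) * \<rho> powr ((1 + t) - 1) / (\<rho> - 2 * (\<rho> * t)) powr (1 + t))"
  have "(\<psi> \<longlongrightarrow> (1 + 0) * \<rho> powr ((1 + 0) - 1) / (\<rho> - 2 * (\<rho> * 0)) powr (1 + 0)) (at_right 0)"
    unfolding \<psi>_def using assms by (intro tendsto_intros) auto
  then have "(\<psi> \<longlongrightarrow> 1 / \<rho>) (at_right 0)" using assms by simp
  then have "\<forall>\<^sub>F t in at_right 0. \<psi> t < L" using assms(3) by (rule order_tendstoD)
  moreover have "\<forall>\<^sub>F t in at_right (0::real). t \<in> {0<..<1/2}" by (rule eventually_at_right_real) simp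
  ultimately have "\<forall>\<^sub>F t in at_right (0::real). \<psi> t < L \<and> t \<in> {0<..<1/2}" by (rule eventually_conj)
  then obtain t where t: "\<psi> t < L" "0 < t" "t < 1 / 2"
    using eventually_happens'[OF trivial_limit_at_right_real] by force
  have par: "0 < \<rho> * t" "2 * (\<rho> * t) < \<rho>" "1 < 1 + t" using t assms by auto
  obtain C where C: "C > 0" "\<And>p. p > 1 \<Longrightarrow>
     rayleigh p (bump c \<rho> (\<rho> * t) (1 + t)) (bump' c \<rho> (\<rho> * t) (1 + t)) \<le> C * \<psi> t powr p"
    using rayleigh_bump_le[OF par, of c] unfolding \<psi>_def by blast
  note ad = bump_admissible[OF par assms(1)]
  have "\<psi> t > 0" using t assms by (simp add: \<psi>_def)
  have "((\<lambda>p. C powr (1 / p) * \<psi> t) \<longlongrightarrow> C powr 0 * \<psi> t) at_top"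
    using C(1) by (intro tendsto_intros tendsto_divide_0[OF tendsto_const] filterlim_at_top_imp_at_infinity filterlim_ident) auto
  then have "((\<lambda>p. C powr (1 / p) * \<psi> t) \<longlongrightarrow> \<psi> t) at_top" using C(1) by simp
  then have "\<forall>\<^sub>F p in at_top. C powr (1 / p) * \<psi> t < L" using t(1) by (rule order_tendstoD)
  with eventually_gt_at_top[of 1] show ?thesis
  proof eventually_elim
    case (elim p)
    have "lambda1 \<Omega> p \<le> C * \<psi> t powr p"
      using lambda1_le[OF ad, of p] C(2)[of p] elim by simp
    then have "lambda1 \<Omega> p powr (1 / p) \<le> (C * \<psi> t powr p) powr (1 / p)"
      using lambda1_nonneg[OF ad, of p] elim by (intro powr_mono2) auto
    also have "\<dots> = C powr (1 / p) * \<psi> t"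
      using C(1) \<open>\<psi> t > 0\<close> elim by (simp add: powr_mult powr_powr)
    finally show ?case using elim by simp
  qed
qed

text \<open>The inscribed disk: its centre lies on the bisector at distance d from the apex, so it
  is at distance d s from both sides and 1 - d from the arc. These agree for d = 1/(1 + s).\<close>

lemma ball_subset_sector:
  fixes n :: nat
  assumes "n \<ge> 2"
  defines "s \<equiv> sin (pi / (2 * real n))"
  shows "\<exists>c. ball c (s / (1 + s)) \<subseteq> sector n"
proof -
  define \<beta> where "\<beta> = pi / (2 * real n)"
  define d where "d = 1 / (1 + s)"
  have b: "0 < \<beta>" "\<beta> \<le> pi / 4" using assms by (auto simp: \<beta>_def field_simps)
  have s: "s > 0" unfolding s_def \<beta>_def[symmetric] using b by (intro sin_gt_zero) auto
  have d: "d > 0" "d * (1 + s) = 1" "s / (1 + s) = d * s" using s by (auto simp: d_def)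
  define c :: "real^2" where "c = vector [d * cos \<beta>, d * sin \<beta>]"
  have c: "c $ 1 = d * cos \<beta>" "c $ 2 = d * sin \<beta>" by (simp_all add: c_def)
  have "x \<in> sector n" if "x \<in> ball c (s / (1 + s))" for x
  proof -
    define y where "y = x - c"
    have y: "norm y < d * s" using that d(3) by (simp add: y_def dist_norm norm_minus_commute)
    have x: "x $ 1 = d * cos \<beta> + y $ 1" "x $ 2 = d * sin \<beta> + y $ 2" by (simp_all add: y_def c)
    have "norm c = d" using d by (simp add: norm_vec2 c power_mult_distrib flip: distrib_left)
    then have "norm x < 1"
      using norm_triangle_ineq[of c y] y d(2) by (simp add: y_def algebra_simps)
    have "\<bar>y $ 2\<bar> \<le> norm y" by (rule component_le_norm_cart)
    then have x2: "x $ 2 > 0" using y by (simp add: x s_def \<beta>_def)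
    then have "x \<noteq> 0" by auto
    then have "norm x > 0" by simp
    have "(x $ 1 / norm x)\<^sup>2 + (x $ 2 / norm x)\<^sup>2 = 1"
    proof -
      have "(x $ 1 / norm x)\<^sup>2 + (x $ 2 / norm x)\<^sup>2 = ((x $ 1)\<^sup>2 + (x $ 2)\<^sup>2) / (norm x)\<^sup>2"
        by (simp add: power_divide add_divide_distrib)
      then show ?thesis unfolding norm_vec2_sq[symmetric] using \<open>norm x > 0\<close> by simp
    qed
    then obtain \<theta> where \<theta>: "0 \<le> \<theta>" "\<theta> < 2 * pi" "x $ 1 / norm x = cos \<theta>" "x $ 2 / norm x = sin \<theta>"
      using sincos_total_2pi by blast
    then have x': "x $ 1 = norm x * cos \<theta>" "x $ 2 = norm x * sin \<theta>" using \<open>norm x > 0\<close> by (auto simp: field_simps)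
    then have "sin \<theta> > 0" using x2 \<open>norm x > 0\<close> by (simp add: zero_less_mult_iff)
    have "\<theta> < pi"
    proof (rule ccontr)
      assume "\<not> \<theta> < pi"
      then have "sin \<theta> \<le> 0" using \<theta> by (intro sin_le_zero) auto
      then show False using \<open>sin \<theta> > 0\<close> by simp
    qed
    have "\<theta> > 0" using \<open>sin \<theta> > 0\<close> \<theta>(1) by (cases "\<theta> = 0") auto
    \<comment> \<open>This linear form is the signed distance to the side at angle 2\<beta>; it
      equals d s at the centre, so it stays positive on the disk. The other side is handled by the
      second coordinate.\<close>
    have "\<bar>y $ 1 * sin (2 * \<beta>) - y $ 2 * cos (2 * \<beta>)\<bar> \<le> norm y"
    proof -
      have "(y $ 1 * sin (2 * \<beta>) - y $ 2 * cos (2 * \<beta>))\<^sup>2 + (y $ 1 * cos (2 * \<beta>) + y $ 2 * sin (2 * \<beta>))\<^sup>2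
          = ((y $ 1)\<^sup>2 + (y $ 2)\<^sup>2) * ((sin (2 * \<beta>))\<^sup>2 + (cos (2 * \<beta>))\<^sup>2)"
        by (simp only: power2_eq_square) (simp only: algebra_simps)
      then have "(y $ 1 * sin (2 * \<beta>) - y $ 2 * cos (2 * \<beta>))\<^sup>2 + (y $ 1 * cos (2 * \<beta>) + y $ 2 * sin (2 * \<beta>))\<^sup>2
          = (y $ 1)\<^sup>2 + (y $ 2)\<^sup>2" by simp
      then have "(y $ 1 * sin (2 * \<beta>) - y $ 2 * cos (2 * \<beta>))\<^sup>2 \<le> (norm y)\<^sup>2"
        unfolding norm_vec2_sq using zero_le_power2[of "y $ 1 * cos (2 * \<beta>) + y $ 2 * sin (2 * \<beta>)"] by linarith
      then show ?thesis by (simp add: abs_le_square_iff[symmetric])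
    qed
    moreover have "x $ 1 * sin (2 * \<beta>) - x $ 2 * cos (2 * \<beta>) =
       d * s + (y $ 1 * sin (2 * \<beta>) - y $ 2 * cos (2 * \<beta>))"
    proof -
      have "s = sin (2 * \<beta> - \<beta>)" by (simp add: s_def \<beta>_def)
      also have "\<dots> = sin (2 * \<beta>) * cos \<beta> - cos (2 * \<beta>) * sin \<beta>" by (rule sin_diff)
      finally have "d * s = d * (sin (2 * \<beta>) * cos \<beta> - cos (2 * \<beta>) * sin \<beta>)" by simp
      then show ?thesis unfolding x by (simp only: algebra_simps)
    qed
    ultimately have "x $ 1 * sin (2 * \<beta>) - x $ 2 * cos (2 * \<beta>) > 0" using y by linarith
    then have "norm x * sin (2 * \<beta> - \<theta>) > 0"
      by (simp add: x' sin_diff algebra_simps)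
    then have sp: "sin (2 * \<beta> - \<theta>) > 0" using \<open>norm x > 0\<close> by (simp add: zero_less_mult_iff)
    have "\<theta> < 2 * \<beta>"
    proof (rule ccontr)
      assume "\<not> \<theta> < 2 * \<beta>"
      then have "sin (\<theta> - 2 * \<beta>) \<ge> 0" using b \<open>\<theta> < pi\<close> by (intro sin_ge_zero) auto
      moreover have "sin (\<theta> - 2 * \<beta>) = - sin (2 * \<beta> - \<theta>)" by (simp flip: sin_minus)
      ultimately show False using sp by simp
    qed
    then have "\<theta> < pi / real n" by (simp add: \<beta>_def)
    then show ?thesis
      unfolding sector_def using \<open>norm x > 0\<close> \<open>norm x < 1\<close> \<open>\<theta> > 0\<close> x' by blast
  qed
  then show ?thesis by blast
qed

section \<open>The crossing\<close>

lemma sin_ge_cubic: "0 \<le> x \<Longrightarrow> x - x ^ 3 / 6 \<le> sin (x::real)"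
proof -
  assume "0 \<le> x"
  have "(\<Sum>m<3. sin_coeff m * x ^ m) = x"
    by (simp add: numeral_3_eq_3 sin_coeff_def)
  moreover have "fact 3 = (6 :: real)" by (simp add: fact_numeral)
  ultimately have "\<bar>sin x - x\<bar> \<le> x ^ 3 / 6"
    using Maclaurin_sin_bound[of x 3] \<open>0 \<le> x\<close> by (simp add: field_simps)
  then show ?thesis by linarith
qed

text \<open>\<open>n\<close> is just below \<open>\<pi>m\<close>: the inequality for the sine needs \<open>n \<le> \<pi>m - O(1/m)\<close>, and the one
  for the Bessel zero needs \<open>n \<ge> \<pi>m - O(m\<^sup>1\<^sup>/\<^sup>3)\<close>.\<close>

lemma exists_sector:
  fixes m :: nat
  assumes "m \<ge> 2"
  shows "\<exists>n b. n \<ge> 2 \<and> 1 / (2 * real m) < sin (pi / (2 * real n)) \<and> 241 / 100 + pi * real m < b \<and>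
    (\<forall>x. 0 \<le> x \<and> x \<le> b \<longrightarrow> bessel n (x\<^sup>2) > 0)"
proof -
  have pi: "(314159 / 100000) \<le> pi" "pi \<le> (31416 / 10000)" using pi_approx by simp_all
  show ?thesis
  proof (cases "m \<le> 7")
    case True
    \<comment> \<open>For small m the slack of 3 against pi covers the cubic error of the
      sine.\<close>
    define n where "n = 3 * m"
    \<comment> \<open>Rational, and slightly above 2.41 + pi m, so that the six cases below are
      arithmetic of rational numbers.\<close>
    define b where "b = (31416 / 10000) * real m + (2415 / 1000)"
    have m2: "real m \<ge> 2" using assms by simp
    have "1 / (2 * real m) < sin (pi / (2 * real n))"
    proof -
      define M where "M = real m"
      define x where "x = pi / (2 * real n)"
      have x: "x = pi / (6 * M)" by (simp add: x_def n_def M_def)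
      have M: "M \<ge> 2" using m2 by (simp add: M_def)
      have "(314 / 100) / (6 * M) \<le> x" "x \<le> (32 / 10) / (6 * M)"
        unfolding x by (rule divide_right_mono; use M pi in simp)+
      moreover have "x ^ 3 \<le> ((32 / 10) / (6 * M)) ^ 3"
        using calculation(2) M by (intro power_mono) (auto simp: x)
      moreover have "((32 / 10) / (6 * M)) ^ 3 \<le> 1 / (24 * M)"
        using M mult_mono[of 2 M 2 M] by (simp add: field_simps power3_eq_cube)
      moreover define w where "w = 1 / M"
      then have "(314 / 100) / (6 * M) = 157 / 300 * w" "1 / (24 * M) = w / 24" "1 / (2 * M) = w / 2" "w > 0"
        using M by auto
      ultimately have "157 / 300 * w \<le> x" "x ^ 3 \<le> w / 24" "1 / (2 * M) = w / 2" "w > 0"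
        by auto
      then have "1 / (2 * M) < x - x ^ 3 / 6" by linarith
      also have "\<dots> \<le> sin x" by (rule sin_ge_cubic) (use M in \<open>simp add: x\<close>)
      finally show ?thesis by (simp add: x_def M_def)
    qed
    moreover have "241 / 100 + pi * real m < b"
    proof -
      have "pi * real m \<le> (31416 / 10000) * real m" using pi by (intro mult_right_mono) auto
      then show ?thesis by (simp add: b_def)
    qed
    moreover have "bessel n (x\<^sup>2) > 0" if x: "0 \<le> x" "x \<le> b" for x
    proof -
      have "m = 2 \<or> m = 3 \<or> m = 4 \<or> m = 5 \<or> m = 6 \<or> m = 7" using assms True by auto
      \<comment> \<open>The witnesses are rounded from the extreme admissible values: K up from
        sqrt(1 - (n^2 - 1/4)/b^2), \<kappa> down from sqrt(2/n), and \<beta> up from K (b - n +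
        1/(7n)) - pi/2. A rational lower bound replaces pi.\<close>
      then obtain K \<beta> \<kappa> :: real where "K > 0" "b\<^sup>2 * (1 - K\<^sup>2) \<le> (real n)\<^sup>2 - 1 / 4" "0 \<le> \<beta>" "\<beta> \<le> 1"
        "K * (b - real n + 1 / (7 * real n)) \<le> (314159 / 100000) / 2 + \<beta>" "\<kappa> > 0" "\<kappa>\<^sup>2 * real n \<le> 2"
        "K * \<beta> * (1 + \<kappa>) < \<kappa> * (1 - \<beta>\<^sup>2 / 2)"
      proof (elim disjE)
        assume "m = 2"
        then show ?thesis
          by (intro that[of "727 / 1000" "41 / 100" "577 / 1000"]) (simp_all add: b_def n_def power2_eq_square)
      next
        assume "m = 3"
        then show ?thesis
          by (intro that[of "163 / 250" "3 / 10" "471 / 1000"]) (simp_all add: b_def n_def power2_eq_square)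
      next
        assume "m = 4"
        then show ?thesis
          by (intro that[of "3 / 5" "23 / 100" "51 / 125"]) (simp_all add: b_def n_def power2_eq_square)
      next
        assume "m = 5"
        then show ?thesis
          by (intro that[of "281 / 500" "19 / 100" "73 / 200"]) (simp_all add: b_def n_def power2_eq_square)
      next
        assume "m = 6"
        then show ?thesis
          by (intro that[of "533 / 1000" "9 / 50" "333 / 1000"]) (simp_all add: b_def n_def power2_eq_square)
      next
        assume "m = 7"
        then show ?thesis
          by (intro that[of "51 / 100" "17 / 100" "77 / 250"]) (simp_all add: b_def n_def power2_eq_square)
      qed
      then show ?thesis
        using assms pi x by (intro bessel_pos[of n b K \<beta> \<kappa>]) (auto simp: n_def b_def)
    qed
    ultimately show ?thesis using assms by (intro exI[of _ n] exI[of _ b]) (auto simp: n_def)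
  next
    case False
    define M where "M = real m"
    have M: "M \<ge> 8" using False by (simp add: M_def)
    have piM: "(2513 / 100) \<le> pi * M" using mult_mono[of "(314159 / 100000)" pi 8 M] M pi by simp
    \<comment> \<open>The margin 1/20 yields 2 M x \<ge> 1 + 1/(80 M) for x = pi/(2n), which
      outweighs the cubic term of the sine, of order 1/M^2.\<close>
    define n where "n = nat \<lfloor>pi * M - 1 / 20\<rfloor>"
    define N where "N = real n"
    have N: "N \<le> pi * M - 1 / 20" "pi * M - 1 / 20 < N + 1"
      using piM by (auto simp: N_def n_def)
    have "N > 24" using N piM by linarith
    then have "n \<ge> 25" by (simp add: N_def)
    then have N25: "N \<ge> 25" by (simp add: N_def)
    define b where "b = pi * M + (2415 / 1000)"
    have bN: "b \<le> N + (3465 / 1000)" "N < b" using N by (auto simp: b_def)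
    have "1 / (2 * real m) < sin (pi / (2 * real n))"
    proof -
      define x where "x = pi / (2 * N)"
      have x: "x > 0" using N25 by (simp add: x_def)
      define r where "r = 1 / M"
      have r: "r > 0" "r \<le> 1 / 8" "M * r = 1" using M by (auto simp: r_def field_simps)
      have lo: "1 + r / 80 \<le> 2 * M * x"
      proof -
        have "N * (1 + r / 80) \<le> (pi * M - 1 / 20) * (1 + r / 80)"
          using N r by (intro mult_right_mono) auto
        also have "\<dots> = pi * M + pi * (M * r) / 80 - 1 / 20 - r / 1600"
          by (simp add: algebra_simps)
        also have "\<dots> \<le> pi * M" using pi r by simp
        finally show ?thesis using N25 by (simp add: x_def field_simps)
      qed
      have hi: "2 * M * x \<le> (105 / 100)"
      proof -
        have "pi * M \<le> (105 / 100) * N" using N N25 by simp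
        then show ?thesis using N25 by (simp add: x_def field_simps)
      qed
      have "(2 * M * x) ^ 3 \<le> (105 / 100) ^ 3" using hi x M by (intro power_mono) auto
      also have "\<dots> \<le> (12 / 10 :: real)" by (simp add: power3_eq_cube)
      finally have "(2 * M * x) ^ 3 * (r\<^sup>2 / 24) \<le> (12 / 10) * (r\<^sup>2 / 24)"
        by (rule mult_right_mono) simp
      moreover have "(2 * M * x) ^ 3 * (r\<^sup>2 / 24) = 2 * M * (x ^ 3 / 6) * (M * r)\<^sup>2"
        by (simp add: power2_eq_square power3_eq_cube)
      moreover have "(M * r)\<^sup>2 = 1" using r(3) by simp
      moreover have "r\<^sup>2 \<le> r * (1 / 8)"
        unfolding power2_eq_square using r by (intro mult_left_mono) auto
      ultimately have "2 * M * (x ^ 3 / 6) \<le> (12 / 10) * (r\<^sup>2 / 24)" "r\<^sup>2 \<le> r * (1 / 8)"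
        by simp_all
      then have "2 * M * (x ^ 3 / 6) < r / 80" using r(1) by linarith
      then have "1 < 2 * M * (x - x ^ 3 / 6)" using lo by (simp add: algebra_simps)
      then have "1 / (2 * M) < x - x ^ 3 / 6" using M by (simp add: field_simps)
      also have "\<dots> \<le> sin x" by (rule sin_ge_cubic) (use x in simp)
      finally show ?thesis by (simp add: x_def M_def N_def)
    qed
    moreover have "241 / 100 + pi * real m < b" by (simp add: b_def M_def)
    moreover have "bessel n (x\<^sup>2) > 0" if x: "0 \<le> x" "x \<le> b" for x
    \<comment> \<open>As b exceeds N by at most 3.465, the squared frequency to be dominated is
      about 6.93/N; 7/N covers it. \<kappa> is the largest value allowed, so K/\<kappa> is the
      constant sqrt(7/2). The phase bound behind \<beta> is worst at N = 25.\<close>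
    proof (rule bessel_pos[where b = b and K = "sqrt (7 / N)" and \<beta> = "3 / 10" and \<kappa> = "sqrt (2 / N)"])
      define K \<kappa> where "K = sqrt (7 / N)" and "\<kappa> = sqrt (2 / N)"
      have K: "K > 0" "K\<^sup>2 = 7 / N" "\<kappa> > 0" "\<kappa>\<^sup>2 = 2 / N" using N25 by (auto simp: K_def \<kappa>_def)
      show "0 < sqrt (7 / N)" "0 < sqrt (2 / N)" using N25 by auto
      show "(sqrt (2 / N))\<^sup>2 * real n \<le> 2" using N25 by (simp add: N_def)
      show "b\<^sup>2 * (1 - (sqrt (7 / N))\<^sup>2) \<le> (real n)\<^sup>2 - 1 / 4"
      proof -
        have "b\<^sup>2 * (1 - 7 / N) \<le> (N + (3465 / 1000))\<^sup>2 * (1 - 7 / N)"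
          using bN N25 by (intro mult_right_mono power_mono) auto
        also have "\<dots> = N\<^sup>2 - (7 / 100) * N - (36503775 / 1000000) - (84043575 / 1000000) / N"
          using N25 by (simp add: field_simps power2_eq_square)
        also have "\<dots> \<le> N\<^sup>2 - 1 / 4"
        proof -
          have "(84043575 / 1000000) / N \<ge> 0" using N25 by simp
          then show ?thesis using N25 by linarith
        qed
        finally show ?thesis using N25 by (simp add: N_def)
      qed
      have "K\<^sup>2 \<le> 7 / 25" unfolding K(2) using N25 by (intro divide_left_mono) auto
      also have "7 / 25 \<le> ((5292 / 10000) :: real)\<^sup>2" by (simp add: power2_eq_square)
      finally have "K\<^sup>2 \<le> (5292 / 10000)\<^sup>2" .
      then have K1: "K \<le> (5292 / 10000)" by (rule power2_le_imp_le) simp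
      have "\<kappa>\<^sup>2 \<le> 2 / 25" unfolding K(4) using N25 by (intro divide_left_mono) auto
      also have "2 / 25 \<le> ((283 / 1000) :: real)\<^sup>2" by (simp add: power2_eq_square)
      finally have "\<kappa>\<^sup>2 \<le> (283 / 1000)\<^sup>2" .
      then have k1: "\<kappa> \<le> (283 / 1000)" by (rule power2_le_imp_le) simp
      have "K\<^sup>2 = 7 / 2 * \<kappa>\<^sup>2" unfolding K(2,4) by simp
      also have "\<dots> \<le> (1871 / 1000)\<^sup>2 * \<kappa>\<^sup>2" by (intro mult_right_mono) (auto simp: power2_eq_square)
      finally have "K\<^sup>2 \<le> ((1871 / 1000) * \<kappa>)\<^sup>2" unfolding power_mult_distrib .
      then have Kk: "K \<le> (1871 / 1000) * \<kappa>" by (rule power2_le_imp_le) (use K in simp)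
      have "1 / (7 * N) \<le> 1 / 175" using N25 by (simp add: field_simps)
      then have "b - N + 1 / (7 * N) \<le> 34708 / 10000" using bN(1) by linarith
      then have "K * (b - N + 1 / (7 * N)) \<le> (5292 / 10000) * (34708 / 10000)"
        by (rule mult_mono[OF K1]) (use bN N25 in auto)
      then have "K * (b - N + 1 / (7 * N)) \<le> pi / 2 + 3 / 10" using pi by simp
      then show "sqrt (7 / N) * (b - real n + 1 / (7 * real n)) \<le> pi / 2 + 3 / 10"
        by (simp add: K_def N_def)
      have "K * (1 + \<kappa>) \<le> ((1871 / 1000) * \<kappa>) * (1283 / 1000)" using Kk k1 K by (intro mult_mono) auto
      then have "K * (3 / 10) * (1 + \<kappa>) < \<kappa> * (1 - (3 / 10)\<^sup>2 / 2)"
        using K by (simp add: power2_eq_square)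
      then show "sqrt (7 / N) * (3 / 10) * (1 + sqrt (2 / N)) < sqrt (2 / N) * (1 - (3 / 10)\<^sup>2 / 2)"
        by (simp add: K_def \<kappa>_def)
    qed (use x bN \<open>n \<ge> 25\<close> in \<open>auto simp: N_def\<close>)
    ultimately show ?thesis using \<open>n \<ge> 25\<close> by (intro exI[of _ n] exI[of _ b]) auto
  qed
qed

text \<open>Let s be the infimum of the p with T < g. Points of that set converge to s from above,
  where monotonicity gives s T(s) \<le> q T(q) \<le> q g(q); points below s are outside the set, so
  q g(q) \<le> q T(q) \<le> s T(s). Only g is passed to the limit, along subsequences.\<close>

lemma monotone_continuous_crossing:
  fixes T g :: "real \<Rightarrow> real"
  assumes mono: "\<And>p q. 2 \<le> p \<Longrightarrow> p \<le> q \<Longrightarrow> p * T p \<le> q * T q"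
    and sub: "\<And>q p. q \<longlonglongrightarrow> p \<Longrightarrow> (\<And>j. 2 \<le> q j) \<Longrightarrow>
      \<exists>r. strict_mono (r :: nat \<Rightarrow> nat) \<and> (\<lambda>j. g (q (r j))) \<longlonglongrightarrow> g p"
    and start: "g 2 < T 2" and stop: "P \<ge> 2" "T P < g P"
  shows "\<exists>s>2. T s = g s"
proof -
  define S where "S = {p. 2 \<le> p \<and> T p < g p}"
  define s where "s = Inf S"
  have "P \<in> S" using stop by (simp add: S_def)
  have bdd: "bdd_below S" by (auto simp: S_def bdd_below_def)
  have s2: "s \<ge> 2" unfolding s_def using \<open>P \<in> S\<close> by (intro cInf_greatest) (auto simp: S_def)
  have upper: "T s \<le> g s"
  proof -
    have "\<exists>q\<in>S. q < s + 1 / real (Suc j)" for j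
      using cInf_lessD[of S "s + 1 / real (Suc j)"] \<open>P \<in> S\<close> by (auto simp: s_def)
    then obtain q where q: "\<And>j. q j \<in> S" "\<And>j. q j < s + 1 / real (Suc j)" by metis
    have qs: "s \<le> q j" for j unfolding s_def by (rule cInf_lower[OF q(1) bdd])
    have "q \<longlonglongrightarrow> s"
    proof (rule tendsto_sandwich[of "\<lambda>_. s" q _ "\<lambda>j. s + 1 / real (Suc j)"])
      show "(\<lambda>j. s + 1 / real (Suc j)) \<longlonglongrightarrow> s"
        using tendsto_add[OF tendsto_const LIMSEQ_Suc[OF lim_1_over_n], of s] by simp
    qed (use qs q(2) in \<open>auto intro!: always_eventually less_imp_le\<close>)
    have q2: "2 \<le> q j" for j using q(1) by (simp add: S_def)
    obtain r where r: "strict_mono (r :: nat \<Rightarrow> nat)" "(\<lambda>j. g (q (r j))) \<longlonglongrightarrow> g s"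
      using sub[OF \<open>q \<longlonglongrightarrow> s\<close> q2] by blast
    have qr: "(\<lambda>j. q (r j)) \<longlonglongrightarrow> s"
      using LIMSEQ_subseq_LIMSEQ[OF \<open>q \<longlonglongrightarrow> s\<close> r(1)] by (simp add: o_def)
    have "s * T s \<le> s * g s"
    proof (rule LIMSEQ_le_const[OF tendsto_mult[OF qr r(2)]], intro exI allI impI)
      fix j
      have "s * T s \<le> q (r j) * T (q (r j))" by (rule mono[OF s2 qs])
      also have "\<dots> \<le> q (r j) * g (q (r j))"
        using q(1)[of "r j"] by (intro mult_left_mono) (auto simp: S_def)
      finally show "s * T s \<le> q (r j) * g (q (r j))" .
    qed
    then show ?thesis using s2 by simp
  qed
  then have "s \<noteq> 2" using start by auto
  then have "s > 2" using s2 by simp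
  have lower: "g s \<le> T s"
  proof -
    \<comment> \<open>Approaches s from below and stays at or above 2, where the hypotheses
      apply.\<close>
    define q where "q = (\<lambda>j. s - (s - 2) * (1 / real (Suc j)))"
    have "(1::real) / real (Suc j) \<le> 1" for j by simp
    then have q2: "2 \<le> q j" for j
      using mult_left_mono[of "1 / real (Suc j)" 1 "s - 2"] \<open>s > 2\<close> by (simp add: q_def)
    have qs: "q j < s" for j using \<open>s > 2\<close> by (simp add: q_def)
    have "q \<longlonglongrightarrow> s - (s - 2) * 0"
      unfolding q_def by (intro tendsto_diff tendsto_mult tendsto_const LIMSEQ_Suc[OF lim_1_over_n])
    then have "q \<longlonglongrightarrow> s" by simp
    then obtain r where r: "strict_mono (r :: nat \<Rightarrow> nat)" "(\<lambda>j. g (q (r j))) \<longlonglongrightarrow> g s"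
      using sub[OF \<open>q \<longlonglongrightarrow> s\<close> q2] by blast
    have qr: "(\<lambda>j. q (r j)) \<longlonglongrightarrow> s"
      using LIMSEQ_subseq_LIMSEQ[OF \<open>q \<longlonglongrightarrow> s\<close> r(1)] by (simp add: o_def)
    have "s * g s \<le> s * T s"
    proof (rule LIMSEQ_le_const2[OF tendsto_mult[OF qr r(2)]], intro exI allI impI)
      fix j
      have "q (r j) \<notin> S" using cInf_lower[OF _ bdd, of "q (r j)"] qs[of "r j"] by (auto simp: s_def)
      then have "g (q (r j)) \<le> T (q (r j))" using q2[of "r j"] by (simp add: S_def)
      then have "q (r j) * g (q (r j)) \<le> q (r j) * T (q (r j))"
        using q2[of "r j"] by (intro mult_left_mono) auto
      also have "\<dots> \<le> s * T s" by (rule mono[OF q2 less_imp_le[OF qs]])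
      finally show "q (r j) * g (q (r j)) \<le> s * T s" .
    qed
    then show ?thesis using s2 by simp
  qed
  show ?thesis using upper lower \<open>s > 2\<close> by force
qed

theorem theorem1p4:
  fixes k :: nat
  assumes "k \<ge> 3"
  shows "\<exists>(n::nat) (pk::real). n \<ge> 1 \<and> pk > 2 \<and> kth_radial_eigenvalue pk k (tau n pk)"
proof -
  define m where "m = k - 1"
  have m: "m \<ge> 2" "k = Suc m" using assms by (auto simp: m_def)
  obtain n b where n: "n \<ge> 2" "1 / (2 * real m) < sin (pi / (2 * real n))" "241 / 100 + pi * real m < b"
    "\<And>x. 0 \<le> x \<and> x \<le> b \<Longrightarrow> bessel n (x\<^sup>2) > 0"
    using exists_sector[OF m(1)] by blast
  define s where "s = sin (pi / (2 * real n))"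
  define \<rho> where "\<rho> = s / (1 + s)"
  have "0 < 1 / (2 * real m)" using m by simp
  then have s: "s > 0" "1 / (2 * real m) < s" using n(2) unfolding s_def by linarith+
  have \<rho>: "\<rho> > 0" "1 / \<rho> = 1 + 1 / s" using s by (auto simp: \<rho>_def field_simps)
  obtain c where c: "ball c \<rho> \<subseteq> sector n"
    using ball_subset_sector[OF n(1)] by (auto simp: \<rho>_def s_def)
  have "1 / s < 2 * real m" using s m by (simp add: field_simps)
  then have L: "1 / \<rho> < 2 * real k - 1" using \<rho> m by simp
  \<comment> \<open>The midpoint separates T from the k-th zero for all large p.\<close>
  define L where "L = (1 / \<rho> + (2 * real k - 1)) / 2"
  have L': "1 / \<rho> < L" "L < 2 * real k - 1" using L by (auto simp: L_def)
  \<comment> \<open>Any admissible parameters serve here: the bump only shows that the sector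
    carries a test function.\<close>
  have par: "0 < \<rho> / 4" "2 * (\<rho> / 4) < \<rho>" "1 < (2::real)" using \<rho> by auto
  obtain u0 D0 where ad: "admissible (sector n) u0 D0"
    using bump_admissible[OF par c] by blast
  define T where "T = (\<lambda>p. lambda1 (sector n) p powr (1 / p))"
  have start: "nu 2 k < T 2"
  proof -
    have "pi * real m \<ge> 0" by simp
    then have "b > 0" using n(3) by linarith
    have "b\<^sup>2 \<le> lambda1 (sector n) 2"
      by (rule lambda1_ge[OF ad], rule rayleigh_2_sector_ge[OF n(1) \<open>b > 0\<close>]) (use n(4) in auto)
    then have "(b\<^sup>2) powr (1 / 2) \<le> T 2" unfolding T_def by (intro powr_mono2) auto
    then have "b \<le> T 2" using \<open>b > 0\<close> by (simp add: powr_half_sqrt)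
    then show ?thesis using nu_2_le[of m] n(3) unfolding m(2) by linarith
  qed
  have "\<forall>\<^sub>F p in at_top. T p < L"
    unfolding T_def by (rule lambda1_powr_le_inradius[OF c \<rho>(1) L'(1)])
  moreover have "\<forall>\<^sub>F p in at_top. L < nu p k"
  proof -
    define R where "R = 2 * real k - 1"
    have "R > 0" using assms by (simp add: R_def)
    have "filterlim (\<lambda>p::real. p - 1) at_top at_top"
      using filterlim_tendsto_add_at_top[OF tendsto_const filterlim_ident, of "- 1 :: real"] by simp
    then have "((\<lambda>p::real. - 3 / (p - 1)) \<longlongrightarrow> 0) at_top"
      by (intro tendsto_divide_0[OF tendsto_const] filterlim_at_top_imp_at_infinity)
    then have "((\<lambda>p. R * R powr (- 3 / (p - 1))) \<longlongrightarrow> R * R powr 0) at_top"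
      using \<open>R > 0\<close> by (intro tendsto_mult tendsto_powr tendsto_const) auto
    then have "\<forall>\<^sub>F p in at_top. L < R * R powr (- 3 / (p - 1))"
      by (rule order_tendstoD) (use L' \<open>R > 0\<close> in \<open>simp add: R_def\<close>)
    with eventually_ge_at_top[of 2] show ?thesis
    proof eventually_elim
      case (elim p)
      have "R * R powr (- 3 / (p - 1)) \<le> nu p k"
        unfolding R_def by (rule nu_lower_bound) (use elim assms in auto)
      then show ?case using elim by linarith
    qed
  qed
  ultimately have "\<forall>\<^sub>F p in at_top. 2 \<le> p \<and> T p < nu p k"
    using eventually_ge_at_top[of 2] by eventually_elim auto
  then obtain P where P: "2 \<le> P" "T P < nu P k"
    using eventually_happens'[OF trivial_limit_at_top_linorder] by force
  obtain p where p: "p > 2" "T p = nu p k"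
  proof -
    have "\<exists>s>2. T s = nu s k"
    proof (rule monotone_continuous_crossing[where P = P])
      show "p * T p \<le> q * T q" if "2 \<le> p" "p \<le> q" for p q
        unfolding T_def by (rule lambda1_powr_mono[OF ad]) (use that in auto)
      show "\<exists>r. strict_mono (r :: nat \<Rightarrow> nat) \<and> (\<lambda>j. nu (q (r j)) k) \<longlonglongrightarrow> nu p k"
        if "q \<longlonglongrightarrow> p" "\<And>j. 2 \<le> q j" for q p
        using nu_subsequence[OF that] by metis
    qed (use start P in auto)
    then show ?thesis using that by blast
  qed
  have "tau n p = nu p k powr p"
    using lambda1_nonneg[OF ad, of p] p by (simp flip: p(2) add: T_def powr_powr tau_def)
  then have "kth_radial_eigenvalue p k (tau n p)"
    using kth_radial_eigenvalue_nu[of p k] p assms by simp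
  then show ?thesis using p n(1) by (intro exI[of _ n] exI[of _ p]) auto
qed

end
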